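(* Let $n\ge1$, let $(M^{2n+1},\eta,H)$ be a smooth autonomous contact Hamiltonian system, and let $\Phi:M\to M$ be a contact canonoid map for it (no invertibility of $\Phi$ is assumed). Set $X=X_H$, $a=R(H)$, $\alpha=\Phi^*\eta$, $K=-\alpha(X)$. On the open set $V=\{x\in M:K(x)\neq0\}$ define $$\sigma=-\frac{\alpha}{K},\qquad \mathcal D=\ker(\eta|_V).$$ Then there exists a unique smooth endomorphism $N:TV\to TV$ such that $$\eta(NY)=0,\qquad d\eta(NY,Z)=-H\,d\sigma(Y,Z)$$ for every vector field $Y$ on $V$ and every section $Z$ of $\mathcal D$. Moreover, $$NX=0,\qquad \mathcal L_XN=0,$$ and $N_x=0$ at every point $x\in V$ for which $H(x)=0$. On the open subset $U=\{x\in M:H(x)K(x)\neq0\}$, put $\lambda=-\eta/H$. Then $N$ is on $U$ equivalently characterized by $$\lambda(NY)=0,\qquad d\lambda(NY,Z)=d\sigma(Y,Z)$$ for all vector fields $Y,Z$ on $U$. For every integer $k\ge1$, the functions $$I_k=\operatorname{tr}(N^k),\qquad D_k=H\operatorname{tr}(N^k)$$ are smooth on $V$ and satisfy $$X(I_k)=0,\qquad X(D_k)=-aD_k.$$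
   Context: A contact Hamiltonian system $(M^{2n+1},\eta,H)$ is a smooth manifold $M$ of dimension $2n+1$ with a contact form $\eta$ (i.e. $\eta\wedge(d\eta)^n$ is nowhere zero) and a smooth function $H$. The Reeb vector field $R$ is defined by $\eta(R)=1$, $\iota_Rd\eta=0$. The contact Hamiltonian vector field $X_H$ is defined by the convention $\eta(X_H)=-H$, $\iota_{X_H}d\eta=dH-R(H)\eta$. A smooth map $\Phi:M\to M$ is a contact canonoid map for $(M,\eta,H)$ if there exists $b\in C^\infty(M)$ with $\mathcal L_{X_H}(\Phi^*\eta)=-b\,\Phi^*\eta$. "Endomorphism $TV\to TV$" means a vector bundle endomorphism covering the identity, i.e. a $(1,1)$-tensor field. *)

theory Defs
  imports "HOL-Analysis.Analysis"
begin

section \<open>Smooth maps between open subsets of normed spaces\<close>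

primrec Ck_on :: "nat \<Rightarrow> ('e::real_normed_vector \<Rightarrow> 'f::real_normed_vector) \<Rightarrow> 'e set \<Rightarrow> bool" where
  "Ck_on 0 f S \<longleftrightarrow> continuous_on S f"
| "Ck_on (Suc k) f S \<longleftrightarrow> (\<forall>x\<in>S. f differentiable (at x)) \<and>
     (\<forall>v. Ck_on k (\<lambda>x. frechet_derivative f (at x) v) S)"

text \<open>Only used for open sets \<open>S\<close>.\<close>

definition smooth_on :: "('e::real_normed_vector \<Rightarrow> 'f::real_normed_vector) \<Rightarrow> 'e set \<Rightarrow> bool" where
  "smooth_on f S \<longleftrightarrow> (\<forall>k. Ck_on k f S)"


section \<open>Smooth manifolds\<close>

text \<open>
  The manifold is a whole type \<open>'a\<close>, Hausdorff and second countable by its sort, with an atlas of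
  charts into \<open>real ^ 'm\<close>; its dimension is \<open>CARD('m)\<close>. A chart is given by its domain and its
  coordinate map, whose values outside the domain are irrelevant. The atlas need not be maximal.
\<close>

type_synonym ('a, 'm) chart = "'a set \<times> ('a \<Rightarrow> real ^ 'm)"

abbreviation chart_dom :: "('a, 'm) chart \<Rightarrow> 'a set" where
  "chart_dom c \<equiv> fst c"

abbreviation chart_map :: "('a, 'm) chart \<Rightarrow> 'a \<Rightarrow> real ^ 'm" where
  "chart_map c \<equiv> snd c"

definition chart_inv :: "('a, 'm) chart \<Rightarrow> real ^ 'm \<Rightarrow> 'a" where
  "chart_inv c = inv_into (chart_dom c) (chart_map c)"

definition is_chart :: "('a::topological_space, 'm::finite) chart \<Rightarrow> bool" where
  "is_chart c \<longleftrightarrow> open (chart_dom c) \<and> open (chart_map c ` chart_dom c) \<and>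
     homeomorphism (chart_dom c) (chart_map c ` chart_dom c) (chart_map c) (chart_inv c)"

definition smooth_atlas ::
  "('a::{t2_space,second_countable_topology}, 'm::finite) chart set \<Rightarrow> bool" where
  "smooth_atlas A \<longleftrightarrow> (\<forall>c\<in>A. is_chart c) \<and> (\<Union>c\<in>A. chart_dom c) = UNIV \<and>
     (\<forall>c\<in>A. \<forall>d\<in>A. smooth_on (chart_map d \<circ> chart_inv c)
                    (chart_map c ` (chart_dom c \<inter> chart_dom d)))"

text \<open>
  A preferred chart is chosen at every point \<open>p\<close>, and the tangent space at \<open>p\<close> is identified with
  \<open>real ^ 'm\<close> through this chart. Hence vector fields, one-forms and \<open>(1,1)\<close>-tensor fields are
  functions \<open>'a \<Rightarrow> real ^ 'm\<close>, \<open>'a \<Rightarrow> real ^ 'm \<Rightarrow> real\<close> and \<open>'a \<Rightarrow> real ^ 'm \<Rightarrow> real ^ 'm\<close>.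
  The preferred chart may jump from point to point, so these functions must never be differentiated
  directly, but only after being expressed in one fixed chart (\<open>vf_rep\<close>, \<open>form_rep\<close>, \<open>endo_rep\<close>).
\<close>

definition chart_at :: "('a, 'm) chart set \<Rightarrow> 'a \<Rightarrow> ('a, 'm) chart" where
  "chart_at A p = (SOME c. c \<in> A \<and> p \<in> chart_dom c)"

definition base_pt :: "('a, 'm) chart set \<Rightarrow> 'a \<Rightarrow> real ^ 'm" where
  "base_pt A p = chart_map (chart_at A p) p"

text \<open>Converts the coordinates in \<open>c\<close> of a tangent vector at \<open>q\<close> into its coordinates in \<open>d\<close>.\<close>

definition coord_change :: "('a, 'm::finite) chart \<Rightarrow> ('a, 'm) chart \<Rightarrow> 'a \<Rightarrow> real ^ 'm \<Rightarrow> real ^ 'm" where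
  "coord_change c d q = frechet_derivative (chart_map d \<circ> chart_inv c) (at (chart_map c q))"

definition vf_rep ::
  "('a, 'm::finite) chart set \<Rightarrow> ('a, 'm) chart \<Rightarrow> ('a \<Rightarrow> real ^ 'm) \<Rightarrow> real ^ 'm \<Rightarrow> real ^ 'm" where
  "vf_rep A c Y y = (let q = chart_inv c y in coord_change (chart_at A q) c q (Y q))"

definition form_rep ::
  "('a, 'm::finite) chart set \<Rightarrow> ('a, 'm) chart \<Rightarrow> ('a \<Rightarrow> real ^ 'm \<Rightarrow> real) \<Rightarrow> real ^ 'm \<Rightarrow> real ^ 'm \<Rightarrow> real" where
  "form_rep A c \<omega> y v = (let q = chart_inv c y in \<omega> q (coord_change c (chart_at A q) q v))"

definition endo_rep ::
  "('a, 'm::finite) chart set \<Rightarrow> ('a, 'm) chart \<Rightarrow> ('a \<Rightarrow> real ^ 'm \<Rightarrow> real ^ 'm) \<Rightarrow> real ^ 'm \<Rightarrow> real ^ 'm \<Rightarrow> real ^ 'm" where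
  "endo_rep A c N y v = (let q = chart_inv c y in
     coord_change (chart_at A q) c q (N q (coord_change c (chart_at A q) q v)))"


section \<open>Smooth objects on an open subset \<open>W\<close>\<close>

definition smooth_fun :: "('a, 'm::finite) chart set \<Rightarrow> 'a set \<Rightarrow> ('a \<Rightarrow> real) \<Rightarrow> bool" where
  "smooth_fun A W f \<longleftrightarrow> (\<forall>c\<in>A. smooth_on (f \<circ> chart_inv c) (chart_map c ` (chart_dom c \<inter> W)))"

definition smooth_vf :: "('a, 'm::finite) chart set \<Rightarrow> 'a set \<Rightarrow> ('a \<Rightarrow> real ^ 'm) \<Rightarrow> bool" where
  "smooth_vf A W Y \<longleftrightarrow> (\<forall>c\<in>A. smooth_on (vf_rep A c Y) (chart_map c ` (chart_dom c \<inter> W)))"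

definition smooth_form :: "('a, 'm::finite) chart set \<Rightarrow> 'a set \<Rightarrow> ('a \<Rightarrow> real ^ 'm \<Rightarrow> real) \<Rightarrow> bool" where
  "smooth_form A W \<omega> \<longleftrightarrow> (\<forall>p\<in>W. linear (\<omega> p)) \<and>
     (\<forall>c\<in>A. \<forall>v. smooth_on (\<lambda>y. form_rep A c \<omega> y v) (chart_map c ` (chart_dom c \<inter> W)))"

definition smooth_endo ::
  "('a, 'm::finite) chart set \<Rightarrow> 'a set \<Rightarrow> ('a \<Rightarrow> real ^ 'm \<Rightarrow> real ^ 'm) \<Rightarrow> bool" where
  "smooth_endo A W N \<longleftrightarrow> (\<forall>p\<in>W. linear (N p)) \<and>
     (\<forall>c\<in>A. \<forall>v. smooth_on (\<lambda>y. endo_rep A c N y v) (chart_map c ` (chart_dom c \<inter> W)))"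

definition smooth_self_map ::
  "('a::topological_space, 'm::finite) chart set \<Rightarrow> ('a \<Rightarrow> 'a) \<Rightarrow> bool" where
  "smooth_self_map A \<Phi> \<longleftrightarrow> continuous_on UNIV \<Phi> \<and>
     (\<forall>c\<in>A. \<forall>d\<in>A. smooth_on (chart_map d \<circ> \<Phi> \<circ> chart_inv c)
                    (chart_map c ` (chart_dom c \<inter> \<Phi> -` chart_dom d)))"


section \<open>Calculus\<close>

text \<open>
  All derivatives at \<open>p\<close> are taken in the preferred chart at \<open>p\<close>, in which the coordinates of a
  tangent vector at \<open>p\<close> are the vector itself. \<open>dfun A f p v\<close> is \<open>df\<^sub>p(v)\<close>; for a vector field \<open>X\<close>,
  the function \<open>X(f)\<close> is \<open>\<lambda>p. dfun A f p (X p)\<close>.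
\<close>

definition dfun :: "('a, 'm::finite) chart set \<Rightarrow> ('a \<Rightarrow> real) \<Rightarrow> 'a \<Rightarrow> real ^ 'm \<Rightarrow> real" where
  "dfun A f p = frechet_derivative (f \<circ> chart_inv (chart_at A p)) (at (base_pt A p))"

definition tangent_map ::
  "('a, 'm::finite) chart set \<Rightarrow> ('a \<Rightarrow> 'a) \<Rightarrow> 'a \<Rightarrow> real ^ 'm \<Rightarrow> real ^ 'm" where
  "tangent_map A \<Phi> p =
     frechet_derivative (chart_map (chart_at A (\<Phi> p)) \<circ> \<Phi> \<circ> chart_inv (chart_at A p)) (at (base_pt A p))"

definition pullback ::
  "('a, 'm::finite) chart set \<Rightarrow> ('a \<Rightarrow> 'a) \<Rightarrow> ('a \<Rightarrow> real ^ 'm \<Rightarrow> real) \<Rightarrow> 'a \<Rightarrow> real ^ 'm \<Rightarrow> real" where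
  "pullback A \<Phi> \<omega> p v = \<omega> (\<Phi> p) (tangent_map A \<Phi> p v)"

text \<open>
  Exterior derivative of a one-form, with the normalisation
  \<open>d\<omega>(Y,Z) = Y(\<omega>(Z)) - Z(\<omega>(Y)) - \<omega>([Y,Z])\<close>;
  in coordinates, \<open>d\<omega>(u,v) = (\<partial>\<^sub>i \<omega>\<^sub>j - \<partial>\<^sub>j \<omega>\<^sub>i) u\<^sup>i v\<^sup>j\<close>.
\<close>

definition ext_deriv ::
  "('a, 'm::finite) chart set \<Rightarrow> ('a \<Rightarrow> real ^ 'm \<Rightarrow> real) \<Rightarrow> 'a \<Rightarrow> real ^ 'm \<Rightarrow> real ^ 'm \<Rightarrow> real" where
  "ext_deriv A \<omega> p u v =
     frechet_derivative (\<lambda>y. form_rep A (chart_at A p) \<omega> y v) (at (base_pt A p)) u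
   - frechet_derivative (\<lambda>y. form_rep A (chart_at A p) \<omega> y u) (at (base_pt A p)) v"

text \<open>
  Lie derivatives along a vector field \<open>X\<close>, as tensor fields given by the usual coordinate
  expressions
  \<open>(L\<^sub>X \<omega>)\<^sub>j = X\<^sup>k \<partial>\<^sub>k \<omega>\<^sub>j + \<omega>\<^sub>k \<partial>\<^sub>j X\<^sup>k\<close> and
  \<open>(L\<^sub>X N)\<^sup>i\<^sub>j = X\<^sup>k \<partial>\<^sub>k N\<^sup>i\<^sub>j - N\<^sup>k\<^sub>j \<partial>\<^sub>k X\<^sup>i + N\<^sup>i\<^sub>k \<partial>\<^sub>j X\<^sup>k\<close>.
  Equivalently, \<open>(L\<^sub>X \<omega>)(Y) = X(\<omega>(Y)) - \<omega>([X,Y])\<close> and \<open>(L\<^sub>X N)Y = [X,NY] - N[X,Y]\<close>.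
\<close>

definition lie_form ::
  "('a, 'm::finite) chart set \<Rightarrow> ('a \<Rightarrow> real ^ 'm) \<Rightarrow> ('a \<Rightarrow> real ^ 'm \<Rightarrow> real) \<Rightarrow> 'a \<Rightarrow> real ^ 'm \<Rightarrow> real" where
  "lie_form A X \<omega> p v =
     frechet_derivative (\<lambda>y. form_rep A (chart_at A p) \<omega> y v) (at (base_pt A p)) (X p)
   + \<omega> p (frechet_derivative (vf_rep A (chart_at A p) X) (at (base_pt A p)) v)"

definition lie_endo ::
  "('a, 'm::finite) chart set \<Rightarrow> ('a \<Rightarrow> real ^ 'm) \<Rightarrow> ('a \<Rightarrow> real ^ 'm \<Rightarrow> real ^ 'm) \<Rightarrow> 'a \<Rightarrow> real ^ 'm \<Rightarrow> real ^ 'm" where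
  "lie_endo A X N p v =
     frechet_derivative (\<lambda>y. endo_rep A (chart_at A p) N y v) (at (base_pt A p)) (X p)
   - frechet_derivative (vf_rep A (chart_at A p) X) (at (base_pt A p)) (N p v)
   + N p (frechet_derivative (vf_rep A (chart_at A p) X) (at (base_pt A p)) v)"

definition endo_trace :: "('a \<Rightarrow> real ^ 'm \<Rightarrow> real ^ 'm::finite) \<Rightarrow> nat \<Rightarrow> 'a \<Rightarrow> real" where
  "endo_trace N k p = trace (matrix ((N p) ^^ k))"


section \<open>Contact Hamiltonian systems\<close>

text \<open>
  A \<open>k\<close>-form on a vector space is a function of a sequence of vectors that only looks at the entries
  with index below \<open>k\<close>. \<open>wedge k l \<alpha> \<beta>\<close> is the wedge product of a \<open>k\<close>-form and an \<open>l\<close>-form, and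
  \<open>wedge_pow \<beta> n\<close> is the \<open>n\<close>-th wedge power of a 2-form.
\<close>

definition wedge ::
  "nat \<Rightarrow> nat \<Rightarrow> ((nat \<Rightarrow> 'v) \<Rightarrow> real) \<Rightarrow> ((nat \<Rightarrow> 'v) \<Rightarrow> real) \<Rightarrow> (nat \<Rightarrow> 'v) \<Rightarrow> real" where
  "wedge k l \<alpha> \<beta> vs =
     (\<Sum>\<pi> | \<pi> permutes {..<k + l}.
        of_int (sign \<pi>) * \<alpha> (\<lambda>i. vs (\<pi> i)) * \<beta> (\<lambda>i. vs (\<pi> (k + i)))) / (fact k * fact l)"

primrec wedge_pow :: "((nat \<Rightarrow> 'v) \<Rightarrow> real) \<Rightarrow> nat \<Rightarrow> (nat \<Rightarrow> 'v) \<Rightarrow> real" where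
  "wedge_pow \<beta> 0 = (\<lambda>vs. 1)"
| "wedge_pow \<beta> (Suc n) = wedge 2 (2 * n) \<beta> (wedge_pow \<beta> n)"

definition contact_form ::
  "('a, 'm::finite) chart set \<Rightarrow> nat \<Rightarrow> ('a \<Rightarrow> real ^ 'm \<Rightarrow> real) \<Rightarrow> bool" where
  "contact_form A n \<eta> \<longleftrightarrow> smooth_form A UNIV \<eta> \<and>
     (\<forall>p. wedge 1 (2 * n) (\<lambda>vs. \<eta> p (vs 0))
            (wedge_pow (\<lambda>vs. ext_deriv A \<eta> p (vs 0) (vs 1)) n) \<noteq> (\<lambda>vs. 0))"

definition contact_ham_system ::
  "('a::{t2_space,second_countable_topology}, 'm::finite) chart set \<Rightarrow> nat \<Rightarrow>
   ('a \<Rightarrow> real ^ 'm \<Rightarrow> real) \<Rightarrow> ('a \<Rightarrow> real) \<Rightarrow> bool" where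
  "contact_ham_system A n \<eta> H \<longleftrightarrow> CARD('m) = 2 * n + 1 \<and> smooth_atlas A \<and>
     contact_form A n \<eta> \<and> smooth_fun A UNIV H"

definition reeb :: "('a, 'm::finite) chart set \<Rightarrow> ('a \<Rightarrow> real ^ 'm \<Rightarrow> real) \<Rightarrow> 'a \<Rightarrow> real ^ 'm" where
  "reeb A \<eta> p = (THE v. \<eta> p v = 1 \<and> (\<forall>w. ext_deriv A \<eta> p v w = 0))"

definition reeb_deriv ::
  "('a, 'm::finite) chart set \<Rightarrow> ('a \<Rightarrow> real ^ 'm \<Rightarrow> real) \<Rightarrow> ('a \<Rightarrow> real) \<Rightarrow> 'a \<Rightarrow> real" where
  "reeb_deriv A \<eta> H p = dfun A H p (reeb A \<eta> p)"

definition contact_ham_vf ::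
  "('a, 'm::finite) chart set \<Rightarrow> ('a \<Rightarrow> real ^ 'm \<Rightarrow> real) \<Rightarrow> ('a \<Rightarrow> real) \<Rightarrow> 'a \<Rightarrow> real ^ 'm" where
  "contact_ham_vf A \<eta> H p = (THE v. \<eta> p v = - H p \<and>
     (\<forall>w. ext_deriv A \<eta> p v w = dfun A H p w - reeb_deriv A \<eta> H p * \<eta> p w))"

definition contact_canonoid ::
  "('a::topological_space, 'm::finite) chart set \<Rightarrow> ('a \<Rightarrow> real ^ 'm \<Rightarrow> real) \<Rightarrow> ('a \<Rightarrow> real) \<Rightarrow>
   ('a \<Rightarrow> 'a) \<Rightarrow> bool" where
  "contact_canonoid A \<eta> H \<Phi> \<longleftrightarrow> smooth_self_map A \<Phi> \<and>
     (\<exists>b. smooth_fun A UNIV b \<and>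
        (\<forall>p v. lie_form A (contact_ham_vf A \<eta> H) (pullback A \<Phi> \<eta>) p v = - b p * pullback A \<Phi> \<eta> p v))"

text \<open>
  The two systems of equations for an endomorphism \<open>N\<close> over an open set \<open>W\<close>; in the first one, \<open>Z\<close>
  ranges over the sections of \<open>ker \<eta>\<close> over \<open>W\<close>.
\<close>

definition contact_eqs ::
  "('a, 'm::finite) chart set \<Rightarrow> ('a \<Rightarrow> real ^ 'm \<Rightarrow> real) \<Rightarrow> ('a \<Rightarrow> real) \<Rightarrow> ('a \<Rightarrow> real ^ 'm \<Rightarrow> real) \<Rightarrow>
   'a set \<Rightarrow> ('a \<Rightarrow> real ^ 'm \<Rightarrow> real ^ 'm) \<Rightarrow> bool" where
  "contact_eqs A \<eta> H \<sigma> W N \<longleftrightarrow>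
     (\<forall>Y. smooth_vf A W Y \<longrightarrow> (\<forall>x\<in>W. \<eta> x (N x (Y x)) = 0)) \<and>
     (\<forall>Y Z. smooth_vf A W Y \<and> smooth_vf A W Z \<and> (\<forall>x\<in>W. \<eta> x (Z x) = 0) \<longrightarrow>
        (\<forall>x\<in>W. ext_deriv A \<eta> x (N x (Y x)) (Z x) = - H x * ext_deriv A \<sigma> x (Y x) (Z x)))"

definition symplectic_eqs ::
  "('a, 'm::finite) chart set \<Rightarrow> ('a \<Rightarrow> real ^ 'm \<Rightarrow> real) \<Rightarrow> ('a \<Rightarrow> real ^ 'm \<Rightarrow> real) \<Rightarrow>
   'a set \<Rightarrow> ('a \<Rightarrow> real ^ 'm \<Rightarrow> real ^ 'm) \<Rightarrow> bool" where
  "symplectic_eqs A l \<sigma> W N \<longleftrightarrow>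
     (\<forall>Y. smooth_vf A W Y \<longrightarrow> (\<forall>x\<in>W. l x (N x (Y x)) = 0)) \<and>
     (\<forall>Y Z. smooth_vf A W Y \<and> smooth_vf A W Z \<longrightarrow>
        (\<forall>x\<in>W. ext_deriv A l x (N x (Y x)) (Z x) = ext_deriv A \<sigma> x (Y x) (Z x)))"

end

theory Submission
  imports Defs
begin

text \<open>
  Nondegeneracy of \<open>d\<eta>\<close> on \<open>ker \<eta>\<close> makes \<open>N\<close> pointwise the unique solution of a linear system with
  smooth coefficients, so \<open>N\<close> is smooth by Cramer's rule.
  The canonoid condition gives \<open>X(K) = -bK\<close>, hence \<open>L\<^sub>X \<sigma> = 0\<close>, and as \<open>\<sigma>(X) = 1\<close> also
  \<open>\<iota>\<^sub>X d\<sigma> = 0\<close> and \<open>L\<^sub>X d\<sigma> = 0\<close>. Together with \<open>L\<^sub>X \<eta> = -a\<eta>\<close> and \<open>X(H) = -aH\<close>, applying \<open>L\<^sub>X\<close> to the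
  defining equations of \<open>N\<close> shows that \<open>L\<^sub>X N\<close> solves the homogeneous system, so it vanishes.
  Then \<open>X(tr(N\<^sup>k))\<close> is the trace of a commutator.
  The equations for \<open>N\<close> are identities of sections; they are localised at a point by extending a
  tangent vector to a global vector field with a bump function.
\<close>


section \<open>Calculus of smooth maps\<close>

text \<open>The invariance of \<open>N\<close> holds also at zeros of \<open>H\<close> because both
  sides of \<open>d\<eta>(NY,Z) = -H d\<sigma>(Y,Z)\<close> have the same weight. From
  \<open>L_X \<eta> = -a\<eta>\<close> follows
  \<open>L_X d\<eta> = -a d\<eta> - da \<and> \<eta>\<close>; the term
  \<open>da \<and> \<eta>\<close> vanishes on \<open>NY\<close> and \<open>Z\<close>, which both lie
  in \<open>ker \<eta>\<close>, and the remaining factor \<open>-a\<close> is the one produced by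
  \<open>X(H) = -aH\<close>. On \<open>U\<close> this amounts to the invariance of \<lambda>, whose
  Reeb field is \<open>X\<close>, but \<lambda> is undefined where \<open>H = 0\<close>; hence the
  computation uses \<eta> and \<open>H\<close> throughout. A constant coordinate vector that lies in
  \<open>ker \<eta>\<close> at one point leaves it nearby. Before it is differentiated, the equation
  for \<open>N\<close> is therefore extended to all \<open>Z\<close> by adding a multiple of \<eta>.
  Since the preferred chart jumps, \<open>ext_deriv\<close> cannot be differentiated as a function
  of the point. Whatever is differentiated lives in one fixed chart (\<open>exd\<close>,
  \<open>local_form\<close>, \<open>local_canonoid\<close>); the way back is naturality of
  \<open>d\<close> under transition maps, which rests on the symmetry of second derivatives.\<close>

lemma Ck_on_cong:
  assumes "open S" "\<And>x. x \<in> S \<Longrightarrow> f x = g x" "Ck_on k f S"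
  shows "Ck_on k g S"
  using assms(2,3)
proof (induction k arbitrary: f g)
  case 0
  then show ?case using continuous_on_cong[of S S f g] by simp
next
  case (Suc k)
  have dd: "frechet_derivative f (at x) = frechet_derivative g (at x)" and dg: "g differentiable (at x)"
    if "x \<in> S" for x
  proof -
    have "(f has_derivative frechet_derivative f (at x)) (at x)"
      using Suc.prems(2) that by (simp add: frechet_derivative_works)
    then have "(g has_derivative frechet_derivative f (at x)) (at x)"
      by (rule has_derivative_transform_within_open[OF _ assms(1) that Suc.prems(1)])
    then show "frechet_derivative f (at x) = frechet_derivative g (at x)" "g differentiable (at x)"
      by (auto simp: frechet_derivative_at differentiable_def)
  qed
  have "Ck_on k (\<lambda>x. frechet_derivative g (at x) v) S" for v
    by (rule Suc.IH[of "\<lambda>x. frechet_derivative f (at x) v"]) (use dd Suc.prems(2) in auto)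
  then show ?case using dg by simp
qed

lemma Ck_on_subset: "Ck_on k f S \<Longrightarrow> T \<subseteq> S \<Longrightarrow> Ck_on k f T"
  by (induction k arbitrary: f) (auto intro: continuous_on_subset)

lemma Ck_on_Suc_imp: "Ck_on (Suc k) f S \<Longrightarrow> Ck_on k f S"
proof (induction k arbitrary: f)
  case 0
  then show ?case
    by (auto intro!: continuous_at_imp_continuous_on differentiable_imp_continuous_within)
next
  case (Suc k)
  from Suc.prems show ?case
    unfolding Ck_on.simps(2)[of "Suc k"] Ck_on.simps(2)[of k] using Suc.IH by (metis Ck_on.simps(2))
qed

text \<open>Continuity at a point and differentiability at a point are local. This is for objects
  that no single formula describes on a whole chart region, such as pullbacks and vector fields cut
  off by a bump function.\<close>

lemma Ck_on_local:
  assumes "\<And>x. x \<in> S \<Longrightarrow> \<exists>T. open T \<and> x \<in> T \<and> Ck_on k f T"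
  shows "Ck_on k f S"
  using assms
proof (induction k arbitrary: f)
  case 0
  have "continuous (at x) f" if "x \<in> S" for x
    using 0[OF that] by (auto simp: continuous_on_eq_continuous_at)
  then show ?case by (auto intro!: continuous_at_imp_continuous_on)
next
  case (Suc k)
  have "Ck_on k (\<lambda>x. frechet_derivative f (at x) v) S" for v
    by (rule Suc.IH) (use Suc.prems in \<open>auto, blast\<close>)
  moreover have "f differentiable (at x)" if "x \<in> S" for x using Suc.prems[OF that] by auto
  ultimately show ?case by simp
qed

lemma Ck_on_const [simp]: "Ck_on k (\<lambda>x. c) S"
  by (induction k arbitrary: c) auto

lemma Ck_on_linear:
  assumes "bounded_linear L" "open S" "Ck_on k f S"
  shows "Ck_on k (\<lambda>x. L (f x)) S"
  using assms(3)
proof (induction k arbitrary: f)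
  case 0
  then show ?case using assms(1) by (simp add: bounded_linear.continuous_on)
next
  case (Suc k)
  have D: "((\<lambda>x. L (f x)) has_derivative (\<lambda>v. L (frechet_derivative f (at x) v))) (at x)" if "x \<in> S" for x
    using Suc.prems that by (auto simp: frechet_derivative_works intro!: bounded_linear.has_derivative[OF assms(1)])
  have "Ck_on k (\<lambda>x. frechet_derivative (\<lambda>x. L (f x)) (at x) v) S" for v
  proof (rule Ck_on_cong[OF assms(2)])
    show "Ck_on k (\<lambda>x. L (frechet_derivative f (at x) v)) S" using Suc by auto
    show "L (frechet_derivative f (at x) v) = frechet_derivative (\<lambda>x. L (f x)) (at x) v" if "x \<in> S" for x
      using frechet_derivative_at[OF D[OF that]] by metis
  qed
  then show ?case using D by (auto simp: differentiable_def)
qed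

lemma Ck_on_add:
  assumes "open S" "Ck_on k f S" "Ck_on k g S"
  shows "Ck_on k (\<lambda>x. f x + g x) S"
  using assms(2,3)
proof (induction k arbitrary: f g)
  case 0
  then show ?case by (simp add: continuous_on_add)
next
  case (Suc k)
  have D: "((\<lambda>x. f x + g x) has_derivative
      (\<lambda>v. frechet_derivative f (at x) v + frechet_derivative g (at x) v)) (at x)" if "x \<in> S" for x
    using Suc.prems that by (auto simp: frechet_derivative_works intro!: has_derivative_add)
  have "Ck_on k (\<lambda>x. frechet_derivative (\<lambda>x. f x + g x) (at x) v) S" for v
  proof (rule Ck_on_cong[OF assms(1)])
    show "Ck_on k (\<lambda>x. frechet_derivative f (at x) v + frechet_derivative g (at x) v) S" using Suc by auto
    show "frechet_derivative f (at x) v + frechet_derivative g (at x) v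
        = frechet_derivative (\<lambda>x. f x + g x) (at x) v" if "x \<in> S" for x
      using frechet_derivative_at[OF D[OF that]] by metis
  qed
  then show ?case using D by (auto simp: differentiable_def)
qed

text \<open>One proof for products, scalar multiples and inner products. The product rule mixes
  derivatives with undifferentiated factors, which enter the induction one order lower
  (\<open>Ck_on_Suc_imp\<close>).\<close>

lemma Ck_on_bilinear:
  assumes b: "bounded_bilinear p" and S: "open S" and "Ck_on k f S" "Ck_on k g S"
  shows "Ck_on k (\<lambda>x. p (f x) (g x)) S"
  using assms(3,4)
proof (induction k arbitrary: f g)
  case 0
  then show ?case by (simp add: bounded_bilinear.continuous_on[OF b])
next
  case (Suc k)
  have D: "((\<lambda>x. p (f x) (g x)) has_derivative
      (\<lambda>v. p (f x) (frechet_derivative g (at x) v) + p (frechet_derivative f (at x) v) (g x))) (at x)"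
    if "x \<in> S" for x
    using Suc.prems that by (auto simp: frechet_derivative_works intro!: bounded_bilinear.FDERIV[OF b])
  have "Ck_on k (\<lambda>x. frechet_derivative (\<lambda>x. p (f x) (g x)) (at x) v) S" for v
  proof (rule Ck_on_cong[OF S])
    show "Ck_on k (\<lambda>x. p (f x) (frechet_derivative g (at x) v) + p (frechet_derivative f (at x) v) (g x)) S"
      using Suc.prems Ck_on_Suc_imp[OF Suc.prems(1)] Ck_on_Suc_imp[OF Suc.prems(2)]
      by (intro Ck_on_add[OF S] Suc.IH) auto
    show "p (f x) (frechet_derivative g (at x) v) + p (frechet_derivative f (at x) v) (g x)
        = frechet_derivative (\<lambda>x. p (f x) (g x)) (at x) v" if "x \<in> S" for x
      using frechet_derivative_at[OF D[OF that]] by metis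
  qed
  then show ?case using D by (auto simp: differentiable_def)
qed

text \<open>The derivative \<open>-(1/f) f' (1/f)\<close> involves only \<open>f'\<close> and
  \<open>1/f\<close> itself, so the induction hypothesis, applied one order lower, closes the
  step.\<close>

lemma Ck_on_inverse:
  fixes f :: "'e::real_normed_vector \<Rightarrow> real"
  assumes S: "open S" and "Ck_on k f S" and nz: "\<And>x. x \<in> S \<Longrightarrow> f x \<noteq> 0"
  shows "Ck_on k (\<lambda>x. inverse (f x)) S"
  using assms(2)
proof (induction k)
  case 0
  then show ?case using nz by (auto intro!: continuous_on_inverse)
next
  case (Suc k)
  have D: "((\<lambda>x. inverse (f x)) has_derivative
      (\<lambda>v. - (inverse (f x) * frechet_derivative f (at x) v * inverse (f x)))) (at x)"
    if "x \<in> S" for x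
    using Suc.prems that nz[OF that]
    by (auto simp: frechet_derivative_works intro!: has_derivative_inverse)
  have "Ck_on k (\<lambda>x. frechet_derivative (\<lambda>x. inverse (f x)) (at x) v) S" for v
  proof (rule Ck_on_cong[OF S])
    show "Ck_on k (\<lambda>x. - (inverse (f x) * frechet_derivative f (at x) v * inverse (f x))) S"
      using Suc.prems Suc.IH[OF Ck_on_Suc_imp[OF Suc.prems]]
      by (intro Ck_on_linear[OF bounded_linear_minus[OF bounded_linear_ident] S]
          Ck_on_bilinear[OF bounded_bilinear_mult S]) auto
    show "- (inverse (f x) * frechet_derivative f (at x) v * inverse (f x))
        = frechet_derivative (\<lambda>x. inverse (f x)) (at x) v" if "x \<in> S" for x
      using frechet_derivative_at[OF D[OF that]] by metis
  qed
  then show ?case using D by (auto simp: differentiable_def)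
qed

lemma Ck_on_sum:
  assumes "open S" "\<And>i. i \<in> I \<Longrightarrow> Ck_on k (f i) S"
  shows "Ck_on k (\<lambda>x. \<Sum>i\<in>I. f i x) S"
  using assms(2) by (induction I rule: infinite_finite_induct) (auto intro!: Ck_on_add[OF assms(1)])

lemma frechet_derivative_basis:
  fixes g :: "'f::euclidean_space \<Rightarrow> 'g::real_normed_vector"
  assumes "g differentiable (at y)"
  shows "frechet_derivative g (at y) w = (\<Sum>b\<in>Basis. (w \<bullet> b) *\<^sub>R frechet_derivative g (at y) b)"
proof -
  have "linear (frechet_derivative g (at y))"
    using assms by (rule linear_frechet_derivative)
  then show ?thesis
    by (subst euclidean_representation[of w, symmetric]) (simp add: linear_sum linear_scale)
qed

text \<open>\<open>Ck_on\<close> differentiates in fixed directions, whereas the chain rule applies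
  \<open>Dg\<close> to the moving direction \<open>Df(x) v\<close>. Expanding that vector in a
  finite basis leaves fixed-direction derivatives of \<open>g\<close>, to which the induction
  hypothesis applies; hence the Euclidean space in the middle.\<close>

lemma Ck_on_compose:
  fixes f :: "'e::real_normed_vector \<Rightarrow> 'f::euclidean_space" and g :: "'f \<Rightarrow> 'g::real_normed_vector"
  assumes S: "open S" and fT: "f ` S \<subseteq> T" and "Ck_on k f S" "Ck_on k g T"
  shows "Ck_on k (\<lambda>x. g (f x)) S"
  using assms(3,4)
proof (induction k arbitrary: g)
  case 0
  then show ?case using continuous_on_compose2[of T g S f] fT by simp
next
  case (Suc k)
  have dg: "g differentiable (at (f x))" if "x \<in> S" for x using Suc.prems fT that by auto
  have D: "((\<lambda>x. g (f x)) has_derivative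
      (\<lambda>v. frechet_derivative g (at (f x)) (frechet_derivative f (at x) v))) (at x)"
    if "x \<in> S" for x
  proof -
    have "f differentiable (at x)" using Suc.prems(1) that by simp
    then show ?thesis
      using dg[OF that] unfolding frechet_derivative_works by (rule has_derivative_compose)
  qed
  have "Ck_on k (\<lambda>x. frechet_derivative (\<lambda>x. g (f x)) (at x) v) S" for v
  proof (rule Ck_on_cong[OF S])
    show "Ck_on k (\<lambda>x. \<Sum>b\<in>Basis. (frechet_derivative f (at x) v \<bullet> b) *\<^sub>R frechet_derivative g (at (f x)) b) S"
      using Suc.prems Ck_on_Suc_imp[OF Suc.prems(1)]
      by (intro Ck_on_sum[OF S] Ck_on_bilinear[OF bounded_bilinear_scaleR S]
          Ck_on_linear[OF bounded_linear_inner_left S] Suc.IH) auto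
    show "(\<Sum>b\<in>Basis. (frechet_derivative f (at x) v \<bullet> b) *\<^sub>R frechet_derivative g (at (f x)) b)
        = frechet_derivative (\<lambda>x. g (f x)) (at x) v" if "x \<in> S" for x
      using frechet_derivative_at[OF D[OF that]] frechet_derivative_basis[OF dg[OF that]] by metis
  qed
  then show ?case using D by (auto simp: differentiable_def)
qed


section \<open>Closure properties of smooth maps on open sets\<close>

lemma smooth_on_cong: "open S \<Longrightarrow> (\<And>x. x \<in> S \<Longrightarrow> f x = g x) \<Longrightarrow> smooth_on f S \<Longrightarrow> smooth_on g S"
  unfolding smooth_on_def using Ck_on_cong by blast

lemma smooth_on_subset: "smooth_on f S \<Longrightarrow> T \<subseteq> S \<Longrightarrow> smooth_on f T"
  unfolding smooth_on_def using Ck_on_subset by blast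

lemma smooth_on_local:
  assumes "\<And>x. x \<in> S \<Longrightarrow> \<exists>T. open T \<and> x \<in> T \<and> smooth_on f T"
  shows "smooth_on f S"
  unfolding smooth_on_def by (intro allI Ck_on_local) (use assms in \<open>auto simp: smooth_on_def\<close>)

lemma smooth_on_differentiable: "smooth_on f S \<Longrightarrow> x \<in> S \<Longrightarrow> f differentiable (at x)"
  unfolding smooth_on_def using Ck_on.simps(2) by blast

lemma smooth_on_has_derivative:
  "smooth_on f S \<Longrightarrow> x \<in> S \<Longrightarrow> (f has_derivative frechet_derivative f (at x)) (at x)"
  using smooth_on_differentiable frechet_derivative_works by blast

lemma smooth_on_continuous: "smooth_on f S \<Longrightarrow> continuous_on S f"
  unfolding smooth_on_def using Ck_on.simps(1) by blast

lemma smooth_on_frechet: "smooth_on f S \<Longrightarrow> smooth_on (\<lambda>x. frechet_derivative f (at x) v) S"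
  unfolding smooth_on_def using Ck_on.simps(2) by blast

lemma smooth_on_const [simp]: "smooth_on (\<lambda>x. c) S"
  by (simp add: smooth_on_def)

lemma smooth_on_ident [simp]: "smooth_on (\<lambda>x. x) S"
proof -
  have "Ck_on k (\<lambda>x. x) S" for k by (cases k) auto
  then show ?thesis by (simp add: smooth_on_def)
qed

lemma smooth_on_linear:
  "bounded_linear L \<Longrightarrow> open S \<Longrightarrow> smooth_on f S \<Longrightarrow> smooth_on (\<lambda>x. L (f x)) S"
  unfolding smooth_on_def using Ck_on_linear by blast

lemma smooth_on_add: "open S \<Longrightarrow> smooth_on f S \<Longrightarrow> smooth_on g S \<Longrightarrow> smooth_on (\<lambda>x. f x + g x) S"
  unfolding smooth_on_def using Ck_on_add by blast

lemma smooth_on_minus: "open S \<Longrightarrow> smooth_on f S \<Longrightarrow> smooth_on (\<lambda>x. - f x) S"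
  by (rule smooth_on_linear[OF bounded_linear_minus[OF bounded_linear_ident]])

lemma smooth_on_diff: "open S \<Longrightarrow> smooth_on f S \<Longrightarrow> smooth_on g S \<Longrightarrow> smooth_on (\<lambda>x. f x - g x) S"
  using smooth_on_add[of S f "\<lambda>x. - g x"] smooth_on_minus[of S g] by simp

lemma smooth_on_bilinear:
  "bounded_bilinear p \<Longrightarrow> open S \<Longrightarrow> smooth_on f S \<Longrightarrow> smooth_on g S \<Longrightarrow> smooth_on (\<lambda>x. p (f x) (g x)) S"
  unfolding smooth_on_def using Ck_on_bilinear by blast

lemmas smooth_on_mult = smooth_on_bilinear[OF bounded_bilinear_mult]
lemmas smooth_on_scaleR = smooth_on_bilinear[OF bounded_bilinear_scaleR]

lemma smooth_on_sum:
  "open S \<Longrightarrow> (\<And>i. i \<in> I \<Longrightarrow> smooth_on (f i) S) \<Longrightarrow> smooth_on (\<lambda>x. \<Sum>i\<in>I. f i x) S"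
  by (simp add: smooth_on_def Ck_on_sum)

lemma smooth_on_prod:
  fixes f :: "'i \<Rightarrow> 'e::real_normed_vector \<Rightarrow> real"
  assumes "open S" "\<And>i. i \<in> I \<Longrightarrow> smooth_on (f i) S"
  shows "smooth_on (\<lambda>x. \<Prod>i\<in>I. f i x) S"
  using assms(2) by (induction I rule: infinite_finite_induct) (auto intro!: smooth_on_mult[OF assms(1)])

lemma smooth_on_divide:
  fixes f g :: "'e::real_normed_vector \<Rightarrow> real"
  assumes "open S" "smooth_on f S" "smooth_on g S" "\<And>x. x \<in> S \<Longrightarrow> g x \<noteq> 0"
  shows "smooth_on (\<lambda>x. f x / g x) S"
proof -
  have "smooth_on (\<lambda>x. inverse (g x)) S"
    using assms Ck_on_inverse unfolding smooth_on_def by blast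
  then show ?thesis
    unfolding divide_inverse using assms by (intro smooth_on_mult)
qed

lemma smooth_on_compose:
  fixes f :: "'e::real_normed_vector \<Rightarrow> 'f::euclidean_space"
  shows "open S \<Longrightarrow> f ` S \<subseteq> T \<Longrightarrow> smooth_on f S \<Longrightarrow> smooth_on g T \<Longrightarrow> smooth_on (\<lambda>x. g (f x)) S"
  by (simp add: smooth_on_def Ck_on_compose)

lemma smooth_on_component:
  fixes f :: "'e::real_normed_vector \<Rightarrow> real ^ 'n"
  shows "open S \<Longrightarrow> smooth_on f S \<Longrightarrow> smooth_on (\<lambda>x. f x $ i) S"
  by (rule smooth_on_linear[OF bounded_linear_vec_nth])

lemma smooth_on_vec:
  fixes f :: "'e::real_normed_vector \<Rightarrow> real ^ 'n"
  assumes "open S" "\<And>i. smooth_on (\<lambda>x. f x $ i) S"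
  shows "smooth_on f S"
proof -
  have "f x = (\<Sum>i\<in>UNIV. f x $ i *\<^sub>R axis i 1)" for x
    by (simp add: basis_expansion scalar_mult_eq_scaleR[symmetric])
  moreover have "smooth_on (\<lambda>x. \<Sum>i\<in>UNIV. f x $ i *\<^sub>R (axis i 1 :: real ^ 'n)) S"
    using assms by (intro smooth_on_sum smooth_on_scaleR) auto
  ultimately show ?thesis by presburger
qed

section \<open>Linear maps depending smoothly on a parameter\<close>

lemma linear_vec_expansion:
  fixes F :: "real ^ 'n \<Rightarrow> 'g::real_vector"
  assumes "linear F"
  shows "F w = (\<Sum>i\<in>UNIV. w $ i *\<^sub>R F (axis i 1))"
proof -
  have "w = (\<Sum>i\<in>UNIV. w $ i *\<^sub>R axis i 1)"
    by (simp add: basis_expansion scalar_mult_eq_scaleR[symmetric])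
  then have "F w = F (\<Sum>i\<in>UNIV. w $ i *\<^sub>R axis i 1)" by simp
  then show ?thesis using assms by (simp add: linear_sum linear_scale)
qed

text \<open>Tensor fields are declared smooth one constant test vector at a time; expanding
  \<open>w y\<close> in coordinates extends this to varying arguments.\<close>

lemma smooth_on_apply:
  fixes F :: "'e::real_normed_vector \<Rightarrow> real ^ 'n \<Rightarrow> 'g::real_normed_vector"
  assumes S: "open S" and lin: "\<And>y. y \<in> S \<Longrightarrow> linear (F y)"
    and F: "\<And>v. smooth_on (\<lambda>y. F y v) S" and w: "smooth_on w S"
  shows "smooth_on (\<lambda>y. F y (w y)) S"
proof (rule smooth_on_cong[OF S])
  show "smooth_on (\<lambda>y. \<Sum>i\<in>UNIV. w y $ i *\<^sub>R F y (axis i 1)) S"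
    using F w by (intro smooth_on_sum smooth_on_scaleR smooth_on_component S) auto
qed (simp add: linear_vec_expansion[OF lin, symmetric])

text \<open>Product rule for a moving linear map applied to a moving vector. The first summand keeps
  the argument frozen at \<open>w y\<close>, which is how derivatives of coefficients occur in
  \<open>ext_deriv\<close>, \<open>lie_form\<close> and \<open>lie_endo\<close>.\<close>

lemma has_derivative_apply:
  fixes F :: "'e::real_normed_vector \<Rightarrow> real ^ 'n \<Rightarrow> 'g::real_normed_vector"
  assumes S: "open S" "y \<in> S" and lin: "\<And>y. y \<in> S \<Longrightarrow> linear (F y)"
    and F: "\<And>v. (\<lambda>y. F y v) differentiable (at y)" and w: "w differentiable (at y)"
  shows "((\<lambda>y. F y (w y)) has_derivative
           (\<lambda>u. frechet_derivative (\<lambda>z. F z (w y)) (at y) u + F y (frechet_derivative w (at y) u))) (at y)"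
proof -
  define e where "e i = (axis i 1 :: real ^ 'n)" for i
  have Fd: "((\<lambda>z. F z v) has_derivative frechet_derivative (\<lambda>z. F z v) (at y)) (at y)" for v
    using F frechet_derivative_works by blast
  have wd: "(w has_derivative frechet_derivative w (at y)) (at y)"
    using w frechet_derivative_works by blast
  have wi: "((\<lambda>z. w z $ i) has_derivative (\<lambda>u. frechet_derivative w (at y) u $ i)) (at y)" for i
    by (rule bounded_linear.has_derivative[OF bounded_linear_vec_nth wd])
  have 1: "((\<lambda>z. \<Sum>i\<in>UNIV. w z $ i *\<^sub>R F z (e i)) has_derivative
      (\<lambda>u. \<Sum>i\<in>UNIV. w y $ i *\<^sub>R frechet_derivative (\<lambda>z. F z (e i)) (at y) u
         + frechet_derivative w (at y) u $ i *\<^sub>R F y (e i))) (at y)"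
    by (intro has_derivative_sum has_derivative_scaleR wi Fd)
  have 2: "((\<lambda>z. F z (w y)) has_derivative (\<lambda>u. \<Sum>i\<in>UNIV. w y $ i *\<^sub>R frechet_derivative (\<lambda>z. F z (e i)) (at y) u)) (at y)"
  proof (rule has_derivative_transform_within_open[OF _ S])
    show "((\<lambda>z. \<Sum>i\<in>UNIV. w y $ i *\<^sub>R F z (e i)) has_derivative 
      (\<lambda>u. \<Sum>i\<in>UNIV. w y $ i *\<^sub>R frechet_derivative (\<lambda>z. F z (e i)) (at y) u)) (at y)"
      by (intro has_derivative_sum bounded_linear.has_derivative[OF bounded_linear_scaleR_right] Fd)
    show "(\<Sum>i\<in>UNIV. w y $ i *\<^sub>R F z (e i)) = F z (w y)" if "z \<in> S" for z
      using linear_vec_expansion[OF lin[OF that], of "w y"] by (simp add: e_def)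
  qed
  have 3: "((\<lambda>z. F z (w z)) has_derivative
      (\<lambda>u. \<Sum>i\<in>UNIV. w y $ i *\<^sub>R frechet_derivative (\<lambda>z. F z (e i)) (at y) u
         + frechet_derivative w (at y) u $ i *\<^sub>R F y (e i))) (at y)"
    by (rule has_derivative_transform_within_open[OF 1 S])
      (simp add: linear_vec_expansion[OF lin, symmetric] e_def)
  have "frechet_derivative (\<lambda>z. F z (w y)) (at y) u + F y (frechet_derivative w (at y) u)
     = (\<Sum>i\<in>UNIV. w y $ i *\<^sub>R frechet_derivative (\<lambda>z. F z (e i)) (at y) u
         + frechet_derivative w (at y) u $ i *\<^sub>R F y (e i))" for u
    unfolding frechet_derivative_at[OF 2, symmetric] sum.distrib
    using linear_vec_expansion[OF lin[OF S(2)], of "frechet_derivative w (at y) u"] by (simp add: e_def)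
  with 3 show ?thesis by simp
qed

lemma frechet_derivative_apply:
  fixes F :: "'e::real_normed_vector \<Rightarrow> real ^ 'n \<Rightarrow> 'g::real_normed_vector"
  assumes "open S" "y \<in> S" "\<And>y. y \<in> S \<Longrightarrow> linear (F y)"
    "\<And>v. (\<lambda>y. F y v) differentiable (at y)" "w differentiable (at y)"
  shows "frechet_derivative (\<lambda>y. F y (w y)) (at y) u =
     frechet_derivative (\<lambda>z. F z (w y)) (at y) u + F y (frechet_derivative w (at y) u)"
  using frechet_derivative_at[OF has_derivative_apply[OF assms]] by metis

lemma linear_frechet_derivative_param:
  fixes F :: "'e::real_normed_vector \<Rightarrow> 'f::real_vector \<Rightarrow> 'g::real_normed_vector"
  assumes S: "open S" "y \<in> S" and lin: "\<And>y. y \<in> S \<Longrightarrow> linear (F y)"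
    and F: "\<And>v. (\<lambda>y. F y v) differentiable (at y)"
  shows "linear (\<lambda>v. frechet_derivative (\<lambda>y. F y v) (at y) u)"
proof (rule linearI)
  have Fd: "((\<lambda>z. F z v) has_derivative frechet_derivative (\<lambda>z. F z v) (at y)) (at y)" for v
    using F frechet_derivative_works by blast
  fix v w c
  have "((\<lambda>z. F z (v + w)) has_derivative
     (\<lambda>u. frechet_derivative (\<lambda>z. F z v) (at y) u + frechet_derivative (\<lambda>z. F z w) (at y) u)) (at y)"
    by (rule has_derivative_transform_within_open[OF has_derivative_add[OF Fd Fd] S])
      (simp add: linear_add[OF lin])
  then show "frechet_derivative (\<lambda>y. F y (v + w)) (at y) u =
     frechet_derivative (\<lambda>y. F y v) (at y) u + frechet_derivative (\<lambda>y. F y w) (at y) u"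
    using frechet_derivative_at by metis
  have "((\<lambda>z. F z (c *\<^sub>R v)) has_derivative (\<lambda>u. c *\<^sub>R frechet_derivative (\<lambda>z. F z v) (at y) u)) (at y)"
    by (rule has_derivative_transform_within_open[OF bounded_linear.has_derivative[OF bounded_linear_scaleR_right Fd] S])
      (simp add: linear_scale[OF lin])
  then show "frechet_derivative (\<lambda>y. F y (c *\<^sub>R v)) (at y) u = c *\<^sub>R frechet_derivative (\<lambda>y. F y v) (at y) u"
    using frechet_derivative_at by metis
qed

section \<open>Symmetry of mixed second derivatives\<close>

lemma DERIV_along_line:
  fixes F :: "'e::real_normed_vector \<Rightarrow> real"
  assumes "F differentiable (at (c + t *\<^sub>R w))"
  shows "((\<lambda>t. F (c + t *\<^sub>R w)) has_real_derivative frechet_derivative F (at (c + t *\<^sub>R w)) w) (at t)"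
proof -
  have l: "((\<lambda>t. c + t *\<^sub>R w) has_derivative (\<lambda>h. h *\<^sub>R w)) (at t)"
    by (auto intro!: derivative_eq_intros)
  have "((\<lambda>t. F (c + t *\<^sub>R w)) has_derivative (\<lambda>h. frechet_derivative F (at (c + t *\<^sub>R w)) (h *\<^sub>R w))) (at t)"
    using assms unfolding frechet_derivative_works by (rule has_derivative_compose[OF l])
  moreover have "(\<lambda>h. frechet_derivative F (at (c + t *\<^sub>R w)) (h *\<^sub>R w))
      = (*) (frechet_derivative F (at (c + t *\<^sub>R w)) w)"
    using linear_frechet_derivative[OF assms] by (auto simp: linear_scale)
  ultimately show ?thesis by (simp add: has_field_derivative_def)
qed

text \<open>Two uses of the mean value theorem: along \<open>u\<close>, for the difference of
  \<open>f\<close> across the shift by \<open>s v\<close>, and then along \<open>v\<close>, for the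
  derivative of \<open>f\<close> in direction \<open>u\<close>. The second difference is symmetric
  in \<open>u\<close> and \<open>v\<close>, the mixed derivative not visibly so.\<close>

lemma second_difference_mvt:
  fixes f :: "'e::real_normed_vector \<Rightarrow> real"
  assumes f: "smooth_on f S" and "0 < s" and S: "cball a (s * (norm u + norm v)) \<subseteq> S"
  shows "\<exists>p \<in> cball a (s * (norm u + norm v)).
     f (a + s *\<^sub>R u + s *\<^sub>R v) - f (a + s *\<^sub>R u) - f (a + s *\<^sub>R v) + f a
       = s * s * frechet_derivative (\<lambda>x. frechet_derivative f (at x) u) (at p) v"
proof -
  have inb: "a + x *\<^sub>R u + y *\<^sub>R v \<in> cball a (s * (norm u + norm v))"
    if "0 \<le> x" "x \<le> s" "0 \<le> y" "y \<le> s" for x y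
  proof -
    have "norm (x *\<^sub>R u + y *\<^sub>R v) \<le> s * norm u + s * norm v"
      using that by (intro norm_triangle_le add_mono) (auto intro: mult_right_mono)
    then show ?thesis by (simp add: dist_norm algebra_simps norm_minus_commute)
  qed
  have df: "f differentiable (at (a + x *\<^sub>R u + y *\<^sub>R v))"
    if "0 \<le> x" "x \<le> s" "0 \<le> y" "y \<le> s" for x y
    using smooth_on_differentiable[OF f] inb[OF that] S by blast
  have ddf: "(\<lambda>x. frechet_derivative f (at x) u) differentiable (at (a + x *\<^sub>R u + y *\<^sub>R v))"
    if "0 \<le> x" "x \<le> s" "0 \<le> y" "y \<le> s" for x y
    using smooth_on_differentiable[OF smooth_on_frechet[OF f]] inb[OF that] S by blast
  let ?g = "\<lambda>x. f (a + s *\<^sub>R v + x *\<^sub>R u) - f (a + x *\<^sub>R u)"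
  let ?g' = "\<lambda>x. frechet_derivative f (at (a + s *\<^sub>R v + x *\<^sub>R u)) u - frechet_derivative f (at (a + x *\<^sub>R u)) u"
  have "\<exists>z>0. z < s \<and> ?g s - ?g 0 = (s - 0) * ?g' z"
  proof (rule MVT2[OF \<open>0 < s\<close>])
    fix x assume x: "0 \<le> x" "x \<le> s"
    have "f differentiable (at (a + s *\<^sub>R v + x *\<^sub>R u))" "f differentiable (at (a + x *\<^sub>R u))"
      using df[OF x, of s] df[OF x, of 0] \<open>0 < s\<close> by (auto simp: algebra_simps)
    then show "(?g has_real_derivative ?g' x) (at x)"
      by (intro DERIV_diff DERIV_along_line)
  qed
  then obtain z where z: "0 < z" "z < s" "?g s - ?g 0 = s * ?g' z" by auto
  let ?h = "\<lambda>y. frechet_derivative f (at (a + z *\<^sub>R u + y *\<^sub>R v)) u"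
  let ?h' = "\<lambda>y. frechet_derivative (\<lambda>x. frechet_derivative f (at x) u) (at (a + z *\<^sub>R u + y *\<^sub>R v)) v"
  have "\<exists>y>0. y < s \<and> ?h s - ?h 0 = (s - 0) * ?h' y"
    using ddf z by (intro MVT2[OF \<open>0 < s\<close>] DERIV_along_line) auto
  then obtain y where y: "0 < y" "y < s" "?h s - ?h 0 = s * ?h' y" by auto
  have "?g' z = ?h s - ?h 0" by (simp add: algebra_simps)
  then have "?g s - ?g 0 = s * s * ?h' y" using z y by simp
  moreover have "a + z *\<^sub>R u + y *\<^sub>R v \<in> cball a (s * (norm u + norm v))"
    using inb[of z y] z y by simp
  ultimately show ?thesis by (intro bexI[of _ "a + z *\<^sub>R u + y *\<^sub>R v"]) (auto simp: algebra_simps)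
qed

text \<open>Reading the same second difference in both orders equates the two mixed derivatives at
  points \<open>p\<close> and \<open>q\<close> that can be taken as close to \<open>a\<close> as
  desired; continuity then excludes a gap at \<open>a\<close>.\<close>

lemma symmetric_second_derivative_real:
  fixes f :: "'e::real_normed_vector \<Rightarrow> real"
  assumes f: "smooth_on f S" and S: "open S" "a \<in> S"
  shows "frechet_derivative (\<lambda>x. frechet_derivative f (at x) u) (at a) v
       = frechet_derivative (\<lambda>x. frechet_derivative f (at x) v) (at a) u" (is "?P a = ?Q a")
proof (rule ccontr)
  assume ne: "?P a \<noteq> ?Q a"
  \<comment> \<open>Half the gap, so that the open \<open>e\<close>-neighbourhoods of the two values
    are disjoint.\<close>
  define e where "e = \<bar>?P a - ?Q a\<bar> / 2"
  have e: "e > 0" using ne by (simp add: e_def)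
  have cont: "continuous (at a) ?P" "continuous (at a) ?Q"
    using smooth_on_continuous[OF smooth_on_frechet[OF smooth_on_frechet[OF f]]] S
    by (auto simp: continuous_on_eq_continuous_at)
  obtain d1 where d1: "d1 > 0" "\<And>x. dist x a < d1 \<Longrightarrow> dist (?P x) (?P a) < e"
    using cont(1) e unfolding continuous_at_eps_delta by blast
  obtain d2 where d2: "d2 > 0" "\<And>x. dist x a < d2 \<Longrightarrow> dist (?Q x) (?Q a) < e"
    using cont(2) e unfolding continuous_at_eps_delta by blast
  obtain d3 where d3: "d3 > 0" "ball a d3 \<subseteq> S"
    using S openE by blast
  define d where "d = min d1 (min d2 d3)"
  \<comment> \<open>The summand 1 keeps the denominator positive even for \<open>u = v = 0\<close>
    and places the closed ball around the parallelogram strictly inside radius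
    \<open>d\<close>.\<close>
  define s where "s = d / (norm u + norm v + 1)"
  have d: "d > 0" using d1 d2 d3 by (simp add: d_def)
  have n: "norm u + norm v + 1 > 0" by (smt (verit) norm_ge_zero)
  have s: "s > 0" using d n by (simp add: s_def)
  have sd: "s * (norm u + norm v) < d"
    using d n by (simp add: s_def divide_simps)
  have sub: "cball a (s * (norm u + norm v)) \<subseteq> ball a d" using sd by auto
  then have sub': "cball a (s * (norm u + norm v)) \<subseteq> S" "cball a (s * (norm v + norm u)) \<subseteq> S"
  proof -
    have "d \<le> d3" by (simp add: d_def)
    then have "ball a d \<subseteq> S" using d3(2) subset_ball[of d d3 a] by blast
    with sub show "cball a (s * (norm u + norm v)) \<subseteq> S" "cball a (s * (norm v + norm u)) \<subseteq> S"
      by (auto simp: add.commute)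
  qed
  obtain p where p: "p \<in> cball a (s * (norm u + norm v))"
    "f (a + s *\<^sub>R u + s *\<^sub>R v) - f (a + s *\<^sub>R u) - f (a + s *\<^sub>R v) + f a = s * s * ?P p"
    using second_difference_mvt[OF f s sub'(1)] by blast
  obtain q where q: "q \<in> cball a (s * (norm v + norm u))"
    "f (a + s *\<^sub>R v + s *\<^sub>R u) - f (a + s *\<^sub>R v) - f (a + s *\<^sub>R u) + f a = s * s * ?Q q"
    using second_difference_mvt[OF f s sub'(2)] by blast
  have "f (a + s *\<^sub>R v + s *\<^sub>R u) = f (a + s *\<^sub>R u + s *\<^sub>R v)" by (simp add: algebra_simps)
  then have "s * s * ?P p = s * s * ?Q q" using p(2) q(2) by linarith
  then have "?P p = ?Q q" using s by simp
  moreover have "dist p a < d" "dist q a < d" using p q sd by (auto simp: dist_commute add.commute)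
  then have "dist (?P p) (?P a) < e" "dist (?Q q) (?Q a) < e" using d1 d2 by (auto simp: d_def)
  ultimately show False unfolding dist_real_def e_def by (simp add: abs_if split: if_splits)
qed

lemma frechet_derivative_component:
  fixes f :: "'e::real_normed_vector \<Rightarrow> real ^ 'n"
  assumes "f differentiable (at x)"
  shows "frechet_derivative (\<lambda>x. f x $ i) (at x) = (\<lambda>v. frechet_derivative f (at x) v $ i)"
proof -
  have "((\<lambda>x. f x $ i) has_derivative (\<lambda>v. frechet_derivative f (at x) v $ i)) (at x)"
    using assms unfolding frechet_derivative_works
    by (rule bounded_linear.has_derivative[OF bounded_linear_vec_nth])
  then show ?thesis by (metis frechet_derivative_at)
qed

text \<open>\<open>frechet_derivative\<close> is a choice from the maps satisfying
  \<open>has_derivative\<close>, and that predicate is the same for \<open>f\<close> and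
  \<open>g\<close>; so the identity covers points where neither is differentiable.\<close>

lemma frechet_derivative_cong:
  assumes S: "open S" "a \<in> S" and eq: "\<And>x. x \<in> S \<Longrightarrow> f x = g x"
  shows "frechet_derivative f (at a) = frechet_derivative g (at a)"
proof -
  have "(f has_derivative D) (at a) \<longleftrightarrow> (g has_derivative D) (at a)" for D
    using has_derivative_transform_within_open[OF _ S, of f D UNIV g]
      has_derivative_transform_within_open[OF _ S, of g D UNIV f] eq by auto
  then show ?thesis by (simp add: frechet_derivative_def)
qed

lemma symmetric_second_derivative:
  fixes f :: "'e::real_normed_vector \<Rightarrow> real ^ 'n"
  assumes f: "smooth_on f S" and S: "open S" "a \<in> S"
  shows "frechet_derivative (\<lambda>x. frechet_derivative f (at x) u) (at a) v
       = frechet_derivative (\<lambda>x. frechet_derivative f (at x) v) (at a) u"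
proof (rule vec_eq_iff[THEN iffD2], rule allI)
  fix i
  have *: "frechet_derivative (\<lambda>x. frechet_derivative f (at x) u) (at a) v $ i
     = frechet_derivative (\<lambda>x. frechet_derivative (\<lambda>x. f x $ i) (at x) u) (at a) v" for u v
  proof -
    have "frechet_derivative (\<lambda>x. frechet_derivative f (at x) u) (at a) v $ i
      = frechet_derivative (\<lambda>x. frechet_derivative f (at x) u $ i) (at a) v"
      using smooth_on_differentiable[OF smooth_on_frechet[OF f] S(2), of u]
      by (simp add: frechet_derivative_component)
    also have "\<dots> = frechet_derivative (\<lambda>x. frechet_derivative (\<lambda>x. f x $ i) (at x) u) (at a) v"
      using frechet_derivative_component[OF smooth_on_differentiable[OF f]]
      by (subst frechet_derivative_cong[OF S]) auto
    finally show ?thesis .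
  qed
  show "frechet_derivative (\<lambda>x. frechet_derivative f (at x) u) (at a) v $ i
      = frechet_derivative (\<lambda>x. frechet_derivative f (at x) v) (at a) u $ i"
    unfolding * by (rule symmetric_second_derivative_real[OF smooth_on_component[OF S(1) f] S])
qed

section \<open>Cramer's rule with smooth coefficients\<close>

lemma smooth_on_det:
  fixes M :: "'e::real_normed_vector \<Rightarrow> real ^ 'n ^ 'n"
  assumes "open S" "\<And>i j. smooth_on (\<lambda>y. M y $ i $ j) S"
  shows "smooth_on (\<lambda>y. det (M y)) S"
  unfolding det_def using assms by (intro smooth_on_sum smooth_on_mult smooth_on_prod) auto

lemma smooth_on_solve:
  fixes B :: "'e::real_normed_vector \<Rightarrow> real ^ 'n \<Rightarrow> real ^ 'n \<Rightarrow> real"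
  assumes S: "open S"
    and linl: "\<And>y w. y \<in> S \<Longrightarrow> linear (\<lambda>v. B y v w)" and linr: "\<And>y v. y \<in> S \<Longrightarrow> linear (B y v)"
    and nondeg: "\<And>y v. y \<in> S \<Longrightarrow> (\<And>w. B y v w = 0) \<Longrightarrow> v = 0"
    and B: "\<And>v w. smooth_on (\<lambda>y. B y v w) S" and b: "\<And>w. smooth_on (\<lambda>y. b y w) S"
    and x: "\<And>y w. y \<in> S \<Longrightarrow> B y (x y) w = b y w"
  shows "smooth_on x S"
proof -
  \<comment> \<open>Rows are indexed by the test vector and columns by the unknown, so that
    \<open>M y *v v\<close> lists the values of \<open>B y v\<close> on the standard basis.\<close>
  define M :: "'e \<Rightarrow> real ^ 'n ^ 'n" where "M y = (\<chi> i j. B y (axis j 1) (axis i 1))" for y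
  define c :: "'e \<Rightarrow> real ^ 'n" where "c y = (\<chi> i. b y (axis i 1))" for y
  have Mv: "(M y *v v) $ i = B y v (axis i 1)" if "y \<in> S" for y v i
    using linear_vec_expansion[OF linl[OF that], of v "axis i 1"]
    by (simp add: M_def matrix_vector_mult_def mult.commute)
  have "det (M y) \<noteq> 0" if y: "y \<in> S" for y
  proof -
    have "v = 0" if "M y *v v = 0" for v
    proof (rule nondeg[OF y])
      fix w
      show "B y v w = 0"
        using linear_vec_expansion[OF linr[OF y], of v w] Mv[OF y, of v] that by simp
    qed
    then have "\<exists>N. N ** M y = mat 1" using matrix_left_invertible_ker by blast
    then show ?thesis using invertible_det_nz invertible_left_inverse by blast
  qed
  moreover have "M y *v x y = c y" if "y \<in> S" for y
    using Mv[OF that, of "x y"] x[OF that] by (simp add: vec_eq_iff c_def)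
  ultimately have cr: "x y = (\<chi> k. det (\<chi> i j. if j = k then c y $ i else M y $ i $ j) / det (M y))"
    if "y \<in> S" for y
    using cramer that by blast
  have "smooth_on (\<lambda>y. \<chi> k. det (\<chi> i j. if j = k then c y $ i else M y $ i $ j) / det (M y)) S"
  proof (rule smooth_on_vec[OF S])
    fix k
    have e: "smooth_on (\<lambda>y. M y $ i $ j) S" "smooth_on (\<lambda>y. c y $ i) S" for i j
      using B b by (auto simp: M_def c_def)
    have "smooth_on (\<lambda>y. det (\<chi> i j. if j = k then c y $ i else M y $ i $ j)) S"
    proof (rule smooth_on_det[OF S])
      show "smooth_on (\<lambda>y. (\<chi> i j. if j = k then c y $ i else M y $ i $ j) $ i $ j) S" for i j
        using e by (cases "j = k") auto
    qed
    then show "smooth_on (\<lambda>y. (\<chi> k. det (\<chi> i j. if j = k then c y $ i else M y $ i $ j) / det (M y)) $ k) S"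
      using smooth_on_det[OF S e(1)] \<open>\<And>y. y \<in> S \<Longrightarrow> det (M y) \<noteq> 0\<close> by (simp add: smooth_on_divide[OF S])
  qed
  then show ?thesis by (rule smooth_on_cong[OF S, rotated]) (simp add: cr)
qed

text \<open>The functions \<open>t^(-n) e^(-1/t)\<close>, extended by 0 to the left. The bump
  profile is the case \<open>n = 0\<close>; the other exponents are there because the derivatives of
  all these functions are linear combinations of members of the family.\<close>

definition flat :: "nat \<Rightarrow> real \<Rightarrow> real" where
  "flat n t = (if t > 0 then inverse t ^ n / exp (inverse t) else 0)"

lemma flat_has_derivative:
  "(flat n has_real_derivative (flat (n + 2) t - real n * flat (n + 1) t)) (at t)"
proof -
  consider "t < 0" | "t > 0" | "t = 0" by linarith
  then show ?thesis
  proof cases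
    case 1
    have "((\<lambda>t. 0) has_real_derivative 0) (at t)" by simp
    then have "(flat n has_real_derivative 0) (at t)"
      by (rule DERIV_cong_ev[THEN iffD1, rotated 3])
        (use 1 in \<open>auto simp: flat_def eventually_nhds intro!: exI[of _ "{..<0}"]\<close>)
    then show ?thesis using 1 by (simp add: flat_def)
  next
    case 2
    have "((\<lambda>t. inverse t ^ n * exp (- inverse t)) has_real_derivative
        (flat (n + 2) t - real n * flat (n + 1) t)) (at t)"
    proof (cases n)
      case 0
      then show ?thesis using 2
        by (auto intro!: derivative_eq_intros simp: flat_def exp_minus field_simps power2_eq_square)
    next
      case (Suc m)
      show ?thesis unfolding Suc using 2
        by (auto intro!: derivative_eq_intros simp: flat_def exp_minus field_simps power2_eq_square
            simp del: power_Suc) (simp add: field_simps)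
    qed
    then have "(flat n has_real_derivative (flat (n + 2) t - real n * flat (n + 1) t)) (at t)"
      by (rule DERIV_cong_ev[THEN iffD1, rotated 3])
        (use 2 in \<open>auto simp: flat_def eventually_nhds exp_minus divide_inverse intro!: exI[of _ "{0<..}"]\<close>)
    then show ?thesis .
  next
    case 3
    \<comment> \<open>With \<open>s = 1/h\<close>, the right difference quotient of
      \<open>flat n\<close> at 0 is \<open>s^(n+1) / e^s\<close>, which tends to 0 as
      \<open>s\<close> grows.\<close>
    have "((\<lambda>h. inverse h ^ Suc n / exp (inverse h)) \<longlongrightarrow> 0) (at_right (0::real))"
      by (rule filterlim_compose[OF tendsto_power_div_exp_0 filterlim_inverse_at_top_right])
    then have "((\<lambda>h. (flat n (0 + h) - flat n 0) / h) \<longlongrightarrow> 0) (at_right 0)"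
      by (rule tendsto_cong[THEN iffD1, rotated])
        (auto simp: flat_def eventually_at_right_field field_simps intro!: exI[of _ 1])
    moreover have "((\<lambda>h. 0) \<longlongrightarrow> 0) (at_left (0::real))" by simp
    then have "((\<lambda>h. (flat n (0 + h) - flat n 0) / h) \<longlongrightarrow> 0) (at_left 0)"
      by (rule tendsto_cong[THEN iffD1, rotated])
        (auto simp: flat_def eventually_at_left_field intro!: exI[of _ "-1"])
    ultimately have "(flat n has_real_derivative 0) (at 0)"
      unfolding DERIV_def by (rule filterlim_split_at[rotated])
    then show ?thesis using 3 by (simp add: flat_def)
  qed
qed

lemma smooth_on_flat: "smooth_on (flat n) S"
proof -
  have D: "(flat n has_derivative (\<lambda>h. (flat (n + 2) t - real n * flat (n + 1) t) * h)) (at t)" for n t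
    using flat_has_derivative by (simp add: has_field_derivative_def)
  have D': "frechet_derivative (flat n) (at t) v = (flat (n + 2) t - real n * flat (n + 1) t) * v" for n t v
    using frechet_derivative_at[OF D] by metis
  have "Ck_on k (flat n) UNIV" for k
  proof (induction k arbitrary: n)
    case 0
    then show ?case using D by (auto intro!: continuous_at_imp_continuous_on has_derivative_continuous)
  next
    case (Suc k)
    have "Ck_on k (\<lambda>t. (flat (n + 2) t + (- real n) * flat (n + 1) t) * v) UNIV" for v
      by (intro Ck_on_bilinear[OF bounded_bilinear_mult] Ck_on_add Suc.IH Ck_on_const) auto
    then show ?case using D by (auto simp: D' differentiable_def)
  qed
  then show ?thesis using Ck_on_subset unfolding smooth_on_def by blast
qed


section \<open>Nondegeneracy of contact forms\<close>

text \<open>Multilinearity in the first \<open>k\<close> entries together with independence of the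
  later ones, since arguments are infinite sequences. Alternation is treated separately and comes
  from the sum over permutations (\<open>wedge_repeated\<close>).\<close>

definition kform :: "nat \<Rightarrow> ((nat \<Rightarrow> 'v::real_vector) \<Rightarrow> real) \<Rightarrow> bool" where
  "kform k f \<longleftrightarrow> (\<forall>vs vs'. (\<forall>i<k. vs i = vs' i) \<longrightarrow> f vs = f vs') \<and>
     (\<forall>vs. \<forall>j<k. linear (\<lambda>w. f (vs(j := w))))"

definition annihilates :: "'v \<Rightarrow> nat \<Rightarrow> ((nat \<Rightarrow> 'v) \<Rightarrow> real) \<Rightarrow> bool" where
  "annihilates v k f \<longleftrightarrow> (\<forall>vs. \<forall>j<k. vs j = v \<longrightarrow> f vs = 0)"

lemma kform_cong: "kform k f \<Longrightarrow> (\<And>i. i < k \<Longrightarrow> vs i = vs' i) \<Longrightarrow> f vs = f vs'"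
  unfolding kform_def by blast

lemma kform_linear: "kform k f \<Longrightarrow> j < k \<Longrightarrow> linear (\<lambda>w. f (vs(j := w)))"
  unfolding kform_def by blast

text \<open>In each summand, entry \<open>j\<close> is read at exactly one position,
  \<open>i0 = inv \<pi> j\<close>. It belongs to one of the two factors, which is linear there,
  while the other factor stays constant.\<close>

lemma kform_wedge:
  assumes \<alpha>: "kform k \<alpha>" and \<beta>: "kform l \<beta>"
  shows "kform (k + l) (wedge k l \<alpha> \<beta>)"
  unfolding kform_def
proof (intro conjI allI impI)
  fix vs vs' :: "nat \<Rightarrow> 'a" assume eq: "\<forall>i<k + l. vs i = vs' i"
  have "\<alpha> (\<lambda>i. vs (\<pi> i)) = \<alpha> (\<lambda>i. vs' (\<pi> i)) \<and> \<beta> (\<lambda>i. vs (\<pi> (k + i))) = \<beta> (\<lambda>i. vs' (\<pi> (k + i)))"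
    if "\<pi> permutes {..<k + l}" for \<pi>
    using permutes_in_image[OF that] eq by (intro conjI kform_cong[OF \<alpha>] kform_cong[OF \<beta>]) auto
  then show "wedge k l \<alpha> \<beta> vs = wedge k l \<alpha> \<beta> vs'"
    unfolding wedge_def by (intro arg_cong2[where f="(/)"] sum.cong) auto
next
  fix vs :: "nat \<Rightarrow> 'a" and j assume j: "j < k + l"
  have "linear (\<lambda>w. of_int (sign \<pi>) * \<alpha> (\<lambda>i. (vs(j := w)) (\<pi> i)) * \<beta> (\<lambda>i. (vs(j := w)) (\<pi> (k + i))))"
    if \<pi>: "\<pi> permutes {..<k + l}" for \<pi>
  proof -
    define i0 where "i0 = inv \<pi> j"
    have i0: "\<pi> i = j \<longleftrightarrow> i = i0" for i using permutes_inv_eq[OF \<pi>, of j i] by (auto simp: i0_def)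
    have i0_less: "i0 < k + l"
      using permutes_in_image[OF permutes_inv[OF \<pi>], of j] j by (simp add: i0_def)
    show ?thesis
    proof (cases "i0 < k")
      case True
      have "\<beta> (\<lambda>i. (vs(j := w)) (\<pi> (k + i))) = \<beta> (\<lambda>i. vs (\<pi> (k + i)))" for w
        using True by (intro kform_cong[OF \<beta>]) (auto simp: i0)
      moreover have "(\<lambda>i. (vs(j := w)) (\<pi> i)) = (\<lambda>i. vs (\<pi> i))(i0 := w)" for w
        by (auto simp: i0)
      ultimately show ?thesis
        using kform_linear[OF \<alpha> True, of "\<lambda>i. vs (\<pi> i)"]
        by (auto simp: linear_iff algebra_simps)
    next
      case False
      have "\<alpha> (\<lambda>i. (vs(j := w)) (\<pi> i)) = \<alpha> (\<lambda>i. vs (\<pi> i))" for w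
        using False by (intro kform_cong[OF \<alpha>]) (auto simp: i0)
      moreover have "(\<lambda>i. (vs(j := w)) (\<pi> (k + i))) = (\<lambda>i. vs (\<pi> (k + i)))(i0 - k := w)" for w
        using False by (auto simp: i0 fun_eq_iff)
      moreover have "i0 - k < l" using False i0_less by simp
      ultimately show ?thesis
        using kform_linear[OF \<beta>, of "i0 - k" "\<lambda>i. vs (\<pi> (k + i))"]
        by (auto simp: linear_iff algebra_simps)
    qed
  qed
  then have "linear (\<lambda>w. \<Sum>\<pi> | \<pi> permutes {..<k + l}.
      of_int (sign \<pi>) * \<alpha> (\<lambda>i. (vs(j := w)) (\<pi> i)) * \<beta> (\<lambda>i. (vs(j := w)) (\<pi> (k + i))))"
    by (intro linear_compose_sum) auto
  from linear_compose_scale_right[OF this, of "inverse (fact k * fact l)"]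
  show "linear (\<lambda>w. wedge k l \<alpha> \<beta> (vs(j := w)))"
    unfolding wedge_def by (simp add: divide_inverse mult.commute)
qed

text \<open>Every permutation hands the entry \<open>v\<close> to one of the two factors, and that
  factor vanishes.\<close>

lemma annihilates_wedge:
  assumes "annihilates v k \<alpha>" "annihilates v l \<beta>"
  shows "annihilates v (k + l) (wedge k l \<alpha> \<beta>)"
  unfolding annihilates_def
proof (intro allI impI)
  fix vs j assume j: "j < k + l" "vs j = v"
  have "\<alpha> (\<lambda>i. vs (\<pi> i)) = 0 \<or> \<beta> (\<lambda>i. vs (\<pi> (k + i))) = 0" if \<pi>: "\<pi> permutes {..<k + l}" for \<pi>
  proof -
    define i0 where "i0 = inv \<pi> j"
    have i0: "\<pi> i0 = j" using permutes_inverses(1)[OF \<pi>] by (simp add: i0_def)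
    have i0_less: "i0 < k + l"
      using permutes_in_image[OF permutes_inv[OF \<pi>], of j] j by (simp add: i0_def)
    show ?thesis
    proof (cases "i0 < k")
      case True
      then have "\<alpha> (\<lambda>i. vs (\<pi> i)) = 0"
        using assms(1) i0 j unfolding annihilates_def by auto
      then show ?thesis ..
    next
      case False
      then have "i0 - k < l" "vs (\<pi> (k + (i0 - k))) = v" using i0_less i0 j by auto
      then have "\<beta> (\<lambda>i. vs (\<pi> (k + i))) = 0"
        using assms(2) unfolding annihilates_def by metis
      then show ?thesis ..
    qed
  qed
  then show "wedge k l \<alpha> \<beta> vs = 0"
    unfolding wedge_def by (subst sum.neutral) auto
qed

text \<open>Reindexing the sum by left composition with \<tau> pulls out the sign of \<tau>.\<close>

lemma wedge_permute:
  assumes \<tau>: "\<tau> permutes {..<k + l}"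
  shows "wedge k l \<alpha> \<beta> vs = of_int (sign \<tau>) * wedge k l \<alpha> \<beta> (vs \<circ> \<tau>)"
proof -
  have "sign (\<tau> \<circ> \<pi>) = sign \<tau> * sign \<pi>" if "\<pi> permutes {..<k + l}" for \<pi>
    using that \<tau> by (intro sign_compose) (auto intro: permutation_permutes[THEN iffD2])
  then show ?thesis
    unfolding wedge_def by (subst setum_permutations_compose_left[OF \<tau>])
      (auto simp: sum_distrib_left mult.assoc intro!: sum.cong)
qed

text \<open>Swapping the two equal entries leaves \<open>vs\<close> unchanged but reverses the
  sign.\<close>

lemma wedge_repeated:
  assumes "i < k + l" "j < k + l" "i \<noteq> j" "vs i = vs j"
  shows "wedge k l \<alpha> \<beta> vs = 0"
proof -
  have "Transposition.transpose i j permutes {..<k + l}" using assms by (intro permutes_swap_id) auto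
  moreover have "vs \<circ> Transposition.transpose i j = vs" using assms by (auto simp: fun_eq_iff Transposition.transpose_def)
  ultimately show ?thesis using wedge_permute[of "Transposition.transpose i j" k l \<alpha> \<beta> vs] assms
    by (simp add: sign_swap_id)
qed

text \<open>Degree equals dimension, so the vectors \<open>vs i\<close> are either dependent or span
  everything, including \<open>v\<close>. In both cases some nonzero \<open>x\<close> has
  \<open>T x\<close> equal to 0 or \<open>v\<close>. Putting \<open>T x\<close> into a slot with
  nonzero coefficient gives that coefficient times \<open>f vs\<close> by alternation, and 0 by
  linearity or by \<open>ann\<close>.\<close>

lemma alternating_form_zero:
  fixes f :: "(nat \<Rightarrow> real ^ 'm) \<Rightarrow> real"
  assumes f: "kform CARD('m) f" and ann: "annihilates v CARD('m) f" and "v \<noteq> 0"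
    and alt: "\<And>vs i j. i < CARD('m) \<Longrightarrow> j < CARD('m) \<Longrightarrow> i \<noteq> j \<Longrightarrow> vs i = vs j \<Longrightarrow> f vs = 0"
  shows "f vs = 0"
proof -
  obtain idx :: "'m \<Rightarrow> nat" where idx: "bij_betw idx UNIV {..<CARD('m)}"
    using ex_bij_betw_finite_nat[of "UNIV :: 'm set"] by (auto simp: atLeast0LessThan)
  have idx_less: "idx i < CARD('m)" for i using idx by (auto simp: bij_betw_def)
  have idx_inj: "idx i = idx j \<longleftrightarrow> i = j" for i j using idx by (auto simp: bij_betw_def inj_on_def)
  define T where "T x = (\<Sum>i\<in>UNIV. x $ i *\<^sub>R vs (idx i))" for x :: "real ^ 'm"
  have T: "linear T"
    unfolding T_def by (auto simp: linear_iff algebra_simps sum.distrib scaleR_right.sum)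
  obtain x where x: "x \<noteq> 0" "T x = 0 \<or> T x = v"
  proof (cases "inj T")
    case True
    then have "surj T" using T linear_injective_imp_surjective by blast
    then obtain x where "T x = v" by (metis surjD)
    then show ?thesis using \<open>v \<noteq> 0\<close> linear_0[OF T] that by (cases "x = 0") auto
  next
    case False
    then show ?thesis using linear_injective_0[OF T] that by auto
  qed
  obtain i where i: "x $ i \<noteq> 0" using x(1) by (auto simp: vec_eq_iff)
  let ?g = "\<lambda>w. f (vs(idx i := w))"
  have g: "linear ?g" by (rule kform_linear[OF f idx_less])
  have "?g (vs (idx j)) = 0" if "j \<noteq> i" for j
    using that by (intro alt[of "idx i" "idx j"] idx_less) (auto simp: idx_inj)
  then have "?g (T x) = (\<Sum>j\<in>UNIV. if j = i then x $ i * f vs else 0)"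
    unfolding T_def linear_sum[OF g] by (intro sum.cong) (auto simp: linear_scale[OF g])
  also have "\<dots> = x $ i * f vs" by simp
  finally have "?g (T x) = x $ i * f vs" .
  moreover have "?g (T x) = 0"
    using x(2) linear_0[OF g] ann idx_less[of i] unfolding annihilates_def by auto
  ultimately show ?thesis using i by simp
qed

text \<open>A vector killed by both \<open>e\<close> and \<open>w\<close> annihilates every wedge
  factor, hence the whole form, whose degree \<open>2n + 1\<close> is the dimension; a nonzero such
  vector would force that form to vanish.\<close>

lemma contact_nondegenerate:
  fixes e :: "real ^ 'm \<Rightarrow> real" and w :: "real ^ 'm \<Rightarrow> real ^ 'm \<Rightarrow> real"
  assumes m: "CARD('m) = 2 * n + 1" and e: "linear e" and w: "\<And>v. linear (\<lambda>u. w u v)"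
    and anti: "\<And>u v. w u v = - w v u"
    and top: "wedge 1 (2 * n) (\<lambda>vs. e (vs 0)) (wedge_pow (\<lambda>vs. w (vs 0) (vs 1)) n) \<noteq> (\<lambda>vs. 0)"
    and v: "e v = 0" "\<And>z. w v z = 0"
  shows "v = 0"
proof (rule ccontr)
  assume "v \<noteq> 0"
  let ?w = "\<lambda>vs. w (vs 0) (vs 1)"
  have w': "linear (w u)" for u
    unfolding linear_iff using w[of u] anti[of u] by (simp add: linear_iff algebra_simps)
  have "kform 2 ?w"
    using w w' by (auto simp: kform_def less_2_cases_iff)
  then have kp: "kform (2 * k) (wedge_pow ?w k)" for k
  proof (induction k)
    case 0
    show ?case by (simp add: kform_def)
  next
    case (Suc k)
    then show ?case using kform_wedge[of 2 ?w "2 * k"] by (simp add: algebra_simps)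
  qed
  have "annihilates v 2 ?w"
    using v anti[of _ v] by (auto simp: annihilates_def less_2_cases_iff)
  then have ap: "annihilates v (2 * k) (wedge_pow ?w k)" for k
  proof (induction k)
    case 0
    show ?case by (simp add: annihilates_def)
  next
    case (Suc k)
    then show ?case using annihilates_wedge[of v 2 ?w "2 * k"] by (simp add: algebra_simps)
  qed
  have e1: "kform 1 (\<lambda>vs. e (vs 0))" "annihilates v 1 (\<lambda>vs. e (vs 0))"
    using e v by (auto simp: kform_def annihilates_def)
  have "wedge 1 (2 * n) (\<lambda>vs. e (vs 0)) (wedge_pow ?w n) vs = 0" for vs
  proof (rule alternating_form_zero[OF _ _ \<open>v \<noteq> 0\<close>])
    show "kform CARD('m) (wedge 1 (2 * n) (\<lambda>vs. e (vs 0)) (wedge_pow ?w n))"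
      using kform_wedge[OF e1(1) kp] m by simp
    show "annihilates v CARD('m) (wedge 1 (2 * n) (\<lambda>vs. e (vs 0)) (wedge_pow ?w n))"
      using annihilates_wedge[OF e1(2) ap] m by simp
  qed (use wedge_repeated[of _ 1 "2 * n"] m in auto)
  then show False using top by auto
qed

text \<open>Linear model of one tangent space carrying the values of \<eta> and
  \<open>d\<eta>\<close>. It is instantiated in the preferred chart and again in the coordinates of
  an arbitrary chart.\<close>

locale contact_space =
  fixes e :: "real ^ 'm \<Rightarrow> real" and w :: "real ^ 'm \<Rightarrow> real ^ 'm \<Rightarrow> real"
  assumes lin_e: "linear e" and lin_w: "linear (\<lambda>u. w u v)" and anti: "w u v = - w v u"
    and nondeg: "e u = 0 \<Longrightarrow> (\<And>z. w u z = 0) \<Longrightarrow> u = 0"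
    and odd_dim: "odd CARD('m)"
begin

lemma lin_w2: "linear (w u)"
  unfolding linear_iff using lin_w[of u] anti[of u] by (simp add: linear_iff algebra_simps)

lemma w_self [simp]: "w u u = 0"
  using anti[of u u] by simp

lemma lin_B: "linear (\<lambda>u. w u v + e u * e v)" "linear (\<lambda>v. w u v + e u * e v)"
  using lin_w[of v] lin_w2[of u] lin_e by (auto simp: linear_iff algebra_simps)

text \<open>Testing \<open>u\<close> against itself kills \<open>w\<close> and leaves the square of
  \<open>e u\<close>. Adding the product \<open>e u * e v\<close> thus merges the conditions on
  \<open>e u\<close> and \<open>w u\<close> into one square system with trivial kernel.\<close>

lemma B_nondeg:
  assumes "\<And>v. w u v + e u * e v = 0"
  shows "u = 0"
proof -
  have eu: "e u = 0" using assms[of u] by simp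
  have "w u z = 0" for z using assms[of z] eu by simp
  with eu show ?thesis by (rule nondeg)
qed

text \<open>A skew matrix of odd size satisfies \<open>det W = - det W\<close> and is singular. By
  \<open>nondeg\<close>, \<open>e\<close> does not vanish on a nonzero kernel vector, which can
  therefore be normalised.\<close>

lemma reeb_exists: "\<exists>r. e r = 1 \<and> (\<forall>v. w r v = 0)"
proof -
  define W :: "real ^ 'm ^ 'm" where "W = (\<chi> i j. w (axis j 1) (axis i 1))"
  have "Finite_Cartesian_Product.transpose W = (\<chi> i. (-1) *s W $ i)"
    by (simp add: W_def Finite_Cartesian_Product.transpose_def vec_eq_iff) (intro allI anti)
  then have "det W = (\<Prod>i\<in>(UNIV::'m set). -1) * det (\<chi> i. W $ i)"
    using det_transpose[of W] det_rows_mul[of "\<lambda>_. -1" "\<lambda>i. W $ i"] by simp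
  then have "det W = 0" using odd_dim by simp
  then have "\<not> (\<exists>N. N ** W = mat 1)" using invertible_det_nz invertible_left_inverse by metis
  then obtain x where x: "W *v x = 0" "x \<noteq> 0" using matrix_left_invertible_ker by blast
  have "(W *v x) $ i = w x (axis i 1)" for i
    using linear_vec_expansion[OF lin_w, of x "axis i 1"]
    by (simp add: W_def matrix_vector_mult_def mult.commute)
  then have wx: "w x v = 0" for v using linear_vec_expansion[OF lin_w2, of x v] x by simp
  then have "e x \<noteq> 0" using nondeg x by blast
  then show ?thesis using wx
    by (intro exI[of _ "inverse (e x) *\<^sub>R x"]) (auto simp: linear_scale[OF lin_e] linear_scale[OF lin_w])
qed

lemma solve_unique: "e u = e u' \<Longrightarrow> (\<And>v. w u v = w u' v) \<Longrightarrow> u = u'"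
  using nondeg[of "u - u'"] linear_diff[OF lin_e] linear_diff[OF lin_w] by simp

text \<open>\<open>b r = 0\<close> is the compatibility condition, since \<open>w u r = 0\<close>
  for all \<open>u\<close>. The square system is solved with right-hand side \<open>b + c e\<close>;
  testing the solution on \<open>r\<close> returns \<open>e u = c\<close>, and the
  \<open>e\<close>-terms cancel.\<close>

lemma solve_exists:
  assumes b: "linear b" and r: "e r = 1" "\<And>v. w r v = 0" and "b r = 0"
  shows "\<exists>u. e u = c \<and> (\<forall>v. w u v = b v)"
proof -
  define T :: "real ^ 'm \<Rightarrow> real ^ 'm" where "T u = (\<chi> i. w u (axis i 1) + e u * e (axis i 1))" for u
  have Ti: "linear f \<Longrightarrow> (\<And>i. T u $ i = f (axis i 1)) \<Longrightarrow> w u v + e u * e v = f v" for f u v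
    using linear_vec_expansion[OF lin_B(2), of u v] linear_vec_expansion[of f v] by (simp add: T_def)
  have T: "linear T"
    using lin_B(1) by (auto simp: T_def linear_iff vec_eq_iff)
  have "u = 0" if "T u = 0" for u
  proof (rule B_nondeg)
    show "w u v + e u * e v = 0" for v using Ti[of "\<lambda>_. 0" u] that by (simp add: linear_zero)
  qed
  then have "inj T" by (simp add: linear_injective_0[OF T])
  then have "surj T" using T linear_injective_imp_surjective by blast
  then obtain u where "T u = (\<chi> i. b (axis i 1) + c * e (axis i 1))" by (metis surjD)
  then have u: "w u v + e u * e v = b v + c * e v" for v
    using b lin_e by (intro Ti[of "\<lambda>v. b v + c * e v"]) (auto simp: linear_iff algebra_simps)
  have "e u = c" using u[of r] r anti[of u r] assms(4) by simp
  then show ?thesis using u by auto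
qed

end


section \<open>Tensor fields in charts\<close>

lemma frechet_derivative_chain:
  assumes S: "open S" "x \<in> S" and eq: "\<And>z. z \<in> S \<Longrightarrow> h z = g (f z)"
    and f: "f differentiable (at x)" and g: "g differentiable (at (f x))"
  shows "frechet_derivative h (at x) v = frechet_derivative g (at (f x)) (frechet_derivative f (at x) v)"
proof -
  have "frechet_derivative h (at x) = frechet_derivative (g \<circ> f) (at x)"
    using eq by (intro frechet_derivative_cong[OF S]) simp
  then show ?thesis using frechet_derivative_compose[OF f g] by simp
qed

definition chart_region :: "('a, 'm::finite) chart \<Rightarrow> 'a set \<Rightarrow> (real ^ 'm) set" where
  "chart_region c W = chart_map c ` (chart_dom c \<inter> W)"

text \<open>Exterior derivative in the coordinates of one fixed chart, so that it may itself be
  differentiated in \<open>y\<close>; \<open>ext_deriv\<close> is its value at the base point of the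
  preferred chart.\<close>

definition exd :: "('e::real_normed_vector \<Rightarrow> 'e \<Rightarrow> real) \<Rightarrow> 'e \<Rightarrow> 'e \<Rightarrow> 'e \<Rightarrow> real" where
  "exd e y u v = frechet_derivative (\<lambda>y. e y v) (at y) u - frechet_derivative (\<lambda>y. e y u) (at y) v"

lemma exd_antisym: "exd e y u v = - exd e y v u"
  by (simp add: exd_def)

lemma exd_self [simp]: "exd e y u u = 0"
  by (simp add: exd_def)

locale smooth_manifold =
  fixes A :: "('a::{t2_space,second_countable_topology}, 'm::finite) chart set"
  assumes atlas: "smooth_atlas A"
begin

lemma chart: "c \<in> A \<Longrightarrow> is_chart c"
  using atlas by (simp add: smooth_atlas_def)

lemma chart_at: "chart_at A p \<in> A" "p \<in> chart_dom (chart_at A p)"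
proof -
  have "p \<in> (\<Union>c\<in>A. chart_dom c)" using atlas by (simp add: smooth_atlas_def)
  then have "\<exists>c. c \<in> A \<and> p \<in> chart_dom c" by blast
  then have "chart_at A p \<in> A \<and> p \<in> chart_dom (chart_at A p)"
    unfolding chart_at_def by (rule someI_ex)
  then show "chart_at A p \<in> A" "p \<in> chart_dom (chart_at A p)" by auto
qed

lemma chart_inv_map: "c \<in> A \<Longrightarrow> q \<in> chart_dom c \<Longrightarrow> chart_inv c (chart_map c q) = q"
  using chart[of c] by (simp add: is_chart_def homeomorphism_def)

lemma chart_map_inv: "c \<in> A \<Longrightarrow> y \<in> chart_region c W \<Longrightarrow> chart_map c (chart_inv c y) = y"
  using chart_inv_map[of c] by (auto simp: chart_region_def)

lemma chart_inv_in: "c \<in> A \<Longrightarrow> y \<in> chart_region c W \<Longrightarrow> chart_inv c y \<in> chart_dom c \<inter> W"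
  using chart_inv_map[of c] by (auto simp: chart_region_def)

lemma region_iff:
  "c \<in> A \<Longrightarrow> y \<in> chart_region c W \<longleftrightarrow> y \<in> chart_region c UNIV \<and> chart_inv c y \<in> W"
  using chart_inv_map[of c] by (auto simp: chart_region_def)

lemma in_region: "q \<in> chart_dom c \<Longrightarrow> q \<in> W \<Longrightarrow> chart_map c q \<in> chart_region c W"
  by (simp add: chart_region_def)

lemma open_chart_dom: "c \<in> A \<Longrightarrow> open (chart_dom c)"
  using chart[of c] by (simp add: is_chart_def)

lemma open_region: "c \<in> A \<Longrightarrow> open W \<Longrightarrow> open (chart_region c W)"
proof -
  assume c: "c \<in> A" and W: "open W"
  have h: "homeomorphism (chart_dom c) (chart_map c ` chart_dom c) (chart_map c) (chart_inv c)"
    and o: "open (chart_map c ` chart_dom c)"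
    using chart[OF c] by (auto simp: is_chart_def)
  have "openin (top_of_set (chart_dom c)) (chart_dom c \<inter> W)" using W by auto
  from homeomorphism_imp_open_map[OF h this] show ?thesis
    using o by (simp add: chart_region_def openin_open_eq)
qed

lemma continuous_chart_inv: "c \<in> A \<Longrightarrow> continuous_on (chart_region c W) (chart_inv c)"
  using chart[of c] unfolding is_chart_def homeomorphism_def chart_region_def
  by (auto intro: continuous_on_subset)

lemma continuous_chart_map: "c \<in> A \<Longrightarrow> continuous_on (chart_dom c) (chart_map c)"
  using chart[of c] unfolding is_chart_def homeomorphism_def by auto

lemma base_pt: "base_pt A p \<in> chart_region (chart_at A p) W" if "p \<in> W"
  using that chart_at by (simp add: base_pt_def chart_region_def)

section \<open>Transition maps and changes of coordinates\<close>

lemma smooth_transition: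
  "c \<in> A \<Longrightarrow> d \<in> A \<Longrightarrow> smooth_on (chart_map d \<circ> chart_inv c) (chart_region c (chart_dom d))"
  using atlas by (simp add: smooth_atlas_def chart_region_def)

lemma transition_differentiable:
  "c \<in> A \<Longrightarrow> d \<in> A \<Longrightarrow> q \<in> chart_dom c \<Longrightarrow> q \<in> chart_dom d \<Longrightarrow>
     (chart_map d \<circ> chart_inv c) differentiable (at (chart_map c q))"
  by (rule smooth_on_differentiable[OF smooth_transition in_region])

lemma coord_change_linear:
  "c \<in> A \<Longrightarrow> d \<in> A \<Longrightarrow> q \<in> chart_dom c \<Longrightarrow> q \<in> chart_dom d \<Longrightarrow> linear (coord_change c d q)"
  unfolding coord_change_def by (rule linear_frechet_derivative[OF transition_differentiable])

lemma coord_change_id: "c \<in> A \<Longrightarrow> q \<in> chart_dom c \<Longrightarrow> coord_change c c q v = v"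
proof -
  assume c: "c \<in> A" "q \<in> chart_dom c"
  have "frechet_derivative (chart_map c \<circ> chart_inv c) (at (chart_map c q))
      = frechet_derivative (\<lambda>x. x) (at (chart_map c q))"
    by (rule frechet_derivative_cong[OF open_region[OF c(1) open_UNIV] in_region])
      (use c chart_map_inv in auto)
  then show ?thesis by (simp add: coord_change_def)
qed

lemma coord_change_comp:
  assumes "c \<in> A" "d \<in> A" "e \<in> A" "q \<in> chart_dom c" "q \<in> chart_dom d" "q \<in> chart_dom e"
  shows "coord_change d e q (coord_change c d q v) = coord_change c e q v"
proof -
  have "frechet_derivative (chart_map e \<circ> chart_inv c) (at (chart_map c q)) v
     = frechet_derivative (chart_map e \<circ> chart_inv d) (at ((chart_map d \<circ> chart_inv c) (chart_map c q)))
         (frechet_derivative (chart_map d \<circ> chart_inv c) (at (chart_map c q)) v)"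
  proof (rule frechet_derivative_chain[OF open_region[OF assms(1) open_chart_dom[OF assms(2)]] in_region])
    show "(chart_map e \<circ> chart_inv c) z = (chart_map e \<circ> chart_inv d) ((chart_map d \<circ> chart_inv c) z)"
      if "z \<in> chart_region c (chart_dom d)" for z
      using chart_inv_in[OF assms(1) that] chart_inv_map[OF assms(2)] by simp
    show "(chart_map d \<circ> chart_inv c) differentiable (at (chart_map c q))"
      using assms by (intro transition_differentiable)
    show "(chart_map e \<circ> chart_inv d) differentiable (at ((chart_map d \<circ> chart_inv c) (chart_map c q)))"
      using transition_differentiable[OF assms(2,3,5,6)] assms(1,4) by (simp add: chart_inv_map)
  qed (use assms in auto)
  then show ?thesis using assms by (simp add: coord_change_def chart_inv_map)
qed

lemma coord_change_inverse:
  assumes "c \<in> A" "d \<in> A" "q \<in> chart_dom c" "q \<in> chart_dom d"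
  shows "coord_change d c q (coord_change c d q v) = v"
  using coord_change_comp[OF assms(1,2,1) assms(3,4,3)] coord_change_id[OF assms(1,3)] by simp

lemma smooth_coord_change:
  assumes "c \<in> A" "d \<in> A"
  shows "smooth_on (\<lambda>y. coord_change c d (chart_inv c y) v) (chart_region c (chart_dom d))"
proof (rule smooth_on_cong[OF open_region[OF assms(1) open_chart_dom[OF assms(2)]]])
  show "smooth_on (\<lambda>y. frechet_derivative (chart_map d \<circ> chart_inv c) (at y) v) (chart_region c (chart_dom d))"
    by (rule smooth_on_frechet[OF smooth_transition[OF assms]])
qed (use chart_map_inv[OF assms(1)] in \<open>simp add: coord_change_def\<close>)

section \<open>Coordinate representations of tensor fields\<close>

lemma vf_rep_map: "c \<in> A \<Longrightarrow> q \<in> chart_dom c \<Longrightarrow>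
   vf_rep A c Y (chart_map c q) = coord_change (chart_at A q) c q (Y q)"
  by (simp add: vf_rep_def chart_inv_map)

lemma form_rep_map: "c \<in> A \<Longrightarrow> q \<in> chart_dom c \<Longrightarrow>
   form_rep A c \<omega> (chart_map c q) v = \<omega> q (coord_change c (chart_at A q) q v)"
  by (simp add: form_rep_def chart_inv_map)

lemma endo_rep_map: "c \<in> A \<Longrightarrow> q \<in> chart_dom c \<Longrightarrow>
   endo_rep A c N (chart_map c q) v = coord_change (chart_at A q) c q (N q (coord_change c (chart_at A q) q v))"
  by (simp add: endo_rep_def chart_inv_map)

lemma vf_rep_base: "vf_rep A (chart_at A p) Y (base_pt A p) = Y p"
  by (simp add: base_pt_def vf_rep_map chart_at coord_change_id)

lemma form_rep_base: "form_rep A (chart_at A p) \<omega> (base_pt A p) v = \<omega> p v"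
  by (simp add: base_pt_def form_rep_map chart_at coord_change_id)

lemma endo_rep_base: "endo_rep A (chart_at A p) N (base_pt A p) v = N p v"
  by (simp add: base_pt_def endo_rep_map chart_at coord_change_id)

lemma ext_deriv_exd: "ext_deriv A \<omega> p = exd (form_rep A (chart_at A p) \<omega>) (base_pt A p)"
  by (simp add: fun_eq_iff ext_deriv_def exd_def)

lemma smooth_funD: "smooth_fun A W f \<Longrightarrow> c \<in> A \<Longrightarrow> smooth_on (\<lambda>y. f (chart_inv c y)) (chart_region c W)"
  by (simp add: smooth_fun_def chart_region_def comp_def)

lemma smooth_funI: "(\<And>c. c \<in> A \<Longrightarrow> smooth_on (\<lambda>y. f (chart_inv c y)) (chart_region c W)) \<Longrightarrow> smooth_fun A W f"
  by (simp add: smooth_fun_def chart_region_def comp_def)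

lemma smooth_vfD: "smooth_vf A W Y \<Longrightarrow> c \<in> A \<Longrightarrow> smooth_on (vf_rep A c Y) (chart_region c W)"
  by (simp add: smooth_vf_def chart_region_def)

lemma smooth_vfI: "(\<And>c. c \<in> A \<Longrightarrow> smooth_on (vf_rep A c Y) (chart_region c W)) \<Longrightarrow> smooth_vf A W Y"
  by (simp add: smooth_vf_def chart_region_def)

lemma smooth_formD: "smooth_form A W \<omega> \<Longrightarrow> c \<in> A \<Longrightarrow> smooth_on (\<lambda>y. form_rep A c \<omega> y v) (chart_region c W)"
  by (simp add: smooth_form_def chart_region_def)

lemma smooth_formI:
  "(\<And>p. p \<in> W \<Longrightarrow> linear (\<omega> p)) \<Longrightarrow>
   (\<And>c v. c \<in> A \<Longrightarrow> smooth_on (\<lambda>y. form_rep A c \<omega> y v) (chart_region c W)) \<Longrightarrow> smooth_form A W \<omega>"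
  by (simp add: smooth_form_def chart_region_def)

lemma smooth_endoD: "smooth_endo A W N \<Longrightarrow> c \<in> A \<Longrightarrow> smooth_on (\<lambda>y. endo_rep A c N y v) (chart_region c W)"
  by (simp add: smooth_endo_def chart_region_def)

lemma smooth_endoI:
  "(\<And>p. p \<in> W \<Longrightarrow> linear (N p)) \<Longrightarrow>
   (\<And>c v. c \<in> A \<Longrightarrow> smooth_on (\<lambda>y. endo_rep A c N y v) (chart_region c W)) \<Longrightarrow> smooth_endo A W N"
  by (simp add: smooth_endo_def chart_region_def)

lemma form_rep_linear:
  assumes "smooth_form A W \<omega>" "c \<in> A" "y \<in> chart_region c W"
  shows "linear (form_rep A c \<omega> y)"
proof -
  have q: "chart_inv c y \<in> chart_dom c" "chart_inv c y \<in> W" using chart_inv_in[OF assms(2,3)] by auto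
  have "linear (\<omega> (chart_inv c y))" using assms(1) q by (simp add: smooth_form_def)
  from linear_compose[OF coord_change_linear[OF assms(2) chart_at(1) q(1) chart_at(2)] this]
  show ?thesis by (simp add: form_rep_def[abs_def] comp_def Let_def)
qed

lemma endo_rep_linear:
  assumes "smooth_endo A W N" "c \<in> A" "y \<in> chart_region c W"
  shows "linear (endo_rep A c N y)"
proof -
  have q: "chart_inv c y \<in> chart_dom c" "chart_inv c y \<in> W" using chart_inv_in[OF assms(2,3)] by auto
  have "linear (N (chart_inv c y))" using assms(1) q by (simp add: smooth_endo_def)
  from linear_compose[OF linear_compose[OF coord_change_linear[OF assms(2) chart_at(1) q(1) chart_at(2)] this]
     coord_change_linear[OF chart_at(1) assms(2) chart_at(2) q(1)]]
  show ?thesis by (simp add: endo_rep_def[abs_def] comp_def Let_def)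
qed

lemma form_rep_change:
  assumes "c \<in> A" "d \<in> A" "q \<in> chart_dom c" "q \<in> chart_dom d"
  shows "form_rep A c \<omega> (chart_map c q) v = form_rep A d \<omega> (chart_map d q) (coord_change c d q v)"
  using assms by (simp add: form_rep_map coord_change_comp chart_at)

text \<open>The two coordinate changes cancel: the contraction is a genuine function on the manifold
  and may be differentiated in any chart.\<close>

lemma form_apply_rep:
  assumes "c \<in> A" "y \<in> chart_region c W"
  shows "form_rep A c \<omega> y (vf_rep A c Y y) = \<omega> (chart_inv c y) (Y (chart_inv c y))"
  using chart_inv_in[OF assms] assms(1)
  by (simp add: form_rep_def vf_rep_def Let_def coord_change_inverse chart_at)

text \<open>In chart \<open>c\<close> the form is the pullback of its representation in
  \<open>d\<close> under the transition map \<open>T\<close>. Differentiating produces, besides the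
  expected term, \<open>F y\<close> applied to the second derivative of \<open>T\<close>; being
  symmetric in \<open>u\<close> and \<open>v\<close>, this cancels in \<open>exd\<close>.\<close>

lemma exd_natural:
  assumes \<omega>: "smooth_form A W \<omega>" and W: "open W" "q \<in> W"
    and c: "c \<in> A" "q \<in> chart_dom c" and d: "d \<in> A" "q \<in> chart_dom d"
  shows "exd (form_rep A c \<omega>) (chart_map c q) u v
       = exd (form_rep A d \<omega>) (chart_map d q) (coord_change c d q u) (coord_change c d q v)"
proof -
  define T where "T = chart_map d \<circ> chart_inv c"
  define y where "y = chart_map c q"
  define S where "S = chart_region c (chart_dom d \<inter> W)"
  define F where "F z = form_rep A d \<omega> (T z)" for z
  have S: "open S" "y \<in> S"
    using open_region[OF c(1)] open_chart_dom[OF d(1)] W c d by (auto simp: S_def y_def in_region)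
  have inS: "chart_inv c z \<in> chart_dom c" "chart_inv c z \<in> chart_dom d" "chart_inv c z \<in> W"
    "chart_map c (chart_inv c z) = z" if "z \<in> S" for z
    using chart_inv_in[OF c(1), of z "chart_dom d \<inter> W"] chart_map_inv[OF c(1), of z "chart_dom d \<inter> W"] that
    by (auto simp: S_def)
  have Ty: "T y = chart_map d q" using c by (simp add: T_def y_def chart_inv_map)
  have Tin: "T z \<in> chart_region d W" if "z \<in> S" for z
    using inS[OF that] by (simp add: T_def in_region)
  have T: "smooth_on T S"
    using smooth_on_subset[OF smooth_transition[OF c(1) d(1)], of S]
    by (auto simp: T_def S_def chart_region_def)
  have Td: "T differentiable (at y)" by (rule smooth_on_differentiable[OF T S(2)])
  have linF: "linear (F z)" if "z \<in> S" for z
    unfolding F_def by (rule form_rep_linear[OF \<omega> d(1) Tin[OF that]])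
  have Fs: "smooth_on (\<lambda>z. F z w) S" for w
    unfolding F_def
    by (rule smooth_on_compose[OF S(1) _ T smooth_formD[OF \<omega> d(1)]]) (use Tin in auto)
  have cc: "frechet_derivative T (at y) = coord_change c d q"
    by (simp add: coord_change_def T_def y_def)
  have key: "frechet_derivative (\<lambda>z. form_rep A c \<omega> z v) (at y) u
     = frechet_derivative (\<lambda>z. form_rep A d \<omega> z (coord_change c d q v)) (at (chart_map d q)) (coord_change c d q u)
       + F y (frechet_derivative (\<lambda>z. frechet_derivative T (at z) v) (at y) u)" for u v
  proof -
    have "frechet_derivative (\<lambda>z. form_rep A c \<omega> z v) (at y) u
        = frechet_derivative (\<lambda>z. F z (frechet_derivative T (at z) v)) (at y) u"
    proof (rule fun_cong[OF frechet_derivative_cong[OF S]])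
      fix z assume z: "z \<in> S"
      show "form_rep A c \<omega> z v = F z (frechet_derivative T (at z) v)"
        using form_rep_change[OF c(1) d(1) inS(1,2)[OF z], of \<omega> v] inS(4)[OF z]
        by (simp add: F_def T_def coord_change_def)
    qed
    also have "\<dots> = frechet_derivative (\<lambda>z. F z (frechet_derivative T (at y) v)) (at y) u
       + F y (frechet_derivative (\<lambda>z. frechet_derivative T (at z) v) (at y) u)"
      by (rule frechet_derivative_apply[OF S linF])
        (auto intro: smooth_on_differentiable[OF Fs S(2)] smooth_on_differentiable[OF smooth_on_frechet[OF T] S(2)])
    also have "frechet_derivative (\<lambda>z. F z (frechet_derivative T (at y) v)) (at y) u
      = frechet_derivative (\<lambda>z. form_rep A d \<omega> z (frechet_derivative T (at y) v)) (at (T y)) (frechet_derivative T (at y) u)"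
      by (rule frechet_derivative_chain[OF S _ Td])
        (auto simp: F_def intro: smooth_on_differentiable[OF smooth_formD[OF \<omega> d(1)] Tin[OF S(2)]])
    finally show ?thesis by (simp add: cc Ty)
  qed
  show ?thesis
    unfolding exd_def y_def[symmetric] key
    using symmetric_second_derivative[OF T S, of u v] by simp
qed

lemma exd_ext_deriv:
  assumes "smooth_form A W \<omega>" "open W" "q \<in> W" "c \<in> A" "q \<in> chart_dom c"
  shows "exd (form_rep A c \<omega>) (chart_map c q) u v
     = ext_deriv A \<omega> q (coord_change c (chart_at A q) q u) (coord_change c (chart_at A q) q v)"
  using exd_natural[OF assms chart_at(1,2)] by (simp add: ext_deriv_exd base_pt_def)

lemma dfun_chart:
  assumes f: "smooth_fun A W f" and W: "open W" "q \<in> W" and c: "c \<in> A" "q \<in> chart_dom c"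
  shows "frechet_derivative (\<lambda>y. f (chart_inv c y)) (at (chart_map c q)) u
       = dfun A f q (coord_change c (chart_at A q) q u)"
proof -
  let ?d = "chart_at A q"
  have d: "?d \<in> A" "q \<in> chart_dom ?d" by (auto simp: chart_at)
  have "frechet_derivative (\<lambda>y. f (chart_inv c y)) (at (chart_map c q)) u
     = frechet_derivative (\<lambda>y. f (chart_inv ?d y)) (at ((chart_map ?d \<circ> chart_inv c) (chart_map c q)))
         (frechet_derivative (chart_map ?d \<circ> chart_inv c) (at (chart_map c q)) u)"
  proof (rule frechet_derivative_chain[OF open_region[OF c(1) open_chart_dom[OF d(1)]] in_region])
    show "f (chart_inv c z) = f (chart_inv ?d ((chart_map ?d \<circ> chart_inv c) z))"
      if "z \<in> chart_region c (chart_dom ?d)" for z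
      using chart_inv_in[OF c(1) that] chart_inv_map[OF d(1)] by simp
    show "(\<lambda>y. f (chart_inv ?d y)) differentiable (at ((chart_map ?d \<circ> chart_inv c) (chart_map c q)))"
      using smooth_on_differentiable[OF smooth_funD[OF f d(1)] in_region[OF d(2) W(2)]] c
      by (simp add: chart_inv_map)
    show "(chart_map ?d \<circ> chart_inv c) differentiable (at (chart_map c q))"
      using c d by (intro transition_differentiable)
  qed (use c d in auto)
  then show ?thesis using c d
    by (simp add: dfun_def coord_change_def chart_inv_map base_pt_def comp_def)
qed

text \<open>A chart domain need not be mapped into a single chart, so smoothness is checked locally,
  on the preimage of one chart around the image point. There the pullback is rewritten in fixed
  charts \<open>c\<close> and \<open>d\<close>, free of the preferred charts at \<open>q\<close> and
  \<open>\<Phi> q\<close>, which vary with \<open>q\<close>.\<close>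

lemma smooth_pullback:
  assumes \<Phi>: "smooth_self_map A \<Phi>" and \<omega>: "smooth_form A UNIV \<omega>"
  shows "smooth_form A UNIV (pullback A \<Phi> \<omega>)"
proof -
  define P where "P c d = chart_map d \<circ> \<Phi> \<circ> chart_inv c" for c d :: "('a, 'm) chart"
  have cont: "open (\<Phi> -` chart_dom d)" if "d \<in> A" for d
    using \<Phi> open_chart_dom[OF that] by (auto simp: smooth_self_map_def intro: open_vimage)
  have Ps: "smooth_on (P c d) (chart_region c (\<Phi> -` chart_dom d))" if "c \<in> A" "d \<in> A" for c d
    using \<Phi> that by (simp add: smooth_self_map_def P_def chart_region_def)
  have Pd: "P c d differentiable (at (chart_map c q))"
    if "c \<in> A" "d \<in> A" "q \<in> chart_dom c" "\<Phi> q \<in> chart_dom d" for c d q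
    using smooth_on_differentiable[OF Ps[OF that(1,2)] in_region] that by simp
  have tm: "tangent_map A \<Phi> q = frechet_derivative (P (chart_at A q) (chart_at A (\<Phi> q))) (at (chart_map (chart_at A q) q))" for q
    by (simp add: tangent_map_def P_def base_pt_def)
  have lin: "linear (pullback A \<Phi> \<omega> p)" for p
  proof -
    have "linear (tangent_map A \<Phi> p)" unfolding tm
      by (rule linear_frechet_derivative[OF Pd]) (auto simp: chart_at)
    moreover have "linear (\<omega> (\<Phi> p))" using \<omega> by (simp add: smooth_form_def)
    ultimately have "linear (\<omega> (\<Phi> p) \<circ> tangent_map A \<Phi> p)" by (rule linear_compose)
    then show ?thesis by (simp add: pullback_def[abs_def] comp_def)
  qed
  have rep: "form_rep A c (pullback A \<Phi> \<omega>) (chart_map c q) v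
     = form_rep A d \<omega> (P c d (chart_map c q)) (frechet_derivative (P c d) (at (chart_map c q)) v)"
    if c: "c \<in> A" "q \<in> chart_dom c" and d: "d \<in> A" "\<Phi> q \<in> chart_dom d" for c d q v
  proof -
    let ?a = "chart_at A q" and ?b = "chart_at A (\<Phi> q)"
    note at = chart_at(1)[of q] chart_at(2)[of q] chart_at(1)[of "\<Phi> q"] chart_at(2)[of "\<Phi> q"]
    have inv_c: "chart_inv c (chart_map c q) = q" by (rule chart_inv_map[OF c])
    \<comment> \<open>The derivative of \<open>P c ?b\<close> is computed twice: through the
      preferred chart at \<open>q\<close>, which gives \<open>tangent_map\<close>, and through
      \<open>d\<close>, which gives the derivative in the fixed charts.\<close>
    have "frechet_derivative (P c ?b) (at (chart_map c q)) v
       = frechet_derivative (P ?a ?b) (at ((chart_map ?a \<circ> chart_inv c) (chart_map c q)))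
          (frechet_derivative (chart_map ?a \<circ> chart_inv c) (at (chart_map c q)) v)"
    proof (rule frechet_derivative_chain[OF open_region[OF c(1) open_chart_dom[OF at(1)]] in_region])
      show "P c ?b z = P ?a ?b ((chart_map ?a \<circ> chart_inv c) z)" if "z \<in> chart_region c (chart_dom ?a)" for z
        using chart_inv_in[OF c(1) that] chart_inv_map[OF at(1)] by (simp add: P_def)
      show "(chart_map ?a \<circ> chart_inv c) differentiable (at (chart_map c q))"
        using c at by (intro transition_differentiable)
      show "P ?a ?b differentiable (at ((chart_map ?a \<circ> chart_inv c) (chart_map c q)))"
        using Pd[OF at(1,3,2,4)] by (simp add: inv_c)
    qed (use c at in auto)
    then have 1: "frechet_derivative (P c ?b) (at (chart_map c q)) v = tangent_map A \<Phi> q (coord_change c ?a q v)"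
      by (simp add: tm coord_change_def inv_c)
    have "frechet_derivative (P c ?b) (at (chart_map c q)) v
       = frechet_derivative (chart_map ?b \<circ> chart_inv d) (at (P c d (chart_map c q)))
          (frechet_derivative (P c d) (at (chart_map c q)) v)"
    proof (rule frechet_derivative_chain[OF open_region[OF c(1) cont[OF d(1)]] in_region])
      show "P c ?b z = (chart_map ?b \<circ> chart_inv d) (P c d z)" if "z \<in> chart_region c (\<Phi> -` chart_dom d)" for z
        using chart_inv_in[OF c(1) that] chart_inv_map[OF d(1)] by (simp add: P_def)
      show "(chart_map ?b \<circ> chart_inv d) differentiable at (P c d (chart_map c q))"
        using transition_differentiable[OF d(1) at(3) d(2) at(4)] by (simp add: P_def inv_c)
    qed (use c d Pd in auto)
    then have 2: "frechet_derivative (P c ?b) (at (chart_map c q)) v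
        = coord_change d ?b (\<Phi> q) (frechet_derivative (P c d) (at (chart_map c q)) v)"
      by (simp add: coord_change_def P_def inv_c)
    have Pq: "P c d (chart_map c q) = chart_map d (\<Phi> q)" by (simp add: P_def inv_c)
    show ?thesis
      using 1 2 unfolding Pq form_rep_map[OF c] form_rep_map[OF d] pullback_def by simp
  qed
  have "smooth_on (\<lambda>y. form_rep A c (pullback A \<Phi> \<omega>) y v) (chart_region c UNIV)" if c: "c \<in> A" for c v
  proof (rule smooth_on_local)
    fix y assume y: "y \<in> chart_region c UNIV"
    let ?d = "chart_at A (\<Phi> (chart_inv c y))"
    let ?S = "chart_region c (\<Phi> -` chart_dom ?d)"
    have d: "?d \<in> A" by (rule chart_at)
    have S: "open ?S" by (rule open_region[OF c cont[OF d]])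
    have yS: "y \<in> ?S" using y region_iff[OF c, of y "\<Phi> -` chart_dom ?d"] chart_at(2) by simp
    have Pin: "P c ?d z \<in> chart_region ?d UNIV" if "z \<in> ?S" for z
      using chart_inv_in[OF c that] by (auto simp: P_def intro: in_region)
    have "smooth_on (\<lambda>z. form_rep A ?d \<omega> (P c ?d z) (frechet_derivative (P c ?d) (at z) v)) ?S"
    proof (rule smooth_on_apply[OF S])
      show "linear (form_rep A ?d \<omega> (P c ?d z))" if "z \<in> ?S" for z
        by (rule form_rep_linear[OF \<omega> d Pin[OF that]])
      show "smooth_on (\<lambda>z. form_rep A ?d \<omega> (P c ?d z) w) ?S" for w
        by (rule smooth_on_compose[OF S _ Ps[OF c d] smooth_formD[OF \<omega> d]]) (use Pin in auto)
      show "smooth_on (\<lambda>z. frechet_derivative (P c ?d) (at z) v) ?S"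
        by (rule smooth_on_frechet[OF Ps[OF c d]])
    qed
    then have "smooth_on (\<lambda>y. form_rep A c (pullback A \<Phi> \<omega>) y v) ?S"
    proof (rule smooth_on_cong[OF S, rotated])
      fix z assume z: "z \<in> ?S"
      show "form_rep A ?d \<omega> (P c ?d z) (frechet_derivative (P c ?d) (at z) v) = form_rep A c (pullback A \<Phi> \<omega>) z v"
        using rep[OF c _ d, of "chart_inv c z" v] chart_inv_in[OF c z] chart_map_inv[OF c z] by simp
    qed
    then show "\<exists>T. open T \<and> y \<in> T \<and> smooth_on (\<lambda>y. form_rep A c (pullback A \<Phi> \<omega>) y v) T"
      using S yS by blast
  qed
  then show ?thesis using lin by (intro smooth_formI) auto
qed

end


section \<open>The Lie derivative computation in a chart\<close>

lemma frechet_derivative_eq: "(f has_derivative f') (at x) \<Longrightarrow> frechet_derivative f (at x) v = f' v"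
  by (metis frechet_derivative_at)

locale local_form =
  fixes S :: "(real ^ 'm) set" and e :: "real ^ 'm \<Rightarrow> real ^ 'm \<Rightarrow> real"
  assumes S: "open S" and lin: "y \<in> S \<Longrightarrow> linear (e y)" and smooth: "smooth_on (\<lambda>y. e y v) S"
begin

lemma diff: "y \<in> S \<Longrightarrow> (\<lambda>y. e y v) differentiable (at y)"
  by (rule smooth_on_differentiable[OF smooth])

lemma exd_linear:
  assumes y: "y \<in> S"
  shows "linear (\<lambda>u. exd e y u v)"
  unfolding exd_def
  by (intro linear_compose_sub linear_frechet_derivative diff y
      linear_frechet_derivative_param[OF S y lin])

lemma exd_linear2: "y \<in> S \<Longrightarrow> linear (exd e y u)"
  using linear_compose_neg[OF exd_linear[of y u]] by (simp add: exd_antisym[of e y u, abs_def])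

lemma exd_smooth: "smooth_on (\<lambda>y. exd e y u v) S"
  unfolding exd_def by (intro smooth_on_diff smooth_on_frechet smooth S)

lemma exd_diff: "y \<in> S \<Longrightarrow> (\<lambda>y. exd e y u v) differentiable (at y)"
  by (rule smooth_on_differentiable[OF exd_smooth])

text \<open>This is \<open>d(de) = 0\<close> on constant fields, whose brackets vanish; the six
  second derivatives cancel in pairs by symmetry.\<close>

lemma exd_closed:
  assumes y: "y \<in> S"
  shows "frechet_derivative (\<lambda>y. exd e y u v) (at y) w + frechet_derivative (\<lambda>y. exd e y v w) (at y) u
      + frechet_derivative (\<lambda>y. exd e y w u) (at y) v = 0"
proof -
  have dd: "(\<lambda>y. frechet_derivative (\<lambda>y. e y v) (at y) u) differentiable (at y)" for u v
    by (rule smooth_on_differentiable[OF smooth_on_frechet[OF smooth] y])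
  have D: "frechet_derivative (\<lambda>y. exd e y u v) (at y) w
     = frechet_derivative (\<lambda>y. frechet_derivative (\<lambda>y. e y v) (at y) u) (at y) w
     - frechet_derivative (\<lambda>y. frechet_derivative (\<lambda>y. e y u) (at y) v) (at y) w" for u v w
    unfolding exd_def
    by (intro frechet_derivative_eq has_derivative_diff) (use dd in \<open>auto simp: frechet_derivative_works\<close>)
  have sym: "frechet_derivative (\<lambda>y. frechet_derivative (\<lambda>y. e y v) (at y) u) (at y) w
     = frechet_derivative (\<lambda>y. frechet_derivative (\<lambda>y. e y v) (at y) w) (at y) u" for u v w
    by (rule symmetric_second_derivative_real[OF smooth S y])
  show ?thesis unfolding D
    using sym[of v u w] sym[of u v w] sym[of w v u] by simp
qed

lemma frechet_derivative_contract:
  assumes y: "y \<in> S" and x: "smooth_on x S"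
  shows "frechet_derivative (\<lambda>z. e z (x z)) (at y) u
    = frechet_derivative (\<lambda>z. e z (x y)) (at y) u + e y (frechet_derivative x (at y) u)"
  by (rule frechet_derivative_apply[OF S y lin diff[OF y] smooth_on_differentiable[OF x y]])

lemma frechet_derivative_contract_exd:
  assumes y: "y \<in> S" and x: "smooth_on x S"
  shows "frechet_derivative (\<lambda>z. exd e z (x z) v) (at y) u
    = frechet_derivative (\<lambda>z. exd e z (x y) v) (at y) u + exd e y (frechet_derivative x (at y) u) v"
  by (rule frechet_derivative_apply[OF S y exd_linear exd_diff[OF y] smooth_on_differentiable[OF x y]])

text \<open>Cartan's formula \<open>L_x e = \<iota>_x de + d(e(x))\<close>, with the Lie derivative
  in the coordinate form of \<open>lie_form\<close>.\<close>

lemma cartan_form: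
  assumes y: "y \<in> S" and x: "smooth_on x S"
  shows "frechet_derivative (\<lambda>z. e z v) (at y) (x y) + e y (frechet_derivative x (at y) v)
    = exd e y (x y) v + frechet_derivative (\<lambda>z. e z (x z)) (at y) v"
  unfolding frechet_derivative_contract[OF assms] by (simp add: exd_def)

text \<open>Cartan's formula for the closed form \<open>de\<close>: since \<open>d(de) = 0\<close>,
  only \<open>L_x de = d(\<iota>_x de)\<close> remains.\<close>

lemma cartan_exd:
  assumes y: "y \<in> S" and x: "smooth_on x S"
  shows "frechet_derivative (\<lambda>z. exd e z u v) (at y) (x y)
      + exd e y (frechet_derivative x (at y) u) v + exd e y u (frechet_derivative x (at y) v)
    = frechet_derivative (\<lambda>z. exd e z (x z) v) (at y) u - frechet_derivative (\<lambda>z. exd e z (x z) u) (at y) v"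
proof -
  have neg: "frechet_derivative (\<lambda>z. exd e z v (x y)) (at y) u = - frechet_derivative (\<lambda>z. exd e z (x y) v) (at y) u"
  proof -
    have "((\<lambda>z. - exd e z (x y) v) has_derivative (\<lambda>u. - frechet_derivative (\<lambda>z. exd e z (x y) v) (at y) u)) (at y)"
      using exd_diff[OF y] unfolding frechet_derivative_works by (rule has_derivative_minus)
    then show ?thesis by (subst exd_antisym) (rule frechet_derivative_eq)
  qed
  show ?thesis
    unfolding frechet_derivative_contract_exd[OF assms]
    using exd_closed[OF y, of u v "x y"] neg exd_antisym[of e y u "frechet_derivative x (at y) v"] by linarith
qed

end

text \<open>The whole situation in one chart, with \<open>e\<close>, \<open>s\<close>,
  \<open>h\<close>, \<open>x\<close>, \<open>r\<close> in place of \<eta>, \<sigma>,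
  \<open>H\<close>, \<open>X\<close>, \<open>R\<close>. The canonoid condition enters only as
  \<open>ds_x\<close>. The equation \<open>de_N\<close> is the one for \<open>N\<close> already
  extended from \<open>ker \<eta>\<close> to all \<open>w\<close>.\<close>

locale local_canonoid =
  eta: local_form S e + sigma: local_form S s for S :: "(real ^ 'm) set" and e s +
  fixes h a :: "real ^ 'm \<Rightarrow> real" and x r :: "real ^ 'm \<Rightarrow> real ^ 'm"
    and N :: "real ^ 'm \<Rightarrow> real ^ 'm \<Rightarrow> real ^ 'm"
  assumes h: "smooth_on h S" and a: "smooth_on a S" and x: "smooth_on x S" and r: "smooth_on r S"
    and N: "smooth_on (\<lambda>y. N y v) S" and linN: "y \<in> S \<Longrightarrow> linear (N y)"
    and e_x: "y \<in> S \<Longrightarrow> e y (x y) = - h y"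
    and de_x: "y \<in> S \<Longrightarrow> exd e y (x y) v = frechet_derivative h (at y) v - a y * e y v"
    and ds_x: "y \<in> S \<Longrightarrow> exd s y (x y) v = 0"
    and e_r: "y \<in> S \<Longrightarrow> e y (r y) = 1" and de_r: "y \<in> S \<Longrightarrow> exd e y (r y) v = 0"
    and e_N: "y \<in> S \<Longrightarrow> e y (N y v) = 0"
    and de_N: "y \<in> S \<Longrightarrow> exd e y (N y v) w = - (h y * exd s y v w) + e y w * (h y * exd s y v (r y))"
    and nondeg: "y \<in> S \<Longrightarrow> e y u = 0 \<Longrightarrow> (\<And>z. exd e y u z = 0) \<Longrightarrow> u = 0"
begin

abbreviation "Dx y \<equiv> frechet_derivative x (at y)"

lemma dh_x:
  assumes y: "y \<in> S"
  shows "frechet_derivative h (at y) (x y) = - a y * h y"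
  using de_x[OF y, of "x y"] e_x[OF y] by simp

text \<open>Cartan's formula gives \<open>(dh - a e) + d(-h)\<close>, in which \<open>dh\<close>
  cancels.\<close>

lemma lie_e:
  assumes y: "y \<in> S"
  shows "frechet_derivative (\<lambda>z. e z v) (at y) (x y) + e y (Dx y v) = - a y * e y v"
proof -
  have "((\<lambda>z. - h z) has_derivative (\<lambda>v. - frechet_derivative h (at y) v)) (at y)"
    by (rule has_derivative_minus[OF smooth_on_has_derivative[OF h y]])
  then have "frechet_derivative (\<lambda>z. e z (x z)) (at y) v = - frechet_derivative h (at y) v"
    using frechet_derivative_cong[OF eta.S y, of "\<lambda>z. e z (x z)" "\<lambda>z. - h z"] e_x
    by (simp add: frechet_derivative_eq)
  then show ?thesis using eta.cartan_form[OF y x, of v] de_x[OF y, of v] by simp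
qed

lemma lie_ds:
  assumes y: "y \<in> S"
  shows "frechet_derivative (\<lambda>z. exd s z u v) (at y) (x y) + exd s y (Dx y u) v + exd s y u (Dx y v) = 0"
proof -
  have "frechet_derivative (\<lambda>z. exd s z (x z) v) (at y) = (\<lambda>_. 0)" for v
    using frechet_derivative_cong[OF eta.S y, of "\<lambda>z. exd s z (x z) v" "\<lambda>_. 0"] ds_x by simp
  then show ?thesis using sigma.cartan_exd[OF y x] by simp
qed

text \<open>The exterior derivative of \<open>L_x e = -a e\<close>, that is,
  \<open>L_x de = -da \<and> e - a de\<close>. It is obtained by differentiating
  \<open>\<iota>_x de = dh - a e\<close>, where \<open>dh\<close> drops out because its second
  derivatives are symmetric.\<close>

lemma lie_de:
  assumes y: "y \<in> S"
  shows "frechet_derivative (\<lambda>z. exd e z u v) (at y) (x y) + exd e y (Dx y u) v + exd e y u (Dx y v)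
    = - (frechet_derivative a (at y) u * e y v) + frechet_derivative a (at y) v * e y u - a y * exd e y u v"
proof -
  have D: "frechet_derivative (\<lambda>z. exd e z (x z) v) (at y) u
     = frechet_derivative (\<lambda>z. frechet_derivative h (at z) v) (at y) u
       - (a y * frechet_derivative (\<lambda>z. e z v) (at y) u + frechet_derivative a (at y) u * e y v)" for u v
  proof -
    have "((\<lambda>z. frechet_derivative h (at z) v - a z * e z v) has_derivative
      (\<lambda>u. frechet_derivative (\<lambda>z. frechet_derivative h (at z) v) (at y) u
       - (a y * frechet_derivative (\<lambda>z. e z v) (at y) u + frechet_derivative a (at y) u * e y v))) (at y)"
      by (intro has_derivative_diff has_derivative_mult smooth_on_has_derivative[OF _ y]
          smooth_on_frechet h a eta.smooth)
    then have "((\<lambda>z. exd e z (x z) v) has_derivative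
      (\<lambda>u. frechet_derivative (\<lambda>z. frechet_derivative h (at z) v) (at y) u
       - (a y * frechet_derivative (\<lambda>z. e z v) (at y) u + frechet_derivative a (at y) u * e y v))) (at y)"
      by (rule has_derivative_transform_within_open[OF _ eta.S y]) (simp add: de_x)
    then show ?thesis by (rule frechet_derivative_eq)
  qed
  have "a y * exd e y u v = a y * frechet_derivative (\<lambda>z. e z v) (at y) u
      - a y * frechet_derivative (\<lambda>z. e z u) (at y) v"
    by (simp add: exd_def right_diff_distrib)
  then show ?thesis
    using D[of v u] D[of u v] eta.cartan_exd[OF y x, of u v]
      symmetric_second_derivative_real[OF h eta.S y, of u v]
    by linarith
qed

text \<open>\<open>?M\<close> is the vector \<open>(L_x N) v\<close>. Differentiating the two
  defining equations of \<open>N\<close> along \<open>x\<close> shows that \<open>e\<close> and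
  \<open>\<iota>\<close> of \<open>?M\<close> into \<open>de\<close> both vanish, and nondegeneracy
  gives \<open>?M = 0\<close>.\<close>

lemma lie_N:
  assumes y: "y \<in> S"
  shows "frechet_derivative (\<lambda>z. N z v) (at y) (x y) - Dx y (N y v) + N y (Dx y v) = 0" (is "?M = 0")
proof -
  let ?DN = "frechet_derivative (\<lambda>z. N z v) (at y) (x y)"
  have "frechet_derivative (\<lambda>z. e z (N z v)) (at y) = (\<lambda>_. 0)"
    using frechet_derivative_cong[OF eta.S y, of "\<lambda>z. e z (N z v)" "\<lambda>_. 0"] e_N by simp
  then have "frechet_derivative (\<lambda>z. e z (N y v)) (at y) (x y) + e y ?DN = 0"
    using eta.frechet_derivative_contract[OF y N[of v], of "x y"] by simp
  then have eM: "e y ?M = 0"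
    using lie_e[OF y, of "N y v"] e_N[OF y]
    by (simp add: linear_add[OF eta.lin[OF y]] linear_diff[OF eta.lin[OF y]])
  have ker: "exd e y ?M w = 0" if w: "e y w = 0" for w
  proof -
    \<comment> \<open>Even for \<open>w\<close> in the kernel of \<open>e\<close> at
      \<open>y\<close>, the vector \<open>Dx y w\<close> need not lie there, so the extended
      equation with its coefficient \<open>k\<close> is the one to differentiate. The derivative of
      \<open>k\<close> disappears because \<open>e y w = 0\<close>; the two occurrences of
      \<open>k\<close> itself, in \<open>G2\<close> via \<open>ew\<close> and in \<open>N1\<close>,
      cancel.\<close>
    define k where "k z = h z * exd s z v (r z)" for z
    have "smooth_on (\<lambda>z. exd s z v (r z)) S"
      by (rule smooth_on_apply[OF eta.S sigma.exd_linear2 sigma.exd_smooth r])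
    then have ks: "smooth_on k S"
      unfolding k_def by (rule smooth_on_mult[OF eta.S h])
    have "((\<lambda>z. - (h z * exd s z v w) + e z w * k z) has_derivative
       (\<lambda>u. - (h y * frechet_derivative (\<lambda>z. exd s z v w) (at y) u + frechet_derivative h (at y) u * exd s y v w)
         + (e y w * frechet_derivative k (at y) u + frechet_derivative (\<lambda>z. e z w) (at y) u * k y))) (at y)"
      by (intro has_derivative_add has_derivative_minus has_derivative_mult smooth_on_has_derivative[OF _ y]
          h eta.smooth sigma.exd_smooth ks)
    then have "((\<lambda>z. exd e z (N z v) w) has_derivative
       (\<lambda>u. - (h y * frechet_derivative (\<lambda>z. exd s z v w) (at y) u + frechet_derivative h (at y) u * exd s y v w)
         + (e y w * frechet_derivative k (at y) u + frechet_derivative (\<lambda>z. e z w) (at y) u * k y))) (at y)"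
      by (rule has_derivative_transform_within_open[OF _ eta.S y]) (simp add: de_N k_def)
    then have G2: "frechet_derivative (\<lambda>z. exd e z (N z v) w) (at y) (x y) =
        - (h y * frechet_derivative (\<lambda>z. exd s z v w) (at y) (x y) - a y * h y * exd s y v w)
         + frechet_derivative (\<lambda>z. e z w) (at y) (x y) * k y"
      using w dh_x[OF y] by (simp add: frechet_derivative_eq)
    have G1: "frechet_derivative (\<lambda>z. exd e z (N z v) w) (at y) (x y)
       = frechet_derivative (\<lambda>z. exd e z (N y v) w) (at y) (x y) + exd e y ?DN w"
      by (rule eta.frechet_derivative_contract_exd[OF y N])
    have ew: "frechet_derivative (\<lambda>z. e z w) (at y) (x y) = - e y (Dx y w)"
      using lie_e[OF y, of w] w by simp
    \<comment> \<open>The terms with the derivative of \<open>a\<close> vanish because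
      \<open>e\<close> kills both \<open>N y v\<close> and \<open>w\<close>. The right-hand side
      cancels the contribution of \<open>h\<close> in \<open>G2\<close>, which leaves
      \<open>h\<close> times \<open>lie_ds\<close>.\<close>
    have L: "frechet_derivative (\<lambda>z. exd e z (N y v) w) (at y) (x y) + exd e y (Dx y (N y v)) w
        + exd e y (N y v) (Dx y w) = a y * (h y * exd s y v w)"
      using lie_de[OF y, of "N y v" w] w e_N[OF y] de_N[OF y, of v w] by simp
    have N1: "exd e y (N y v) (Dx y w) = - (h y * exd s y v (Dx y w)) + e y (Dx y w) * k y"
      using de_N[OF y] by (simp add: k_def)
    have N2: "exd e y (N y (Dx y v)) w = - (h y * exd s y (Dx y v) w)"
      using de_N[OF y] w by simp
    have Ls: "h y * frechet_derivative (\<lambda>z. exd s z v w) (at y) (x y) + h y * exd s y (Dx y v) w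
        + h y * exd s y v (Dx y w) = 0"
      using arg_cong[OF lie_ds[OF y, of v w], of "\<lambda>t. h y * t"] by (simp add: algebra_simps)
    have "exd e y ?M w = exd e y ?DN w - exd e y (Dx y (N y v)) w + exd e y (N y (Dx y v)) w"
      by (simp add: linear_add[OF eta.exd_linear[OF y]] linear_diff[OF eta.exd_linear[OF y]])
    then show ?thesis using G1 G2 L N1 N2 Ls unfolding ew by (simp add: algebra_simps)
  qed
  show ?thesis
  proof (rule nondeg[OF y eM])
    fix z
    \<comment> \<open>Splitting \<open>z\<close> along the kernel of \<open>e\<close> and the Reeb
      direction, where \<open>de\<close> vanishes anyway.\<close>
    have "exd e y ?M z = exd e y ?M (z - e y z *\<^sub>R r y) + e y z * exd e y ?M (r y)"
      by (simp add: linear_diff[OF eta.exd_linear2[OF y]] linear_scale[OF eta.exd_linear2[OF y]])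
    also have "exd e y ?M (r y) = 0" using de_r[OF y] exd_antisym[of e y ?M "r y"] by simp
    also have "exd e y ?M (z - e y z *\<^sub>R r y) = 0"
      using e_r[OF y] by (intro ker) (simp add: linear_diff[OF eta.lin[OF y]] linear_scale[OF eta.lin[OF y]])
    finally show "exd e y ?M z = 0" by simp
  qed
qed

text \<open>The last part is \<open>L_x (N^k) = 0\<close> written as a commutator of
  \<open>Dx\<close> with \<open>N^k\<close>, ready for taking traces. The three parts are proved
  together because the product rule for \<open>N^(k+1)\<close> uses the smoothness of
  \<open>N^k\<close>.\<close>

lemma power_N:
  shows "y \<in> S \<Longrightarrow> linear (N y ^^ k)"
    and "smooth_on (\<lambda>z. (N z ^^ k) v) S"
    and "y \<in> S \<Longrightarrow>
      frechet_derivative (\<lambda>z. (N z ^^ k) v) (at y) (x y) = Dx y ((N y ^^ k) v) - (N y ^^ k) (Dx y v)"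
proof -
  have all: "(\<forall>y\<in>S. linear (N y ^^ k)) \<and> (\<forall>v. smooth_on (\<lambda>z. (N z ^^ k) v) S) \<and>
    (\<forall>y\<in>S. \<forall>v. frechet_derivative (\<lambda>z. (N z ^^ k) v) (at y) (x y) = Dx y ((N y ^^ k) v) - (N y ^^ k) (Dx y v))"
  proof (induction k)
    case 0
    then show ?case by (simp add: linear_iff)
  next
    case (Suc k)
    have lin: "linear (N y ^^ k)" if "y \<in> S" for y
      using Suc.IH that by (auto dest: conjunct1)
    have sm: "smooth_on (\<lambda>z. (N z ^^ k) v) S" for v
      using Suc.IH[THEN conjunct2, THEN conjunct1] by (rule spec)
    have "linear (N y ^^ Suc k)" if "y \<in> S" for y
      using linear_compose[OF lin[OF that] linN[OF that]] by simp
    moreover have "smooth_on (\<lambda>z. (N z ^^ Suc k) v) S" for v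
      using smooth_on_apply[OF eta.S linN N sm] by simp
    moreover have "frechet_derivative (\<lambda>z. (N z ^^ Suc k) v) (at y) (x y) =
        Dx y ((N y ^^ Suc k) v) - (N y ^^ Suc k) (Dx y v)" if y: "y \<in> S" for y v
    proof -
      have "frechet_derivative (\<lambda>z. (N z ^^ Suc k) v) (at y) (x y)
        = frechet_derivative (\<lambda>z. N z ((N y ^^ k) v)) (at y) (x y)
          + N y (frechet_derivative (\<lambda>z. (N z ^^ k) v) (at y) (x y))"
        using frechet_derivative_apply[OF eta.S y linN smooth_on_differentiable[OF N y]
            smooth_on_differentiable[OF sm y]] by simp
      also have "frechet_derivative (\<lambda>z. (N z ^^ k) v) (at y) (x y) = Dx y ((N y ^^ k) v) - (N y ^^ k) (Dx y v)"
        using Suc.IH[THEN conjunct2, THEN conjunct2, THEN bspec, OF y] by (rule spec)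
      also have "frechet_derivative (\<lambda>z. N z ((N y ^^ k) v)) (at y) (x y)
          = Dx y (N y ((N y ^^ k) v)) - N y (Dx y ((N y ^^ k) v))"
        using lie_N[OF y, of "(N y ^^ k) v"] by (simp add: algebra_simps)
      finally show ?thesis by (simp add: linear_diff[OF linN[OF y]])
    qed
    ultimately show ?case by (intro conjI ballI allI)
  qed
  show "y \<in> S \<Longrightarrow> linear (N y ^^ k)"
    and "smooth_on (\<lambda>z. (N z ^^ k) v) S"
    and "y \<in> S \<Longrightarrow>
      frechet_derivative (\<lambda>z. (N z ^^ k) v) (at y) (x y) = Dx y ((N y ^^ k) v) - (N y ^^ k) (Dx y v)"
    using all[THEN conjunct1] all[THEN conjunct2, THEN conjunct1]
      all[THEN conjunct2, THEN conjunct2] by simp_all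
qed

lemma trace_N:
  shows "smooth_on (\<lambda>z. trace (matrix (N z ^^ k))) S"
    and "y \<in> S \<Longrightarrow> frechet_derivative (\<lambda>z. trace (matrix (N z ^^ k))) (at y) (x y) = 0"
proof -
  have tr: "trace (matrix (N z ^^ k)) = (\<Sum>i\<in>UNIV. (N z ^^ k) (axis i 1) $ i)" for z
    by (simp add: trace_def matrix_def)
  have sm: "smooth_on (\<lambda>z. (N z ^^ k) (axis i 1) $ i) S" for i
    by (intro smooth_on_component eta.S power_N)
  show "smooth_on (\<lambda>z. trace (matrix (N z ^^ k))) S"
    unfolding tr by (intro smooth_on_sum eta.S sm)
  assume y: "y \<in> S"
  let ?P = "Dx y" and ?T = "N y ^^ k"
  have P: "linear ?P" and T: "linear ?T"
    using linear_frechet_derivative[OF smooth_on_differentiable[OF x y]] power_N(1)[OF y] by auto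
  have "((\<lambda>z. \<Sum>i\<in>UNIV. (N z ^^ k) (axis i 1) $ i) has_derivative
     (\<lambda>u. \<Sum>i\<in>UNIV. frechet_derivative (\<lambda>z. (N z ^^ k) (axis i 1) $ i) (at y) u)) (at y)"
    by (intro has_derivative_sum smooth_on_has_derivative[OF sm y])
  then have "frechet_derivative (\<lambda>z. trace (matrix (N z ^^ k))) (at y) (x y)
     = (\<Sum>i\<in>UNIV. frechet_derivative (\<lambda>z. (N z ^^ k) (axis i 1) $ i) (at y) (x y))"
    unfolding tr by (rule frechet_derivative_eq)
  also have "\<dots> = (\<Sum>i\<in>UNIV. (?P (?T (axis i 1)) - ?T (?P (axis i 1))) $ i)"
    by (simp only: frechet_derivative_component[OF smooth_on_differentiable[OF power_N(2) y]] power_N(3)[OF y])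
  also have "\<dots> = trace (matrix (?P \<circ> ?T)) - trace (matrix (?T \<circ> ?P))"
    by (simp add: trace_def matrix_def sum_subtractf)
  also have "\<dots> = 0"
    using trace_mul_sym[of "matrix ?P" "matrix ?T"] by (simp add: matrix_compose[OF P T] matrix_compose[OF T P])
  finally show "frechet_derivative (\<lambda>z. trace (matrix (N z ^^ k))) (at y) (x y) = 0" .
qed

end

section \<open>Extension of tangent vectors to smooth vector fields\<close>

context smooth_manifold
begin

text \<open>A field constant in one chart is multiplied by a bump function supported in a compact
  coordinate ball and continued by 0. The Hausdorff property makes the image \<open>Q\<close> of the
  ball closed, so the continuation is smooth.\<close>

lemma vector_extension:
  obtains Y where "smooth_vf A W Y" "Y p = v"
proof -
  define c where "c = chart_at A p"
  define y0 where "y0 = base_pt A p"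
  have c: "c \<in> A" "p \<in> chart_dom c" by (auto simp: c_def chart_at)
  have y0: "y0 = chart_map c p" by (simp add: y0_def base_pt_def c_def)
  have "open (chart_region c UNIV)" "y0 \<in> chart_region c UNIV"
    using c by (auto simp: y0 in_region intro: open_region)
  then obtain r where r: "r > 0" "cball y0 r \<subseteq> chart_region c UNIV"
    using open_contains_cball by blast
  \<comment> \<open>Positive exactly on the open ball of radius \<open>r\<close>. The squared norm
    is used because the norm is not smooth at the centre.\<close>
  define \<rho> where "\<rho> y = flat 0 (r\<^sup>2 - (y - y0) \<bullet> (y - y0))" for y
  have \<rho>0: "\<rho> y0 \<noteq> 0" using r by (simp add: \<rho>_def flat_def)
  have \<rho>_out: "\<rho> y = 0" if "y \<notin> cball y0 r" for y
  proof -
    have "r \<le> norm (y - y0)" using that by (simp add: dist_norm norm_minus_commute)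
    then have "r\<^sup>2 \<le> (norm (y - y0))\<^sup>2" using r by (intro power_mono) auto
    then show ?thesis by (simp add: \<rho>_def flat_def power2_norm_eq_inner)
  qed
  have \<rho>: "smooth_on \<rho> UNIV"
    unfolding \<rho>_def
    by (rule smooth_on_compose[OF open_UNIV _ _ smooth_on_flat[of 0 UNIV]])
      (auto intro!: smooth_on_diff smooth_on_bilinear[OF bounded_bilinear_inner])
  \<comment> \<open>Compensates the value of the bump function at the centre, so that the field
    takes exactly the value \<open>v\<close> at \<open>p\<close>.\<close>
  define v' where "v' = inverse (\<rho> y0) *\<^sub>R v"
  define Y where "Y q = (if q \<in> chart_dom c then \<rho> (chart_map c q) *\<^sub>R coord_change c (chart_at A q) q v' else 0)" for q
  define Q where "Q = chart_inv c ` cball y0 r"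
  have "compact Q"
    unfolding Q_def using r continuous_chart_inv[OF c(1), of UNIV]
    by (intro compact_continuous_image) (auto intro: continuous_on_subset)
  then have Q: "open (- Q)" by (simp add: compact_imp_closed open_Compl)
  have Y0: "Y q = 0" if "q \<notin> Q" for q
  proof (cases "q \<in> chart_dom c")
    case True
    have "chart_map c q \<notin> cball y0 r"
    proof
      assume "chart_map c q \<in> cball y0 r"
      then have "chart_inv c (chart_map c q) \<in> Q" unfolding Q_def by (rule imageI)
      then show False using that chart_inv_map[OF c(1) True] by simp
    qed
    then show ?thesis by (simp add: Y_def \<rho>_out)
  qed (simp add: Y_def)
  have "smooth_vf A UNIV Y"
  proof (intro smooth_vfI smooth_on_local)
    fix d y assume d: "d \<in> A" and y: "y \<in> chart_region d UNIV"
    let ?q = "chart_inv d y"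
    have q: "?q \<in> chart_dom d" using chart_inv_in[OF d y] by simp
    show "\<exists>T. open T \<and> y \<in> T \<and> smooth_on (vf_rep A d Y) T"
    proof (cases "?q \<in> chart_dom c")
      case True
      let ?T = "chart_region d (chart_dom c)"
      have T: "open ?T" by (rule open_region[OF d open_chart_dom[OF c(1)]])
      have yT: "y \<in> ?T" using region_iff[OF d, of y "chart_dom c"] y True by simp
      let ?t = "chart_map c \<circ> chart_inv d"
      have t: "smooth_on ?t ?T" by (rule smooth_transition[OF d c(1)])
      have "smooth_on (\<lambda>z. \<rho> (?t z) *\<^sub>R coord_change c d (chart_inv c (?t z)) v') ?T"
      proof (intro smooth_on_scaleR[OF T])
        show "smooth_on (\<lambda>z. \<rho> (?t z)) ?T" by (rule smooth_on_compose[OF T _ t \<rho>]) simp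
        have "?t ` ?T \<subseteq> chart_region c (chart_dom d)"
          using chart_inv_in[OF d] by (auto intro!: in_region)
        then show "smooth_on (\<lambda>z. coord_change c d (chart_inv c (?t z)) v') ?T"
          by (rule smooth_on_compose[OF T _ t smooth_coord_change[OF c(1) d]])
      qed
      then have "smooth_on (vf_rep A d Y) ?T"
      proof (rule smooth_on_cong[OF T, rotated])
        fix z assume z: "z \<in> ?T"
        have z': "chart_inv d z \<in> chart_dom d" "chart_inv d z \<in> chart_dom c" using chart_inv_in[OF d z] by auto
        have lin: "linear (coord_change (chart_at A (chart_inv d z)) d (chart_inv d z))"
          using z' d by (intro coord_change_linear) (auto simp: chart_at)
        show "\<rho> (?t z) *\<^sub>R coord_change c d (chart_inv c (?t z)) v' = vf_rep A d Y z"
          using z' c d by (simp add: vf_rep_def Let_def Y_def linear_scale[OF lin] coord_change_comp chart_at chart_inv_map)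
      qed
      then show ?thesis using T yT by blast
    next
      case False
      have "?q \<notin> Q"
      proof
        assume "?q \<in> Q"
        then obtain z where "z \<in> cball y0 r" "?q = chart_inv c z" by (auto simp: Q_def)
        then show False using False r chart_inv_in[OF c(1), of z UNIV] by auto
      qed
      let ?T = "chart_region d (- Q)"
      have T: "open ?T" by (rule open_region[OF d Q])
      have yT: "y \<in> ?T" using region_iff[OF d, of y "- Q"] y \<open>?q \<notin> Q\<close> by simp
      have "vf_rep A d Y z = 0" if z: "z \<in> ?T" for z
      proof -
        have z': "chart_inv d z \<in> chart_dom d" "chart_inv d z \<notin> Q" using chart_inv_in[OF d z] by auto
        have "linear (coord_change (chart_at A (chart_inv d z)) d (chart_inv d z))"
          using z' d by (intro coord_change_linear) (auto simp: chart_at)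
        then show ?thesis using z' by (simp add: vf_rep_def Let_def Y0 linear_0)
      qed
      then have "smooth_on (vf_rep A d Y) ?T"
        by (intro smooth_on_cong[OF T _ smooth_on_const[of 0]]) simp
      then show ?thesis using T yT by blast
    qed
  qed
  then have "smooth_vf A W Y"
    by (auto simp: smooth_vf_def intro: smooth_on_subset)
  moreover have "Y p = v"
    using c \<rho>0 by (simp add: Y_def v'_def y0[symmetric] coord_change_id c_def[symmetric])
  ultimately show ?thesis using that by blast
qed

end


section \<open>Contact Hamiltonian systems\<close>

lemma trace_conjugate:
  fixes P T Q :: "real ^ 'n \<Rightarrow> real ^ 'n"
  assumes "linear P" "linear T" "linear Q" "\<And>v. Q (P v) = v"
  shows "trace (matrix (\<lambda>v. P (T (Q v)))) = trace (matrix T)"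
proof -
  have TQ: "linear (T \<circ> Q)" using assms by (intro linear_compose)
  have "trace (matrix (P \<circ> (T \<circ> Q))) = trace (matrix ((T \<circ> Q) \<circ> P))"
    unfolding matrix_compose[OF TQ assms(1)] matrix_compose[OF assms(1) TQ] by (rule trace_mul_sym)
  then show ?thesis using assms(4) by (simp add: comp_def)
qed

section \<open>Smooth functions, forms and endomorphisms on open subsets\<close>

context smooth_manifold
begin

lemma local_form_rep:
  "smooth_form A W \<omega> \<Longrightarrow> open W \<Longrightarrow> c \<in> A \<Longrightarrow> local_form (chart_region c W) (form_rep A c \<omega>)"
  by (rule local_form.intro) (auto intro: open_region form_rep_linear smooth_formD)

lemma smooth_form_subset: "smooth_form A W \<omega> \<Longrightarrow> W' \<subseteq> W \<Longrightarrow> smooth_form A W' \<omega>"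
  unfolding smooth_form_def by (blast intro: smooth_on_subset)

lemma smooth_fun_subset: "smooth_fun A W f \<Longrightarrow> W' \<subseteq> W \<Longrightarrow> smooth_fun A W' f"
  unfolding smooth_fun_def by (blast intro: smooth_on_subset)

lemma smooth_vf_subset: "smooth_vf A W Y \<Longrightarrow> W' \<subseteq> W \<Longrightarrow> smooth_vf A W' Y"
  unfolding smooth_vf_def by (blast intro: smooth_on_subset)

lemma ext_deriv_antisym: "ext_deriv A \<omega> p u v = - ext_deriv A \<omega> p v u"
  by (simp add: ext_deriv_def)

lemma ext_deriv_linear:
  assumes "smooth_form A W \<omega>" "open W" "p \<in> W"
  shows "linear (\<lambda>u. ext_deriv A \<omega> p u v)" "linear (ext_deriv A \<omega> p u)"
proof -
  interpret local_form "chart_region (chart_at A p) W" "form_rep A (chart_at A p) \<omega>"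
    by (rule local_form_rep[OF assms(1,2) chart_at(1)])
  show "linear (\<lambda>u. ext_deriv A \<omega> p u v)" "linear (ext_deriv A \<omega> p u)"
    unfolding ext_deriv_exd using exd_linear exd_linear2 base_pt[OF assms(3)] by auto
qed

lemma exd_rep:
  assumes "smooth_form A W \<omega>" "open W" "c \<in> A" "y \<in> chart_region c W"
  shows "exd (form_rep A c \<omega>) y u v = ext_deriv A \<omega> (chart_inv c y)
     (coord_change c (chart_at A (chart_inv c y)) (chart_inv c y) u)
     (coord_change c (chart_at A (chart_inv c y)) (chart_inv c y) v)"
  using exd_ext_deriv[OF assms(1,2) _ assms(3), of "chart_inv c y" u v] chart_inv_in[OF assms(3,4)]
    chart_map_inv[OF assms(3,4)] by simp

lemma coord_change_vf_rep:
  assumes "c \<in> A" "y \<in> chart_region c W"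
  shows "coord_change c (chart_at A (chart_inv c y)) (chart_inv c y) (vf_rep A c Y y) = Y (chart_inv c y)"
  using chart_inv_in[OF assms] assms(1) by (simp add: vf_rep_def Let_def coord_change_inverse chart_at)

lemma smooth_fun_continuous:
  assumes "smooth_fun A UNIV f"
  shows "continuous_on UNIV f"
proof (intro continuous_at_imp_continuous_on ballI)
  fix p
  let ?c = "chart_at A p"
  have c: "?c \<in> A" "p \<in> chart_dom ?c" by (auto simp: chart_at)
  have "continuous_on (chart_dom ?c) (\<lambda>q. f (chart_inv ?c (chart_map ?c q)))"
    by (rule continuous_on_compose2[OF smooth_on_continuous[OF smooth_funD[OF assms c(1)]]
          continuous_chart_map[OF c(1)]]) (auto simp: chart_region_def)
  then have "continuous_on (chart_dom ?c) f"
    by (rule continuous_on_cong[THEN iffD1, rotated 2]) (auto simp: chart_inv_map[OF c(1)])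
  then show "isCont f p"
    using open_chart_dom[OF c(1)] c(2) by (simp add: continuous_on_eq_continuous_at)
qed

lemma open_nonzero: "smooth_fun A UNIV f \<Longrightarrow> open {x. f x \<noteq> 0}"
  using smooth_fun_continuous by (intro open_Collect_neq) auto

lemma form_rep_dfun:
  assumes "smooth_fun A W f" "open W" "c \<in> A" "y \<in> chart_region c W"
  shows "form_rep A c (dfun A f) y v = frechet_derivative (\<lambda>y. f (chart_inv c y)) (at y) v"
  using dfun_chart[OF assms(1,2) _ assms(3), of "chart_inv c y" v] chart_inv_in[OF assms(3,4)]
    chart_map_inv[OF assms(3,4)] by (simp add: form_rep_def Let_def)

lemma dfun_base: "dfun A f p v = frechet_derivative (\<lambda>y. f (chart_inv (chart_at A p) y)) (at (base_pt A p)) v"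
  by (simp add: dfun_def comp_def)

lemma chart_inv_base [simp]: "chart_inv (chart_at A p) (base_pt A p) = p"
  by (simp add: base_pt_def chart_inv_map chart_at)

lemma smooth_fun_base:
  "smooth_fun A W f \<Longrightarrow> p \<in> W \<Longrightarrow> (\<lambda>y. f (chart_inv (chart_at A p) y)) differentiable (at (base_pt A p))"
  by (rule smooth_on_differentiable[OF smooth_funD[OF _ chart_at(1)] base_pt])

lemma smooth_form_dfun:
  assumes "smooth_fun A W f" "open W"
  shows "smooth_form A W (dfun A f)"
proof (rule smooth_formI)
  show "linear (dfun A f p)" if "p \<in> W" for p
    using linear_frechet_derivative[OF smooth_fun_base[OF assms(1) that]]
    by (simp add: dfun_def comp_def)
  show "smooth_on (\<lambda>y. form_rep A c (dfun A f) y v) (chart_region c W)" if "c \<in> A" for c v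
    by (rule smooth_on_cong[OF open_region[OF that assms(2)] _
          smooth_on_frechet[OF smooth_funD[OF assms(1) that]]])
      (simp add: form_rep_dfun[OF assms that])
qed

lemma dfun_mult:
  assumes "smooth_fun A W f" "smooth_fun A W g" "p \<in> W"
  shows "dfun A (\<lambda>x. f x * g x) p v = f p * dfun A g p v + dfun A f p v * g p"
  unfolding dfun_base
  by (rule trans[OF frechet_derivative_eq[OF has_derivative_mult[OF
        smooth_fun_base[OF assms(1,3), unfolded frechet_derivative_works]
        smooth_fun_base[OF assms(2,3), unfolded frechet_derivative_works]]]]) simp

lemma smooth_fun_contract:
  assumes \<omega>: "smooth_form A W \<omega>" and Y: "smooth_vf A W Y" and W: "open W"
  shows "smooth_fun A W (\<lambda>x. \<omega> x (Y x))"
proof (rule smooth_funI)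
  fix c assume c: "c \<in> A"
  have "smooth_on (\<lambda>y. form_rep A c \<omega> y (vf_rep A c Y y)) (chart_region c W)"
    by (rule smooth_on_apply[OF open_region[OF c W] form_rep_linear[OF \<omega> c] smooth_formD[OF \<omega> c] smooth_vfD[OF Y c]])
  then show "smooth_on (\<lambda>y. \<omega> (chart_inv c y) (Y (chart_inv c y))) (chart_region c W)"
    by (rule smooth_on_cong[OF open_region[OF c W], rotated]) (rule form_apply_rep[OF c])
qed

lemma smooth_fun_mult:
  "open W \<Longrightarrow> smooth_fun A W f \<Longrightarrow> smooth_fun A W g \<Longrightarrow> smooth_fun A W (\<lambda>x. f x * g x)"
  by (rule smooth_funI, rule smooth_on_mult[OF open_region smooth_funD smooth_funD])

lemma smooth_fun_minus: "open W \<Longrightarrow> smooth_fun A W f \<Longrightarrow> smooth_fun A W (\<lambda>x. - f x)"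
  by (rule smooth_funI, rule smooth_on_minus[OF open_region smooth_funD])

lemma smooth_vf_diff_scale:
  assumes Y: "smooth_vf A W Y" "smooth_vf A W Z" and f: "smooth_fun A W f" and W: "open W"
  shows "smooth_vf A W (\<lambda>x. Y x - f x *\<^sub>R Z x)"
proof (rule smooth_vfI)
  fix c assume c: "c \<in> A"
  have "smooth_on (\<lambda>y. vf_rep A c Y y - f (chart_inv c y) *\<^sub>R vf_rep A c Z y) (chart_region c W)"
    by (intro smooth_on_diff smooth_on_scaleR open_region[OF c W] smooth_vfD[OF _ c] smooth_funD[OF _ c] assms)
  then show "smooth_on (vf_rep A c (\<lambda>x. Y x - f x *\<^sub>R Z x)) (chart_region c W)"
  proof (rule smooth_on_cong[OF open_region[OF c W], rotated])
    fix y assume "y \<in> chart_region c W"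
    then have "linear (coord_change (chart_at A (chart_inv c y)) c (chart_inv c y))"
      using chart_inv_in[OF c] c by (intro coord_change_linear) (auto simp: chart_at)
    then show "vf_rep A c Y y - f (chart_inv c y) *\<^sub>R vf_rep A c Z y = vf_rep A c (\<lambda>x. Y x - f x *\<^sub>R Z x) y"
      by (simp add: vf_rep_def Let_def linear_diff linear_scale)
  qed
qed

lemma form_rep_quotient: "form_rep A c (\<lambda>x v. - \<omega> x v / f x) y v = - form_rep A c \<omega> y v / f (chart_inv c y)"
  by (simp add: form_rep_def Let_def)

lemma smooth_form_quotient:
  assumes \<omega>: "smooth_form A W \<omega>" and f: "smooth_fun A W f" "\<And>x. x \<in> W \<Longrightarrow> f x \<noteq> 0" and W: "open W"
  shows "smooth_form A W (\<lambda>x v. - \<omega> x v / f x)"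
proof (rule smooth_formI)
  show "linear (\<lambda>v. - \<omega> p v / f p)" if "p \<in> W" for p
  proof -
    have "linear (\<omega> p)" using \<omega> that by (simp add: smooth_form_def)
    then show ?thesis by (simp add: linear_iff add_divide_distrib)
  qed
  show "smooth_on (\<lambda>y. form_rep A c (\<lambda>x v. - \<omega> x v / f x) y v) (chart_region c W)" if c: "c \<in> A" for c v
    unfolding form_rep_quotient
    by (intro smooth_on_divide smooth_on_minus open_region[OF c W] smooth_formD[OF \<omega> c] smooth_funD[OF f(1) c])
      (use f(2) chart_inv_in[OF c] in blast)
qed

text \<open>The quotient rule
  \<open>d(-\<omega>/f) = -d\<omega>/f + (df \<and> \<omega>)/f^2\<close>, stated once for \<sigma>
  and \<lambda>, which are both of this shape.\<close>

lemma ext_deriv_quotient: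
  assumes \<omega>: "smooth_form A W \<omega>" and f: "smooth_fun A W f" and p: "p \<in> W" "f p \<noteq> 0"
  shows "ext_deriv A (\<lambda>x v. - \<omega> x v / f x) p u v
    = - ext_deriv A \<omega> p u v / f p + (dfun A f p u * \<omega> p v - dfun A f p v * \<omega> p u) / (f p * f p)"
proof -
  let ?c = "chart_at A p" and ?y = "base_pt A p"
  have D: "frechet_derivative (\<lambda>y. - form_rep A ?c \<omega> y v / f (chart_inv ?c y)) (at ?y) u
     = - \<omega> p v * (- (inverse (f p) * dfun A f p u * inverse (f p)))
       + - frechet_derivative (\<lambda>y. form_rep A ?c \<omega> y v) (at ?y) u / f p" for u v
  proof (rule frechet_derivative_eq[THEN trans])
    show "((\<lambda>y. - form_rep A ?c \<omega> y v / f (chart_inv ?c y)) has_derivative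
       (\<lambda>u. - (- form_rep A ?c \<omega> ?y v) * (inverse (f (chart_inv ?c ?y)) * frechet_derivative (\<lambda>y. f (chart_inv ?c y)) (at ?y) u
           * inverse (f (chart_inv ?c ?y)))
         + - frechet_derivative (\<lambda>y. form_rep A ?c \<omega> y v) (at ?y) u / f (chart_inv ?c ?y))) (at ?y)"
      using p
      by (intro has_derivative_divide has_derivative_minus
          smooth_on_has_derivative[OF smooth_formD[OF \<omega> chart_at(1)] base_pt]
          smooth_on_has_derivative[OF smooth_funD[OF f chart_at(1)] base_pt]) auto
  qed (simp add: dfun_base form_rep_base)
  then show ?thesis
    unfolding ext_deriv_def form_rep_quotient D using p(2) by (simp add: field_simps)
qed

text \<open>In any chart the endomorphism is conjugate to \<open>N q\<close> by a coordinate change,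
  and so are the powers. The trace is therefore a function on the manifold that does not see the
  jumps of the preferred chart.\<close>

lemma endo_trace_rep:
  assumes N: "smooth_endo A W N" and c: "c \<in> A" and y: "y \<in> chart_region c W"
  shows "trace (matrix (endo_rep A c N y ^^ k)) = endo_trace N k (chart_inv c y)"
proof -
  let ?q = "chart_inv c y"
  let ?P = "coord_change (chart_at A ?q) c ?q" and ?Q = "coord_change c (chart_at A ?q) ?q"
  have q: "?q \<in> chart_dom c" "?q \<in> W" using chart_inv_in[OF c y] by auto
  have QP: "?Q (?P v) = v" "?P (?Q v) = v" for v
    using q c by (auto simp: coord_change_inverse chart_at)
  have lin: "linear ?P" "linear ?Q" using q c by (auto intro!: coord_change_linear simp: chart_at)
  have linN: "linear (N ?q)" using N q by (simp add: smooth_endo_def)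
  have linNk: "linear (N ?q ^^ k)"
  proof (induction k)
    case 0
    then show ?case by (simp add: linear_iff)
  next
    case (Suc k)
    show ?case unfolding funpow.simps by (rule linear_compose[OF Suc linN])
  qed
  have "(endo_rep A c N y ^^ k) v = ?P ((N ?q ^^ k) (?Q v))" for v
    by (induction k) (auto simp: QP endo_rep_def Let_def)
  then have "endo_rep A c N y ^^ k = (\<lambda>v. ?P ((N ?q ^^ k) (?Q v)))" by (simp add: fun_eq_iff)
  then show ?thesis
    unfolding endo_trace_def using trace_conjugate[OF lin(1) linNk lin(2) QP(1)] by simp
qed

end

section \<open>The Reeb field and linear systems on a contact manifold\<close>

locale contact_manifold = smooth_manifold A
  for A :: "('a::{t2_space,second_countable_topology}, 'm::finite) chart set" +
  fixes n :: nat and \<eta> :: "'a \<Rightarrow> real ^ 'm \<Rightarrow> real"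
  assumes dim: "CARD('m) = 2 * n + 1" and contact: "contact_form A n \<eta>"
begin

lemma \<eta>: "smooth_form A W \<eta>"
  using contact smooth_form_subset[of UNIV] by (simp add: contact_form_def)

lemma contact_space: "contact_space (\<eta> p) (ext_deriv A \<eta> p)"
proof (rule contact_space.intro)
  show lin: "linear (\<eta> p)" using \<eta>[of UNIV] by (simp add: smooth_form_def)
  show lin2: "linear (\<lambda>u. ext_deriv A \<eta> p u v)" for v
    using ext_deriv_linear(1)[OF \<eta> open_UNIV] by simp
  show "ext_deriv A \<eta> p u v = - ext_deriv A \<eta> p v u" for u v by (rule ext_deriv_antisym)
  show "u = 0" if "\<eta> p u = 0" "\<And>z. ext_deriv A \<eta> p u z = 0" for u
    using contact_nondegenerate[OF dim lin lin2 ext_deriv_antisym _ that] contact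
    by (simp add: contact_form_def)
  show "odd CARD('m)" by (simp add: dim)
qed

text \<open>Nondegeneracy is carried from the preferred chart to \<open>c\<close> by the invertible
  coordinate change; the Cramer argument and the Lie derivatives need it throughout a fixed
  chart.\<close>

lemma contact_space_rep:
  assumes c: "c \<in> A" and y: "y \<in> chart_region c UNIV"
  shows "contact_space (form_rep A c \<eta> y) (exd (form_rep A c \<eta>) y)"
proof (rule contact_space.intro)
  interpret local_form "chart_region c UNIV" "form_rep A c \<eta>"
    by (rule local_form_rep[OF \<eta> open_UNIV c])
  show "linear (form_rep A c \<eta> y)" by (rule lin[OF y])
  show "linear (\<lambda>u. exd (form_rep A c \<eta>) y u v)" for v by (rule exd_linear[OF y])
  show "exd (form_rep A c \<eta>) y u v = - exd (form_rep A c \<eta>) y v u" for u v by (rule exd_antisym)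
  show "odd CARD('m)" by (simp add: dim)
  fix u assume u: "form_rep A c \<eta> y u = 0" "\<And>z. exd (form_rep A c \<eta>) y u z = 0"
  let ?q = "chart_inv c y" let ?d = "chart_at A ?q"
  let ?P = "coord_change c ?d ?q" and ?Q = "coord_change ?d c ?q"
  have q: "?q \<in> chart_dom c" using chart_inv_in[OF c y] by simp
  have PQ: "?P (?Q v) = v" "?Q (?P v) = v" for v using q c by (auto simp: coord_change_inverse chart_at)
  have "ext_deriv A \<eta> ?q (?P u) z = 0" for z
    using u(2)[of "?Q z"] by (simp add: exd_rep[OF \<eta> open_UNIV c y] PQ)
  then have "?P u = 0"
    using u(1) by (intro contact_space.nondeg[OF contact_space]) (simp_all add: form_rep_def Let_def)
  then have "?Q (?P u) = 0"
    using q c by (simp add: linear_0 coord_change_linear chart_at)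
  then show "u = 0" by (simp add: PQ)
qed

abbreviation "R \<equiv> reeb A \<eta>"

lemma R: "\<eta> p (R p) = 1" "ext_deriv A \<eta> p (R p) v = 0" "ext_deriv A \<eta> p v (R p) = 0"
proof -
  interpret contact_space "\<eta> p" "ext_deriv A \<eta> p" by (rule contact_space)
  have "\<exists>!v. \<eta> p v = 1 \<and> (\<forall>w. ext_deriv A \<eta> p v w = 0)"
    using reeb_exists by (auto intro!: solve_unique)
  from theI'[OF this] show "\<eta> p (R p) = 1" and r: "ext_deriv A \<eta> p (R p) v = 0" for v
    unfolding reeb_def by auto
  then show "ext_deriv A \<eta> p v (R p) = 0" using ext_deriv_antisym[of \<eta> p v "R p"] by simp
qed

text \<open>\<open>b (R p) = 0\<close> is forced, since \<open>d\<eta>(u, R) = 0\<close> for every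
  \<open>u\<close>. This justifies the definite descriptions of both \<open>X\<close> and
  \<open>N\<close>.\<close>

lemma contact_solve:
  assumes "linear b" "b (R p) = 0"
  shows "\<exists>!u. \<eta> p u = t \<and> (\<forall>v. ext_deriv A \<eta> p u v = b v)"
proof -
  interpret contact_space "\<eta> p" "ext_deriv A \<eta> p" by (rule contact_space)
  show ?thesis using solve_exists[OF assms(1) R(1,2) assms(2), of t] by (auto intro!: solve_unique)
qed

text \<open>On vectors solving a system of the form \<open>\<eta>(u) = t\<close>, \<open>\<iota>\<^sub>u d\<eta> = b\<close>, smoothness is inherited from
  the data by Cramer's rule, since \<open>u \<mapsto> \<iota>\<^sub>u d\<eta> + \<eta>(u) \<eta>\<close> is invertible.\<close>

lemma smooth_contact_solution:
  assumes c: "c \<in> A" and W: "open W"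
    and b: "\<And>v. smooth_on (\<lambda>y. b y v) (chart_region c W)" and t: "smooth_on t (chart_region c W)"
    and x: "\<And>y. y \<in> chart_region c W \<Longrightarrow> form_rep A c \<eta> y (x y) = t y"
      "\<And>y v. y \<in> chart_region c W \<Longrightarrow> exd (form_rep A c \<eta>) y (x y) v = b y v"
  shows "smooth_on x (chart_region c W)"
proof -
  let ?e = "form_rep A c \<eta>"
  interpret local_form "chart_region c W" ?e by (rule local_form_rep[OF \<eta> W c])
  have cs: "contact_space (?e y) (exd ?e y)" if "y \<in> chart_region c W" for y
    using contact_space_rep[OF c] that by (auto simp: chart_region_def)
  show ?thesis
  proof (rule smooth_on_solve[OF S, where B="\<lambda>y u v. exd ?e y u v + ?e y u * ?e y v"
        and b="\<lambda>y v. b y v + t y * ?e y v"])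
    show "linear (\<lambda>v. exd ?e y v w + ?e y v * ?e y w)" if "y \<in> chart_region c W" for y w
      by (rule contact_space.lin_B(1)[OF cs[OF that]])
    show "linear (\<lambda>w. exd ?e y v w + ?e y v * ?e y w)" if "y \<in> chart_region c W" for y v
      by (rule contact_space.lin_B(2)[OF cs[OF that]])
    show "v = 0" if "y \<in> chart_region c W" "\<And>w. exd ?e y v w + ?e y v * ?e y w = 0" for y v
      by (rule contact_space.B_nondeg[OF cs[OF that(1)] that(2)])
    show "smooth_on (\<lambda>y. exd ?e y v w + ?e y v * ?e y w) (chart_region c W)" for v w
      by (intro smooth_on_add smooth_on_mult S smooth exd_smooth)
    show "smooth_on (\<lambda>y. b y w + t y * ?e y w) (chart_region c W)" for w
      by (intro smooth_on_add smooth_on_mult S smooth b t)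
  qed (simp add: x)
qed

lemma smooth_R: "smooth_vf A W R"
proof -
  have "smooth_vf A UNIV R"
  proof (rule smooth_vfI)
    fix c assume c: "c \<in> A"
    show "smooth_on (vf_rep A c R) (chart_region c UNIV)"
      by (rule smooth_contact_solution[OF c open_UNIV, where b="\<lambda>y v. 0" and t="\<lambda>y. 1"])
        (auto simp: form_apply_rep[OF c] exd_rep[OF \<eta> open_UNIV c] coord_change_vf_rep[OF c] R)
  qed
  then show ?thesis by (rule smooth_vf_subset) simp
qed

end

section \<open>The contact Hamiltonian vector field\<close>

locale contact_hamiltonian = contact_manifold A n \<eta>
  for A :: "('a::{t2_space,second_countable_topology}, 'm::finite) chart set" and n \<eta> +
  fixes H :: "'a \<Rightarrow> real"
  assumes H': "smooth_fun A UNIV H"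
begin

abbreviation "a \<equiv> reeb_deriv A \<eta> H"
abbreviation "X \<equiv> contact_ham_vf A \<eta> H"

lemma H: "smooth_fun A W H"
  by (rule smooth_fun_subset[OF H']) simp

lemma smooth_a: "smooth_fun A W a"
  using smooth_fun_subset[OF smooth_fun_contract[OF smooth_form_dfun[OF H open_UNIV] smooth_R open_UNIV]]
  by (simp add: reeb_deriv_def[abs_def])

lemma linear_dH: "linear (dfun A H p)"
  using smooth_form_dfun[OF H open_UNIV] by (simp add: smooth_form_def)

lemma linear_\<eta>: "linear (\<eta> p)"
  using \<eta>[of UNIV] by (simp add: smooth_form_def)

lemma X: "\<eta> p (X p) = - H p" "ext_deriv A \<eta> p (X p) v = dfun A H p v - a p * \<eta> p v"
proof -
  have "linear (\<lambda>v. dfun A H p v - a p * \<eta> p v)"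
    using linear_dH[of p] linear_\<eta>[of p] by (simp add: linear_iff algebra_simps)
  \<comment> \<open>Solvability at the Reeb vector; the coefficient \<open>a = R(H)\<close> in the
    convention for \<open>X\<close> is exactly what makes this vanish.\<close>
  moreover have "dfun A H p (R p) - a p * \<eta> p (R p) = 0" by (simp add: R reeb_deriv_def)
  ultimately have "\<exists>!u. \<eta> p u = - H p \<and> (\<forall>v. ext_deriv A \<eta> p u v = dfun A H p v - a p * \<eta> p v)"
    by (rule contact_solve)
  from theI'[OF this] show "\<eta> p (X p) = - H p" "ext_deriv A \<eta> p (X p) v = dfun A H p v - a p * \<eta> p v"
    unfolding contact_ham_vf_def by auto
qed

lemma dH_X: "dfun A H p (X p) = - a p * H p"
proof -
  have "dfun A H p (X p) - a p * \<eta> p (X p) = 0"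
    using ext_deriv_antisym[of \<eta> p "X p" "X p"] by (simp add: X(2))
  then show ?thesis by (simp add: X(1))
qed

lemma X_rep:
  assumes c: "c \<in> A" and y: "y \<in> chart_region c UNIV"
  shows "form_rep A c \<eta> y (vf_rep A c X y) = - H (chart_inv c y)"
    "exd (form_rep A c \<eta>) y (vf_rep A c X y) v
      = frechet_derivative (\<lambda>y. H (chart_inv c y)) (at y) v - a (chart_inv c y) * form_rep A c \<eta> y v"
proof -
  show "form_rep A c \<eta> y (vf_rep A c X y) = - H (chart_inv c y)"
    by (simp add: form_apply_rep[OF c y] X)
  have "form_rep A c \<eta> y v = \<eta> (chart_inv c y) (coord_change c (chart_at A (chart_inv c y)) (chart_inv c y) v)"
    "form_rep A c (dfun A H) y v = dfun A H (chart_inv c y) (coord_change c (chart_at A (chart_inv c y)) (chart_inv c y) v)"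
    by (simp_all add: form_rep_def Let_def)
  then show "exd (form_rep A c \<eta>) y (vf_rep A c X y) v
      = frechet_derivative (\<lambda>y. H (chart_inv c y)) (at y) v - a (chart_inv c y) * form_rep A c \<eta> y v"
    by (simp add: exd_rep[OF \<eta> open_UNIV c y] coord_change_vf_rep[OF c y] X form_rep_dfun[OF H open_UNIV c y, symmetric])
qed

lemma smooth_X: "smooth_vf A W X"
proof -
  have "smooth_vf A UNIV X"
  proof (rule smooth_vfI)
    fix c assume c: "c \<in> A"
    have S: "open (chart_region c UNIV)" by (rule open_region[OF c open_UNIV])
    show "smooth_on (vf_rep A c X) (chart_region c UNIV)"
    proof (rule smooth_contact_solution[OF c open_UNIV, where t="\<lambda>y. - H (chart_inv c y)"
          and b="\<lambda>y v. frechet_derivative (\<lambda>y. H (chart_inv c y)) (at y) v - a (chart_inv c y) * form_rep A c \<eta> y v",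
          OF _ _ X_rep(1)[OF c] X_rep(2)[OF c]])
      show "smooth_on (\<lambda>y. - H (chart_inv c y)) (chart_region c UNIV)"
        by (intro smooth_on_minus S smooth_funD[OF H c])
      show "smooth_on (\<lambda>y. frechet_derivative (\<lambda>y. H (chart_inv c y)) (at y) v - a (chart_inv c y) * form_rep A c \<eta> y v)
        (chart_region c UNIV)" for v
        by (rule smooth_on_diff[OF S smooth_on_frechet[OF smooth_funD[OF H c]]
              smooth_on_mult[OF S smooth_funD[OF smooth_a c] smooth_formD[OF \<eta> c]]])
    qed
  qed
  then show ?thesis by (rule smooth_vf_subset) simp
qed

end


section \<open>Canonoid maps\<close>

locale contact_canonoid_system = contact_hamiltonian A n \<eta> H
  for A :: "('a::{t2_space,second_countable_topology}, 'm::finite) chart set" and n \<eta> H +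
  fixes \<Phi> :: "'a \<Rightarrow> 'a"
  assumes canonoid: "contact_canonoid A \<eta> H \<Phi>"
begin

definition "\<alpha> = pullback A \<Phi> \<eta>"
definition "K = (\<lambda>x. - \<alpha> x (X x))"
definition "V = {x. K x \<noteq> 0}"
definition "\<sigma> = (\<lambda>x v. - \<alpha> x v / K x)"
definition "U = {x. H x * K x \<noteq> 0}"
definition "lam = (\<lambda>x v. - \<eta> x v / H x)"

lemma \<alpha>: "smooth_form A UNIV \<alpha>"
  unfolding \<alpha>_def using canonoid by (intro smooth_pullback \<eta>) (simp add: contact_canonoid_def)

lemma K: "smooth_fun A UNIV K"
  unfolding K_def by (rule smooth_fun_minus[OF open_UNIV smooth_fun_contract[OF \<alpha> smooth_X open_UNIV]])

lemma open_V: "open V" and open_U: "open U"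
  unfolding V_def U_def
  using open_nonzero[OF K] open_nonzero[OF smooth_fun_mult[OF open_UNIV H K]] by auto

lemma \<sigma>: "smooth_form A V \<sigma>"
  unfolding \<sigma>_def
  by (rule smooth_form_quotient[OF smooth_form_subset[OF \<alpha>] smooth_fun_subset[OF K] _ open_V])
    (auto simp: V_def)

text \<open>Cartan's formula with \<open>\<alpha>(X) = -K\<close> turns the canonoid condition
  \<open>L_X \<alpha> = -b\<alpha>\<close> into
  \<open>\<iota>_X d\<alpha> = dK - b\<alpha>\<close>.\<close>

lemma d\<alpha>_X:
  obtains b where "\<And>p v. ext_deriv A \<alpha> p (X p) v = dfun A K p v - b p * \<alpha> p v"
proof -
  obtain b where b: "\<And>p v. lie_form A X \<alpha> p v = - b p * \<alpha> p v"
    using canonoid by (auto simp: contact_canonoid_def \<alpha>_def)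
  have "ext_deriv A \<alpha> p (X p) v = dfun A K p v - b p * \<alpha> p v" for p v
  proof -
    let ?c = "chart_at A p" and ?y = "base_pt A p"
    have c: "?c \<in> A" by (rule chart_at)
    interpret local_form "chart_region ?c UNIV" "form_rep A ?c \<alpha>"
      by (rule local_form_rep[OF \<alpha> open_UNIV c])
    have y: "?y \<in> chart_region ?c UNIV" by (rule base_pt) simp
    have "frechet_derivative (\<lambda>z. form_rep A ?c \<alpha> z (vf_rep A ?c X z)) (at ?y) v
        = frechet_derivative (\<lambda>z. - K (chart_inv ?c z)) (at ?y) v"
      by (rule fun_cong[OF frechet_derivative_cong[OF S y]]) (simp add: form_apply_rep[OF c] K_def)
    also have "\<dots> = - dfun A K p v"
      unfolding dfun_base
      by (rule frechet_derivative_eq[OF has_derivative_minus[OF smooth_on_has_derivative[OF smooth_funD[OF K c] y]]])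
    finally show ?thesis
      using cartan_form[OF y smooth_vfD[OF smooth_X c], of v] b[of p v]
      by (simp add: lie_form_def ext_deriv_exd vf_rep_base form_rep_base)
  qed
  then show ?thesis by (rule that)
qed

text \<open>Inserting \<open>X\<close> once more gives \<open>X(K) = -bK\<close>. The quotient rule
  then yields \<open>-(dK - b\<alpha>)/K + (-bK\<alpha> + K dK)/K^2\<close>, which is 0.\<close>

lemma d\<sigma>_X:
  assumes p: "p \<in> V"
  shows "ext_deriv A \<sigma> p (X p) v = 0" "ext_deriv A \<sigma> p v (X p) = 0"
proof -
  obtain b where b: "\<And>p v. ext_deriv A \<alpha> p (X p) v = dfun A K p v - b p * \<alpha> p v"
    using d\<alpha>_X by blast
  have nz: "K p \<noteq> 0" using p by (simp add: V_def)
  have \<alpha>X: "\<alpha> p (X p) = - K p" by (simp add: K_def)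
  have "ext_deriv A \<alpha> p (X p) (X p) = 0" using ext_deriv_antisym[of \<alpha> p "X p" "X p"] by simp
  then have KX: "dfun A K p (X p) = - b p * K p" using b[of p "X p"] \<alpha>X by simp
  show "ext_deriv A \<sigma> p (X p) v = 0"
    unfolding \<sigma>_def ext_deriv_quotient[OF \<alpha> K UNIV_I nz] b \<alpha>X KX using nz by (simp add: field_simps)
  then show "ext_deriv A \<sigma> p v (X p) = 0" using ext_deriv_antisym[of \<sigma> p v "X p"] by simp
qed

text \<open>Extends \<open>-H d\<sigma>(v, \<cdot>)\<close> from \<open>ker \<eta>\<close> to all tangent vectors so that \<open>R\<close> is annihilated, as it
  must be by \<open>\<iota>\<^sub>u d\<eta>\<close>.\<close>

definition rhs :: "'a \<Rightarrow> real ^ 'm \<Rightarrow> real ^ 'm \<Rightarrow> real" where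
  "rhs x v z = - (H x * ext_deriv A \<sigma> x v z) + \<eta> x z * (H x * ext_deriv A \<sigma> x v (R x))"

definition N :: "'a \<Rightarrow> real ^ 'm \<Rightarrow> real ^ 'm" where
  "N x v = (THE u. \<eta> x u = 0 \<and> (\<forall>z. ext_deriv A \<eta> x u z = rhs x v z))"

lemma N_ex1:
  assumes x: "x \<in> V"
  shows "\<exists>!u. \<eta> x u = 0 \<and> (\<forall>z. ext_deriv A \<eta> x u z = rhs x v z)"
proof (rule contact_solve)
  show "linear (rhs x v)"
    using ext_deriv_linear(2)[OF \<sigma> open_V x, of v] linear_\<eta>[of x]
    by (simp add: rhs_def[abs_def] linear_iff algebra_simps)
qed (simp add: rhs_def R)

lemma N:
  assumes x: "x \<in> V"
  shows "\<eta> x (N x v) = 0" "ext_deriv A \<eta> x (N x v) z = rhs x v z"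
  using theI'[OF N_ex1[OF x, of v]] unfolding N_def by auto

text \<open>Subtracting \<open>\<eta>(z) R\<close> moves any \<open>z\<close> into
  \<open>ker \<eta>\<close> without changing \<open>d\<eta>(u, z)\<close>, and \<open>rhs\<close> is
  built to match. All later identifications of a vector with \<open>N x v\<close> go through this
  test on \<open>ker \<eta>\<close>.\<close>

lemma N_unique:
  assumes x: "x \<in> V" and u: "\<eta> x u = 0"
    and ker: "\<And>z. \<eta> x z = 0 \<Longrightarrow> ext_deriv A \<eta> x u z = - H x * ext_deriv A \<sigma> x v z"
  shows "u = N x v"
proof -
  have "ext_deriv A \<eta> x u z = rhs x v z" for z
  proof -
    let ?z = "z - \<eta> x z *\<^sub>R R x"
    have "\<eta> x ?z = 0" by (simp add: linear_diff[OF linear_\<eta>] linear_scale[OF linear_\<eta>] R)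
    from ker[OF this] show ?thesis
      by (simp add: linear_diff[OF ext_deriv_linear(2)[OF \<eta> open_UNIV UNIV_I]]
          linear_scale[OF ext_deriv_linear(2)[OF \<eta> open_UNIV UNIV_I]]
          linear_diff[OF ext_deriv_linear(2)[OF \<sigma> open_V x]]
          linear_scale[OF ext_deriv_linear(2)[OF \<sigma> open_V x]] R rhs_def algebra_simps)
  qed
  then show ?thesis using N_ex1[OF x, of v] N[OF x, of v] u by blast
qed

lemma linear_N:
  assumes x: "x \<in> V"
  shows "linear (N x)"
proof (rule linearI)
  note l = linear_add[OF linear_\<eta>] linear_scale[OF linear_\<eta>]
    linear_add[OF ext_deriv_linear(1)[OF \<eta> open_UNIV UNIV_I]]
    linear_scale[OF ext_deriv_linear(1)[OF \<eta> open_UNIV UNIV_I]]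
    linear_add[OF ext_deriv_linear(1)[OF \<sigma> open_V x]]
    linear_scale[OF ext_deriv_linear(1)[OF \<sigma> open_V x]]
  show "N x (v + w) = N x v + N x w" for v w
    by (rule N_unique[OF x, symmetric]) (simp_all add: l N[OF x] rhs_def algebra_simps)
  show "N x (t *\<^sub>R v) = t *\<^sub>R N x v" for t v
    by (rule N_unique[OF x, symmetric]) (simp_all add: l N[OF x] rhs_def algebra_simps)
qed

text \<open>Since \<open>\<iota>_X d\<sigma> = 0\<close>, the zero vector solves the system that
  defines \<open>N x (X x)\<close>.\<close>

lemma N_X: "x \<in> V \<Longrightarrow> N x (X x) = 0"
  by (rule N_unique[symmetric])
    (simp_all add: linear_0[OF linear_\<eta>] linear_0[OF ext_deriv_linear(1)[OF \<eta> open_UNIV UNIV_I]] d\<sigma>_X)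

lemma N_zero: "x \<in> V \<Longrightarrow> H x = 0 \<Longrightarrow> N x v = 0"
  by (rule N_unique[symmetric])
    (simp_all add: linear_0[OF linear_\<eta>] linear_0[OF ext_deriv_linear(1)[OF \<eta> open_UNIV UNIV_I]])

text \<open>Every ingredient of the defining system is tensorial, so the equations keep their form
  in each chart, including the correction along \<open>R\<close>.\<close>

lemma N_rep:
  assumes c: "c \<in> A" and y: "y \<in> chart_region c V"
  shows "form_rep A c \<eta> y (endo_rep A c N y v) = 0"
    "exd (form_rep A c \<eta>) y (endo_rep A c N y v) z =
      - (H (chart_inv c y) * exd (form_rep A c \<sigma>) y v z)
      + form_rep A c \<eta> y z * (H (chart_inv c y) * exd (form_rep A c \<sigma>) y v (vf_rep A c R y))"
proof -
  let ?q = "chart_inv c y" and ?P = "coord_change c (chart_at A (chart_inv c y)) (chart_inv c y)"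
  have q: "?q \<in> chart_dom c" "?q \<in> V" using chart_inv_in[OF c y] by auto
  have P: "?P (endo_rep A c N y v) = N ?q (?P v)"
    using q c by (simp add: endo_rep_def Let_def coord_change_inverse chart_at)
  have e: "form_rep A c \<eta> y w = \<eta> ?q (?P w)" for w by (simp add: form_rep_def Let_def)
  show "form_rep A c \<eta> y (endo_rep A c N y v) = 0"
    by (simp add: e P N[OF q(2)])
  show "exd (form_rep A c \<eta>) y (endo_rep A c N y v) z =
      - (H ?q * exd (form_rep A c \<sigma>) y v z)
      + form_rep A c \<eta> y z * (H ?q * exd (form_rep A c \<sigma>) y v (vf_rep A c R y))"
    unfolding exd_rep[OF \<eta> open_V c y] exd_rep[OF \<sigma> open_V c y] P coord_change_vf_rep[OF c y] e
    by (simp add: N[OF q(2)] rhs_def)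
qed

lemma smooth_N: "smooth_endo A V N"
proof (rule smooth_endoI)
  show "linear (N p)" if "p \<in> V" for p by (rule linear_N[OF that])
  fix c v assume c: "c \<in> A"
  let ?S = "chart_region c V" and ?h = "\<lambda>y. H (chart_inv c y)"
  interpret s: local_form ?S "form_rep A c \<sigma>" by (rule local_form_rep[OF \<sigma> open_V c])
  have h: "smooth_on ?h ?S" by (rule smooth_funD[OF H c])
  have "smooth_on (\<lambda>y. exd (form_rep A c \<sigma>) y v (vf_rep A c R y)) ?S"
    by (rule smooth_on_apply[OF s.S s.exd_linear2 s.exd_smooth smooth_vfD[OF smooth_R c]])
  then have "smooth_on (\<lambda>y. - (?h y * exd (form_rep A c \<sigma>) y v z)
      + form_rep A c \<eta> y z * (?h y * exd (form_rep A c \<sigma>) y v (vf_rep A c R y))) ?S" for z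
    by (intro smooth_on_add smooth_on_minus smooth_on_mult s.S h s.exd_smooth smooth_formD[OF \<eta> c])
  then show "smooth_on (\<lambda>y. endo_rep A c N y v) ?S"
    by (rule smooth_contact_solution[OF c open_V _ smooth_on_const[of 0]]) (auto simp: N_rep[OF c])
qed

lemma local_canonoid_rep:
  assumes c: "c \<in> A"
  shows "local_canonoid (chart_region c V) (form_rep A c \<eta>) (form_rep A c \<sigma>) (\<lambda>y. H (chart_inv c y))
    (\<lambda>y. a (chart_inv c y)) (vf_rep A c X) (vf_rep A c R) (endo_rep A c N)"
proof (intro local_canonoid.intro local_canonoid_axioms.intro)
  fix y assume y: "y \<in> chart_region c V"
  have y': "y \<in> chart_region c UNIV" using y by (auto simp: chart_region_def)
  have q: "chart_inv c y \<in> V" using chart_inv_in[OF c y] by simp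
  show "linear (endo_rep A c N y)" by (rule endo_rep_linear[OF smooth_N c y])
  show "form_rep A c \<eta> y (vf_rep A c X y) = - H (chart_inv c y)" by (rule X_rep(1)[OF c y'])
  show "exd (form_rep A c \<eta>) y (vf_rep A c X y) v =
      frechet_derivative (\<lambda>y. H (chart_inv c y)) (at y) v - a (chart_inv c y) * form_rep A c \<eta> y v" for v
    by (rule X_rep(2)[OF c y'])
  show "exd (form_rep A c \<sigma>) y (vf_rep A c X y) v = 0" for v
    by (simp add: exd_rep[OF \<sigma> open_V c y] coord_change_vf_rep[OF c y] d\<sigma>_X[OF q])
  show "form_rep A c \<eta> y (vf_rep A c R y) = 1" by (simp add: form_apply_rep[OF c y] R)
  show "exd (form_rep A c \<eta>) y (vf_rep A c R y) v = 0" for v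
    by (simp add: exd_rep[OF \<eta> open_V c y] coord_change_vf_rep[OF c y] R)
  show "form_rep A c \<eta> y (endo_rep A c N y v) = 0" for v by (rule N_rep(1)[OF c y])
  show "exd (form_rep A c \<eta>) y (endo_rep A c N y v) w =
      - (H (chart_inv c y) * exd (form_rep A c \<sigma>) y v w)
      + form_rep A c \<eta> y w * (H (chart_inv c y) * exd (form_rep A c \<sigma>) y v (vf_rep A c R y))" for v w
    by (rule N_rep(2)[OF c y])
  show "u = 0" if "form_rep A c \<eta> y u = 0" "\<And>z. exd (form_rep A c \<eta>) y u z = 0" for u
    by (rule contact_space.nondeg[OF contact_space_rep[OF c y'] that])
qed (rule local_form_rep[OF \<eta> open_V c] local_form_rep[OF \<sigma> open_V c] smooth_funD[OF H c]
    smooth_funD[OF smooth_a c] smooth_vfD[OF smooth_X c] smooth_vfD[OF smooth_R c]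
    smooth_endoD[OF smooth_N c])+

lemma lie_N:
  assumes p: "p \<in> V"
  shows "lie_endo A X N p v = 0"
  using local_canonoid.lie_N[OF local_canonoid_rep[OF chart_at(1)] base_pt[OF p], of v]
  by (simp add: lie_endo_def vf_rep_base endo_rep_base)

lemma trace_rep:
  assumes c: "c \<in> A" and y: "y \<in> chart_region c V"
  shows "trace (matrix (endo_rep A c N y ^^ k)) = endo_trace N k (chart_inv c y)"
  by (rule endo_trace_rep[OF smooth_N c y])

lemma smooth_trace: "smooth_fun A V (endo_trace N k)"
proof (rule smooth_funI)
  fix c assume c: "c \<in> A"
  show "smooth_on (\<lambda>y. endo_trace N k (chart_inv c y)) (chart_region c V)"
    by (rule smooth_on_cong[OF open_region[OF c open_V] trace_rep[OF c]
          local_canonoid.trace_N(1)[OF local_canonoid_rep[OF c]]])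
qed

lemma trace_X:
  assumes p: "p \<in> V"
  shows "dfun A (endo_trace N k) p (X p) = 0"
proof -
  let ?c = "chart_at A p" and ?y = "base_pt A p"
  have c: "?c \<in> A" by (rule chart_at)
  have "dfun A (endo_trace N k) p (X p)
      = frechet_derivative (\<lambda>y. trace (matrix (endo_rep A ?c N y ^^ k))) (at ?y) (vf_rep A ?c X ?y)"
    unfolding dfun_base vf_rep_base
    by (rule fun_cong[OF frechet_derivative_cong[OF open_region[OF c open_V] base_pt[OF p]]])
      (simp add: trace_rep[OF c])
  then show ?thesis
    using local_canonoid.trace_N(2)[OF local_canonoid_rep[OF c] base_pt[OF p]] by simp
qed

section \<open>Characterisations of \<open>N\<close> by identities of sections\<close>

lemma contact_eqs_N: "contact_eqs A \<eta> H \<sigma> V N"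
  by (auto simp: contact_eqs_def N rhs_def)

lemma contact_eqs_unique:
  assumes N': "contact_eqs A \<eta> H \<sigma> V N'" and x: "x \<in> V"
  shows "N' x = N x"
proof
  fix v
  obtain Y where Y: "smooth_vf A V Y" "Y x = v" using vector_extension .
  show "N' x v = N x v"
  proof (rule N_unique[OF x])
    show "\<eta> x (N' x v) = 0"
      using N' Y x by (auto simp: contact_eqs_def)
    fix z assume z: "\<eta> x z = 0"
    obtain Z where Z: "smooth_vf A V Z" "Z x = z" using vector_extension .
    \<comment> \<open>An arbitrary extension of \<open>z\<close> need not stay in
      \<open>ker \<eta>\<close>; it is projected there along \<open>R\<close>. At \<open>x\<close>
      the projection changes nothing because \<open>\<eta> x z = 0\<close>.\<close>
    let ?Z = "\<lambda>q. Z q - \<eta> q (Z q) *\<^sub>R R q"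
    have "smooth_vf A V ?Z"
      by (rule smooth_vf_diff_scale[OF Z(1) smooth_R smooth_fun_contract[OF \<eta> Z(1) open_V] open_V])
    moreover have "\<eta> q (?Z q) = 0" for q
      by (simp add: linear_diff[OF linear_\<eta>] linear_scale[OF linear_\<eta>] R)
    ultimately have "ext_deriv A \<eta> x (N' x (Y x)) (?Z x) = - H x * ext_deriv A \<sigma> x (Y x) (?Z x)"
      using N' Y(1) x unfolding contact_eqs_def by blast
    then show "ext_deriv A \<eta> x (N' x v) z = - H x * ext_deriv A \<sigma> x v z"
      by (simp add: Y Z z)
  qed
qed

lemma d_lam:
  assumes "H x \<noteq> 0" "\<eta> x u = 0"
  shows "ext_deriv A lam x u z = - ext_deriv A \<eta> x u z / H x + dfun A H x u * \<eta> x z / (H x * H x)"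
  unfolding lam_def ext_deriv_quotient[OF \<eta> H UNIV_I assms(1)] assms(2) by simp

text \<open>Both \<open>\<iota>\<^sub>X d\<lambda>\<close> and \<open>\<iota>\<^sub>X d\<sigma>\<close> vanish, and where \<open>H\<close> is nonzero \<open>X\<close> spans a complement of \<open>ker \<eta>\<close>;
  hence it suffices to test against \<open>ker \<eta>\<close>.\<close>

lemma symplectic_iff:
  assumes x: "x \<in> U"
  shows "lam x u = 0 \<and> (\<forall>z. ext_deriv A lam x u z = ext_deriv A \<sigma> x v z) \<longleftrightarrow> u = N x v"
proof
  have H0: "H x \<noteq> 0" and xV: "x \<in> V" using x by (auto simp: U_def V_def)
  assume l: "lam x u = 0 \<and> (\<forall>z. ext_deriv A lam x u z = ext_deriv A \<sigma> x v z)"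
  then have u: "\<eta> x u = 0" using H0 by (simp add: lam_def)
  show "u = N x v"
  proof (rule N_unique[OF xV u])
    fix z assume "\<eta> x z = 0"
    then have "- ext_deriv A \<eta> x u z / H x = ext_deriv A \<sigma> x v z"
      using l d_lam[OF H0 u, of z] by simp
    then show "ext_deriv A \<eta> x u z = - H x * ext_deriv A \<sigma> x v z" using H0 by (auto simp: field_simps)
  qed
next
  have H0: "H x \<noteq> 0" and xV: "x \<in> V" using x by (auto simp: U_def V_def)
  assume u: "u = N x v"
  have \<eta>u: "\<eta> x u = 0" by (simp add: u N[OF xV])
  have "ext_deriv A lam x u z = ext_deriv A \<sigma> x v z" for z
  proof -
    define t where "t = \<eta> x z / H x"
    define w where "w = z + t *\<^sub>R X x"
    have w: "\<eta> x w = 0"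
      using H0 by (simp add: w_def t_def linear_add[OF linear_\<eta>] linear_scale[OF linear_\<eta>] X)
    have "ext_deriv A \<eta> x u (X x) = - dfun A H x u"
      using ext_deriv_antisym[of \<eta> x u "X x"] X(2)[of x u] \<eta>u by simp
    \<comment> \<open>The term \<open>t dH(u)\<close> will cancel the \<open>dH\<close>-term of
      \<open>d_lam\<close>, as \<open>t / H\<close> is \<open>\<eta>(z) / H^2\<close>.\<close>
    then have "ext_deriv A \<eta> x u z = ext_deriv A \<eta> x u w + t * dfun A H x u"
      by (simp add: w_def linear_add[OF ext_deriv_linear(2)[OF \<eta> open_UNIV UNIV_I]]
          linear_scale[OF ext_deriv_linear(2)[OF \<eta> open_UNIV UNIV_I]])
    moreover have "ext_deriv A \<eta> x u w = - (H x * ext_deriv A \<sigma> x v w)"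
      using N(2)[OF xV, of v w] w by (simp add: u rhs_def)
    moreover have "ext_deriv A \<sigma> x v w = ext_deriv A \<sigma> x v z"
      by (simp add: w_def linear_add[OF ext_deriv_linear(2)[OF \<sigma> open_V xV]]
          linear_scale[OF ext_deriv_linear(2)[OF \<sigma> open_V xV]] d\<sigma>_X[OF xV])
    ultimately show ?thesis
      unfolding d_lam[OF H0 \<eta>u] using H0 by (simp add: t_def field_simps)
  qed
  then show "lam x u = 0 \<and> (\<forall>z. ext_deriv A lam x u z = ext_deriv A \<sigma> x v z)"
    using \<eta>u by (simp add: lam_def)
qed

lemma symplectic_eqs_iff: "symplectic_eqs A lam \<sigma> U N' \<longleftrightarrow> (\<forall>x\<in>U. N' x = N x)"
proof
  assume s: "symplectic_eqs A lam \<sigma> U N'"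
  show "\<forall>x\<in>U. N' x = N x"
  proof (intro ballI ext)
    fix x v assume x: "x \<in> U"
    obtain Y where Y: "smooth_vf A U Y" "Y x = v" using vector_extension .
    have "ext_deriv A lam x (N' x v) z = ext_deriv A \<sigma> x v z" for z
    proof -
      obtain Z where "smooth_vf A U Z" "Z x = z" using vector_extension .
      then show ?thesis using s Y x unfolding symplectic_eqs_def by blast
    qed
    moreover have "lam x (N' x v) = 0" using s Y x unfolding symplectic_eqs_def by blast
    ultimately show "N' x v = N x v" using symplectic_iff[OF x] by blast
  qed
next
  assume "\<forall>x\<in>U. N' x = N x"
  then show "symplectic_eqs A lam \<sigma> U N'"
    using symplectic_iff unfolding symplectic_eqs_def by metis
qed

end

theorem proposition5:
  fixes A :: "('a::{t2_space,second_countable_topology}, 'm::finite) chart set"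
    and n :: nat
    and \<eta> \<alpha> \<sigma> lam :: "'a \<Rightarrow> real ^ 'm \<Rightarrow> real"
    and H a K :: "'a \<Rightarrow> real"
    and X :: "'a \<Rightarrow> real ^ 'm"
    and \<Phi> :: "'a \<Rightarrow> 'a"
    and V U :: "'a set"
  assumes "n \<ge> 1"
    and "contact_ham_system A n \<eta> H"
    and "contact_canonoid A \<eta> H \<Phi>"
    and "X = contact_ham_vf A \<eta> H"
    and "a = reeb_deriv A \<eta> H"
    and "\<alpha> = pullback A \<Phi> \<eta>"
    and "K = (\<lambda>x. - \<alpha> x (X x))"
    and "V = {x. K x \<noteq> 0}"
    and "\<sigma> = (\<lambda>x v. - \<alpha> x v / K x)"
    and "U = {x. H x * K x \<noteq> 0}"
    and "lam = (\<lambda>x v. - \<eta> x v / H x)"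
  shows "\<exists>N. smooth_endo A V N \<and> contact_eqs A \<eta> H \<sigma> V N
     \<and> (\<forall>N'. smooth_endo A V N' \<and> contact_eqs A \<eta> H \<sigma> V N' \<longrightarrow> (\<forall>x\<in>V. N' x = N x))
     \<and> (\<forall>x\<in>V. N x (X x) = 0)
     \<and> (\<forall>x\<in>V. \<forall>v. lie_endo A X N x v = 0)
     \<and> (\<forall>x\<in>V. H x = 0 \<longrightarrow> (\<forall>v. N x v = 0))
     \<and> (\<forall>N'. smooth_endo A U N' \<longrightarrow> (symplectic_eqs A lam \<sigma> U N' \<longleftrightarrow> (\<forall>x\<in>U. N' x = N x)))
     \<and> (\<forall>k\<ge>1. smooth_fun A V (endo_trace N k)
          \<and> smooth_fun A V (\<lambda>x. H x * endo_trace N k x)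
          \<and> (\<forall>x\<in>V. dfun A (endo_trace N k) x (X x) = 0)
          \<and> (\<forall>x\<in>V. dfun A (\<lambda>x. H x * endo_trace N k x) x (X x) = - a x * (H x * endo_trace N k x)))"
proof -
  interpret S: contact_canonoid_system A n \<eta> H \<Phi>
    using assms(2,3) by unfold_locales (simp_all add: contact_ham_system_def)
  have \<alpha>: "\<alpha> = S.\<alpha>" by (simp add: S.\<alpha>_def assms(6))
  have K: "K = S.K" by (simp add: S.K_def assms(7,4) \<alpha>)
  have V: "V = S.V" by (simp add: S.V_def assms(8) K)
  have \<sigma>: "\<sigma> = S.\<sigma>" by (simp add: S.\<sigma>_def assms(9) K \<alpha>)
  have U: "U = S.U" by (simp add: S.U_def assms(10) K)
  have lam: "lam = S.lam" by (simp add: S.lam_def assms(11))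
  \<comment> \<open>Product rule: the trace is constant along \<open>X\<close>, so the whole weight
    \<open>-a\<close> comes from \<open>X(H) = -aH\<close>.\<close>
  have D: "dfun A (\<lambda>x. H x * endo_trace S.N k x) x (S.X x) = - S.a x * (H x * endo_trace S.N k x)"
    if "x \<in> S.V" for k x
    using that by (simp add: S.dfun_mult[OF S.H S.smooth_trace] S.trace_X S.dH_X)
  show ?thesis
    unfolding V \<sigma> U lam assms(4,5)
  proof (intro exI[of _ S.N] conjI allI impI ballI)
    show "smooth_endo A S.V S.N" by (rule S.smooth_N)
    show "contact_eqs A \<eta> H S.\<sigma> S.V S.N" by (rule S.contact_eqs_N)
    show "N' x = S.N x" if "smooth_endo A S.V N' \<and> contact_eqs A \<eta> H S.\<sigma> S.V N'" "x \<in> S.V" for N' x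
      by (rule S.contact_eqs_unique[OF conjunct2[OF that(1)] that(2)])
    show "S.N x (S.X x) = 0" if "x \<in> S.V" for x by (rule S.N_X[OF that])
    show "lie_endo A S.X S.N x v = 0" if "x \<in> S.V" for x v by (rule S.lie_N[OF that])
    show "S.N x v = 0" if "x \<in> S.V" "H x = 0" for x v by (rule S.N_zero[OF that])
    show "symplectic_eqs A S.lam S.\<sigma> S.U N' \<longleftrightarrow> (\<forall>x\<in>S.U. N' x = S.N x)" for N'
      by (rule S.symplectic_eqs_iff)
    show "smooth_fun A S.V (endo_trace S.N k)" for k by (rule S.smooth_trace)
    show "smooth_fun A S.V (\<lambda>x. H x * endo_trace S.N k x)" for k
      by (rule S.smooth_fun_mult[OF S.open_V S.H S.smooth_trace])
    show "dfun A (endo_trace S.N k) x (S.X x) = 0" if "x \<in> S.V" for k x by (rule S.trace_X[OF that])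
  qed (rule D)
qed

end
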